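(* Fix $n\in\mathbb N$. Let $\varphi\in L^1(\mathbb R)$ be such that there exist constants $A,B,C>0$ with $$A\frac{e^{-2\pi|\xi|}}{1+\xi^{2n}}\leq|\widehat{\varphi}(\xi)|\leq B(1+\xi^{2n})e^{-2\pi|\xi|}\quad\text{and}\quad |(\widehat{\varphi})'(\xi)|\leq C(1+\xi^{2n})e^{-2\pi|\xi|}$$ for all $\xi\in\mathbb R$. Let $\Lambda\subseteq\mathbb R$ be a discrete set. Then $\{\varphi(t-\lambda):\lambda\in\Lambda\}$ spans $L^1(\mathbb R)$ if and only if $\sum_{\lambda\in\Lambda}e^{-\frac{\pi}{2}|\lambda|}=\infty$.
   Context: $\widehat{\varphi}(\xi)=\int_{\mathbb R}\varphi(t)e^{-2\pi i t\xi}\,dt$. A family spans $L^1(\mathbb R)$ if its finite linear combinations are dense in $L^1(\mathbb R)$. *)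

theory Defs
  imports "HOL-Analysis.Analysis"
begin

definition fourier_transform :: "(real \<Rightarrow> complex) \<Rightarrow> real \<Rightarrow> complex" where
  "fourier_transform \<phi> \<xi> =
     (\<integral>t. \<phi> t * exp (- 2 * complex_of_real pi * \<i> * complex_of_real (t * \<xi>)) \<partial>lborel)"

definition L1 :: "(real \<Rightarrow> complex) \<Rightarrow> bool" where
  "L1 f \<longleftrightarrow> integrable lborel f"

definition spans_L1 :: "'i set \<Rightarrow> ('i \<Rightarrow> real \<Rightarrow> complex) \<Rightarrow> bool" where
  "spans_L1 I g \<longleftrightarrow>
     (\<forall>f. L1 f \<longrightarrow> (\<forall>\<epsilon>>0. \<exists>F c. finite F \<and> F \<subseteq> I \<and>
        integrable lborel (\<lambda>t. f t - (\<Sum>i\<in>F. c i * g i t)) \<and>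
        (\<integral>t. norm (f t - (\<Sum>i\<in>F. c i * g i t)) \<partial>lborel) < \<epsilon>))"

text \<open>Discrete subset of R: no finite accumulation point, i.e. finitely many points in every
  bounded interval.\<close>
definition discrete_set :: "real set \<Rightarrow> bool" where
  "discrete_set \<Lambda> \<longleftrightarrow> (\<forall>R. finite (\<Lambda> \<inter> {-R..R}))"

end

theory Submission
  imports Defs "HOL-Probability.Probability" "HOL-Complex_Analysis.Complex_Analysis"
begin

text \<open>
  Write \<open>\<Phi>\<close> for the Fourier transform of \<open>\<phi>\<close>. The decay of \<open>\<Phi>\<close> lets the translates \<open>\<phi>(\<cdot> - z)\<close> be
  continued to the strip \<open>\<bar>Im z\<bar> < 1\<close>, and \<open>\<Sum> exp (- \<pi>\<bar>\<lambda>\<bar>/2) < \<infinity>\<close> is the Blaschke condition for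
  real points of that strip.

  If the sum diverges, it diverges on one side, say for \<open>\<lambda> \<rightarrow> +\<infinity>\<close>. With \<open>u = exp (- \<pi> z / 2)\<close> the
  points \<open>\<lambda> > 0\<close> lie in the disc \<open>\<bar>u - 1\<bar> < 1\<close>, which touches the boundary of the half plane
  \<open>Re u > 0\<close> (the image of the strip) only at \<open>u = 0\<close>; there the factor \<open>u\<^sup>m\<close> compensates the
  growth of \<open>u\<^bsup>4i\<xi>\<^esup> = exp (- 2\<pi> i z \<xi>)\<close>. Cauchy's formula, with the kernel multiplied by the
  reciprocal of a finite Blaschke product, gives coefficients such that
  \<open>\<rho>(\<xi>) = 1 - \<Sum> d\<^sub>\<lambda> exp (- 2\<pi> i \<lambda> \<xi>)\<close> and \<open>\<rho>'\<close> are bounded by a constant times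
  \<open>\<Prod> (1 - u\<^sub>\<lambda>) exp (2\<pi>\<bar>\<xi>\<bar>) (1 + \<bar>\<xi>\<bar>)\<^bsup>-m\<^esup>\<close>. Then \<open>\<Phi> \<rho>\<close> and its derivative are small in a weighted
  supremum norm, so its transform \<open>\<phi> - \<Sum> d\<^sub>\<lambda> \<phi>(\<cdot> - \<lambda>)\<close> is small in \<open>L\<^sup>1\<close>. By translation all
  translates of \<open>\<phi>\<close> lie in the closed span; as Gaussians have the form \<open>h * \<phi>\<close> with \<open>h\<close> integrable,
  this span is everything.

  If the sum converges, then for each finite \<open>S \<subseteq> \<Lambda>\<close> there is a function \<open>F\<^sub>S\<close>, a Gaussian times
  a finite Blaschke product, which vanishes on \<open>S\<close> and is of the form
  \<open>F\<^sub>S(x) = \<integral> \<phi>(t - x) g\<^sub>S(t) dt\<close> with \<open>\<bar>g\<^sub>S\<bar>\<close> bounded independently of \<open>S\<close>. The Blaschke factors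
  are taken for a domain slightly larger than the strip, so that Cauchy's estimates control all
  derivatives up to the boundary and the transform of \<open>F\<^sub>S\<close> can be divided by \<open>\<Phi>\<close>. At a point
  \<open>x \<notin> \<Lambda>\<close> the values \<open>\<bar>F\<^sub>S(x)\<bar>\<close> are bounded below, hence \<open>\<phi>(\<cdot> - x)\<close> stays away from the span.
\<close>

section \<open>Fourier inversion by Gaussian means\<close>

text \<open>The strip has no room to spare: for |Im z| < 1 the size of exp (- 2 pi i z \<xi>) can
  come arbitrarily close to exp (2 pi |\<xi>|), the reciprocal of the exponential decay of \<Phi>.
  The factors 1 + \<xi>^(2n) in the bounds for \<Phi> cannot be absorbed by a narrower or wider
  strip, since that would change the exponent pi / 2. So both directions have to gain powers of
  \<xi> at the critical width. In the divergent case tangency supplies them: on the circle, |u| is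
  comparable to the angle between u and the imaginary axis, and this angle is what u^(4 i \<xi>)
  gains over exp (2 pi |\<xi>|). In the convergent case they come from integration by parts. The
  margin around the strip shrinks like exp (- pi |x| / 2), so the j-th Cauchy estimate loses exp (j
  pi |x| / 2), which the Gaussian outweighs. Returning from transforms to the L1 norm costs one
  derivative in L2; there, and in the integrability of h, the bound on the derivative of \<Phi>
  enters.\<close>

lemma exp_eq_cis:
  "exp (- 2 * complex_of_real pi * \<i> * complex_of_real x) = cis (- 2 * pi * x)"
  by (simp add: cis_conv_exp mult_ac)

lemma fourier_transform_cis:
  "fourier_transform f \<xi> = (\<integral>t. f t * cis (- 2 * pi * (t * \<xi>)) \<partial>lborel)"
  unfolding fourier_transform_def exp_eq_cis ..

lemma borel_measurable_cis [measurable (raw)]: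
  "f \<in> borel_measurable M \<Longrightarrow> (\<lambda>x. cis (f x)) \<in> borel_measurable M"
  by (rule borel_measurable_continuous_on[where f=cis]) (auto intro: continuous_on_cis continuous_on_id)

lemma integrable_times_cis [intro]:
  assumes "integrable M f" "g \<in> borel_measurable M"
  shows "integrable M (\<lambda>t. f t * cis (g t))"
proof (rule Bochner_Integration.integrable_bound[OF assms(1)])
  show "(\<lambda>t. f t * cis (g t)) \<in> borel_measurable M"
    using borel_measurable_integrable[OF assms(1)] assms(2) by measurable
qed (simp add: norm_mult)

lemma norm_fourier_transform_le:
  "norm (fourier_transform f \<xi>) \<le> (\<integral>t. norm (f t) \<partial>lborel)"
proof -
  have "norm (fourier_transform f \<xi>) \<le> (\<integral>t. norm (f t * cis (- 2 * pi * (t * \<xi>))) \<partial>lborel)"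
    unfolding fourier_transform_cis by (rule integral_norm_bound)
  then show ?thesis by (simp add: norm_mult)
qed

lemma isCont_fourier_transform:
  assumes "integrable lborel f"
  shows "isCont (fourier_transform f) \<xi>"
  unfolding continuous_at_sequentially comp_def fourier_transform_cis
proof safe
  fix X :: "nat \<Rightarrow> real" assume X: "X \<longlonglongrightarrow> \<xi>"
  note [measurable] = borel_measurable_integrable[OF assms]
  show "(\<lambda>n. \<integral>t. f t * cis (- 2 * pi * (t * X n)) \<partial>lborel)
          \<longlonglongrightarrow> (\<integral>t. f t * cis (- 2 * pi * (t * \<xi>)) \<partial>lborel)"
    by (rule integral_dominated_convergence[where w="\<lambda>t. norm (f t)"])
       (use assms in \<open>auto simp: norm_mult intro!: tendsto_intros AE_I2 X tendsto_cis\<close>)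
qed

lemma continuous_fourier_transform:
  "integrable lborel f \<Longrightarrow> continuous_on A (fourier_transform f)"
  by (simp add: isCont_fourier_transform continuous_at_imp_continuous_on)

lemma borel_measurable_fourier_transform:
  "integrable lborel f \<Longrightarrow> fourier_transform f \<in> borel_measurable borel"
  by (intro borel_measurable_continuous_onI continuous_fourier_transform)

lemma integrable_lborel_translate:
  fixes f :: "real \<Rightarrow> 'a :: {banach, second_countable_topology}"
  shows "integrable lborel f \<Longrightarrow> integrable lborel (\<lambda>t. f (t - x))"
  using lborel_integrable_real_affine[of f 1 "-x"] by (simp add: algebra_simps)

lemma integral_lborel_translate:
  fixes f :: "real \<Rightarrow> 'a :: {banach, second_countable_topology}"
  shows "(\<integral>t. f (t - x) \<partial>lborel) = (\<integral>t. f t \<partial>lborel)"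
  using lborel_integral_real_affine[of 1 f "-x"] by (simp add: algebra_simps)

lemma integral_lborel_reflect:
  fixes f :: "real \<Rightarrow> 'a :: {banach, second_countable_topology}"
  shows "(\<integral>s. f (t - s) \<partial>lborel) = (\<integral>s. f s \<partial>lborel)"
  using lborel_integral_real_affine[of "-1" f t] by (simp add: algebra_simps)

lemma integrable_lborel_reflect:
  fixes f :: "real \<Rightarrow> 'a :: {banach, second_countable_topology}"
  shows "integrable lborel f \<Longrightarrow> integrable lborel (\<lambda>s. f (t - s))"
  using lborel_integrable_real_affine[of f "-1" t] by (simp add: algebra_simps)

lemma fourier_transform_translate:
  "fourier_transform (\<lambda>t. f (t - x)) \<xi> = cis (- 2 * pi * (x * \<xi>)) * fourier_transform f \<xi>"
proof -
  have "fourier_transform (\<lambda>t. f (t - x)) \<xi> =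
      (\<integral>t. f (t - x) * cis (- 2 * pi * ((t - x) * \<xi>)) * cis (- 2 * pi * (x * \<xi>)) \<partial>lborel)"
    unfolding fourier_transform_cis
    by (rule Bochner_Integration.integral_cong) (auto simp: mult.assoc cis_mult algebra_simps)
  also have "\<dots> = (\<integral>t. f t * cis (- 2 * pi * (t * \<xi>)) * cis (- 2 * pi * (x * \<xi>)) \<partial>lborel)"
    by (rule integral_lborel_translate[where f="\<lambda>t. f t * cis (- 2 * pi * (t * \<xi>)) * cis (- 2 * pi * (x * \<xi>))"])
  finally show ?thesis unfolding fourier_transform_cis by simp
qed

lemma fourier_transform_modulate:
  "fourier_transform (\<lambda>\<xi>. f \<xi> * cis (2 * pi * (x * \<xi>))) t = fourier_transform f (t - x)"
  unfolding fourier_transform_cis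
  by (rule Bochner_Integration.integral_cong) (auto simp: mult.assoc cis_mult algebra_simps)

section \<open>Fubini and the multiplication formula\<close>

lemma integrable_tensor:
  fixes f g :: "real \<Rightarrow> 'a :: {real_normed_div_algebra, banach, second_countable_topology}"
  assumes f: "integrable lborel f" and g: "integrable lborel g"
  shows "integrable (lborel \<Otimes>\<^sub>M lborel) (\<lambda>(x, y). f x * g y)"
proof (rule lborel_pair.Fubini_integrable)
  note [measurable] = borel_measurable_integrable[OF f] borel_measurable_integrable[OF g]
  show "(\<lambda>(x, y). f x * g y) \<in> borel_measurable (lborel \<Otimes>\<^sub>M lborel)" by measurable
qed (use f g in \<open>auto simp: norm_mult\<close>)

lemma integrable_convolution_pair:
  fixes f g :: "real \<Rightarrow> 'a :: {real_normed_div_algebra, banach, second_countable_topology}"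
  assumes f: "integrable lborel f" and g: "integrable lborel g"
  shows "integrable (lborel \<Otimes>\<^sub>M lborel) (\<lambda>(s, t). f s * g (t - s))"
proof (rule lborel_pair.Fubini_integrable)
  note [measurable] = borel_measurable_integrable[OF f] borel_measurable_integrable[OF g]
  show "(\<lambda>(s, t). f s * g (t - s)) \<in> borel_measurable (lborel \<Otimes>\<^sub>M lborel)" by measurable
qed (use f g in \<open>auto simp: norm_mult integral_lborel_translate[where f="\<lambda>t. norm (g t)"]
  integrable_lborel_translate\<close>)

text \<open>Fubini's theorem for the kernel \<open>cis (- 2 * pi * (t * \<xi>))\<close>. With a
  modulated Gaussian as second function it produces the means behind inversion; it also carries the
  duality computation in \<open>annihilator\<close>.\<close>

lemma fourier_transform_multiplication:
  assumes f: "integrable lborel f" and g: "integrable lborel g"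
  shows "(\<integral>\<xi>. fourier_transform f \<xi> * g \<xi> \<partial>lborel) = (\<integral>t. f t * fourier_transform g t \<partial>lborel)"
proof -
  note [measurable] = borel_measurable_integrable[OF f] borel_measurable_integrable[OF g]
  have "integrable (lborel \<Otimes>\<^sub>M lborel) (\<lambda>(t, \<xi>). f t * g \<xi> * cis (- 2 * pi * (t * \<xi>)))"
    by (rule Bochner_Integration.integrable_bound[OF integrable_tensor[OF f g]])
       (measurable, auto simp: norm_mult)
  from lborel_pair.Fubini_integral[OF this]
  have "(\<integral>\<xi>. (\<integral>t. f t * g \<xi> * cis (- 2 * pi * (t * \<xi>)) \<partial>lborel) \<partial>lborel)
      = (\<integral>t. (\<integral>\<xi>. f t * g \<xi> * cis (- 2 * pi * (t * \<xi>)) \<partial>lborel) \<partial>lborel)" .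
  moreover have "(\<integral>t. f t * g \<xi> * cis (- 2 * pi * (t * \<xi>)) \<partial>lborel) = fourier_transform f \<xi> * g \<xi>" for \<xi>
    unfolding fourier_transform_cis by (subst integral_mult_left_zero[symmetric]) (simp add: mult_ac)
  moreover have "(\<integral>\<xi>. f t * g \<xi> * cis (- 2 * pi * (t * \<xi>)) \<partial>lborel) = f t * fourier_transform g t" for t
    unfolding fourier_transform_cis by (subst integral_mult_right_zero[symmetric]) (simp add: mult_ac)
  ultimately show ?thesis by simp
qed

text \<open>Scaled so that its transform is the normal density of standard deviation \<sigma>; as
  \<sigma> tends to 0 the weight tends to 1 while the density concentrates at 0.\<close>

definition gauss_weight :: "real \<Rightarrow> real \<Rightarrow> real" where
  "gauss_weight \<sigma> \<xi> = exp (- 2 * pi\<^sup>2 * \<sigma>\<^sup>2 * \<xi>\<^sup>2)"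

lemma gauss_weight_measurable [measurable]: "gauss_weight \<sigma> \<in> borel_measurable borel"
  unfolding gauss_weight_def by measurable

lemma gauss_weight_bounds: "0 < gauss_weight \<sigma> \<xi>" "gauss_weight \<sigma> \<xi> \<le> 1"
  by (auto simp: gauss_weight_def)

lemma gauss_weight_eq_density:
  assumes "\<sigma> > 0"
  shows "gauss_weight \<sigma> \<xi> = sqrt (2 * pi) * std_normal_density (2 * pi * \<sigma> * \<xi>)"
  using assms by (simp add: gauss_weight_def std_normal_density_def power_mult_distrib)

lemma integrable_gauss_weight:
  assumes "\<sigma> > 0"
  shows "integrable lborel (gauss_weight \<sigma>)"
proof -
  have "integrable lborel (\<lambda>x. std_normal_density (0 + (2 * pi * \<sigma>) * x))"
    by (rule lborel_integrable_real_affine) (use assms in auto)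
  then show ?thesis
    unfolding gauss_weight_eq_density[OF assms, abs_def] by simp
qed

text \<open>The substitution x = 2 pi \<sigma> \<xi> reduces the transform to the characteristic
  function of the standard normal distribution at - t / \<sigma>.\<close>

lemma fourier_transform_gauss_weight:
  assumes "\<sigma> > 0"
  shows "fourier_transform (\<lambda>\<xi>. of_real (gauss_weight \<sigma> \<xi>)) t = of_real (normal_density 0 \<sigma> t)"
proof -
  define c where "c = 2 * pi * \<sigma>"
  have c: "c > 0" using assms by (simp add: c_def)
  have N: "(\<integral>x. of_real (std_normal_density x) * cis (- (t / \<sigma>) * x) \<partial>lborel) =
      complex_of_real (exp (- (t / \<sigma>)\<^sup>2 / 2))"
  proof -
    have "char std_normal_distribution (- (t / \<sigma>)) =
        (\<integral>x. std_normal_density x *\<^sub>R iexp (- (t / \<sigma>) * x) \<partial>lborel)"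
      unfolding char_def by (subst integral_density) auto
    then show ?thesis
      by (simp add: char_std_normal_distribution cis_conv_exp scaleR_conv_of_real)
  qed
  have "(\<integral>x. of_real (std_normal_density x) * cis (- (t / \<sigma>) * x) \<partial>lborel) =
      c *\<^sub>R (\<integral>\<xi>. of_real (std_normal_density (c * \<xi>)) * cis (- (t / \<sigma>) * (c * \<xi>)) \<partial>lborel)"
    using c by (subst lborel_integral_real_affine[of c _ 0]) auto
  also have "(\<lambda>\<xi>. - (t / \<sigma>) * (c * \<xi>)) = (\<lambda>\<xi>. - 2 * pi * (\<xi> * t))"
    using assms by (auto simp: c_def)
  finally have I: "(\<integral>\<xi>. of_real (std_normal_density (c * \<xi>)) * cis (- 2 * pi * (\<xi> * t)) \<partial>lborel)
      = complex_of_real (exp (- (t / \<sigma>)\<^sup>2 / 2) / c)"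
    using N c by (simp add: scaleR_conv_of_real field_simps)
  have "fourier_transform (\<lambda>\<xi>. of_real (gauss_weight \<sigma> \<xi>)) t =
      of_real (sqrt (2 * pi)) *
        (\<integral>\<xi>. of_real (std_normal_density (c * \<xi>)) * cis (- 2 * pi * (\<xi> * t)) \<partial>lborel)"
    unfolding fourier_transform_cis gauss_weight_eq_density[OF assms] c_def
    by (subst integral_mult_right_zero[symmetric]) (simp add: mult_ac)
  also have "\<dots> = of_real (sqrt (2 * pi) * (exp (- (t / \<sigma>)\<^sup>2 / 2) / c))"
    unfolding I by simp
  also have "sqrt (2 * pi) * (exp (- (t / \<sigma>)\<^sup>2 / 2) / c) = normal_density 0 \<sigma> t"
  proof -
    have "sqrt (2 * pi) / c = 1 / sqrt (2 * pi * \<sigma>\<^sup>2)"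
      using assms by (simp add: c_def real_sqrt_mult field_simps)
    then have "sqrt (2 * pi) * (exp (- (t / \<sigma>)\<^sup>2 / 2) / c) = 1 / sqrt (2 * pi * \<sigma>\<^sup>2) * exp (- (t / \<sigma>)\<^sup>2 / 2)"
      by (metis times_divide_eq_left times_divide_eq_right)
    then show ?thesis
      by (simp add: normal_density_def power_divide)
  qed
  finally show ?thesis .
qed

lemma normal_density_symmetric: "normal_density 0 \<sigma> (s - t) = normal_density 0 \<sigma> (t - s)"
  by (simp add: normal_density_def power2_commute)

text \<open>The multiplication formula with a modulated weight: damping the inversion integral is
  the same as smoothing \<open>f\<close> by a normal density. Inversion compares the limits of the
  two sides as \<sigma> tends to 0.\<close>

lemma gauss_summability:
  assumes f: "integrable lborel f" and \<sigma>: "\<sigma> > 0"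
  shows "(\<integral>\<xi>. fourier_transform f \<xi> * (of_real (gauss_weight \<sigma> \<xi>) * cis (2 * pi * (t * \<xi>))) \<partial>lborel)
       = (\<integral>s. f s * of_real (normal_density 0 \<sigma> (t - s)) \<partial>lborel)"
proof -
  have "integrable lborel (\<lambda>\<xi>. complex_of_real (gauss_weight \<sigma> \<xi>) * cis (2 * pi * (t * \<xi>)))"
    by (rule integrable_times_cis) (use integrable_gauss_weight[OF \<sigma>] in auto)
  from fourier_transform_multiplication[OF f this] show ?thesis
    by (simp add: fourier_transform_modulate fourier_transform_gauss_weight[OF \<sigma>]
        normal_density_symmetric[of \<sigma> _ t])
qed

lemma gauss_weight_tendsto: "((\<lambda>n. gauss_weight (1 / real (Suc n)) \<xi>) \<longlongrightarrow> 1) sequentially"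
proof -
  have "(\<lambda>n. exp (- 2 * pi\<^sup>2 * (1 / real (Suc n))\<^sup>2 * \<xi>\<^sup>2)) \<longlonglongrightarrow> exp (- 2 * pi\<^sup>2 * 0\<^sup>2 * \<xi>\<^sup>2)"
    by (intro tendsto_intros LIMSEQ_Suc[OF lim_1_over_n])
  then show ?thesis by (simp add: gauss_weight_def)
qed

lemma gauss_means_tendsto_inverse:
  assumes f: "integrable lborel f" and ff: "integrable lborel (fourier_transform f)"
  shows "(\<lambda>n. \<integral>s. f s * of_real (normal_density 0 (1 / real (Suc n)) (t - s)) \<partial>lborel)
      \<longlonglongrightarrow> fourier_transform (fourier_transform f) (- t)"
proof -
  note [measurable] = borel_measurable_integrable[OF ff]
  have "(\<lambda>n. \<integral>\<xi>. fourier_transform f \<xi> *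
           (of_real (gauss_weight (1 / real (Suc n)) \<xi>) * cis (2 * pi * (t * \<xi>))) \<partial>lborel)
      \<longlonglongrightarrow> (\<integral>\<xi>. fourier_transform f \<xi> * (of_real 1 * cis (2 * pi * (t * \<xi>))) \<partial>lborel)"
  proof (rule integral_dominated_convergence[where w="\<lambda>\<xi>. norm (fourier_transform f \<xi>)"])
    show "AE \<xi> in lborel. (\<lambda>n. fourier_transform f \<xi> *
           (of_real (gauss_weight (1 / real (Suc n)) \<xi>) * cis (2 * pi * (t * \<xi>))))
        \<longlonglongrightarrow> fourier_transform f \<xi> * (of_real 1 * cis (2 * pi * (t * \<xi>)))"
      by (intro AE_I2 tendsto_intros gauss_weight_tendsto)
    show "AE \<xi> in lborel. norm (fourier_transform f \<xi> *
           (of_real (gauss_weight (1 / real (Suc n)) \<xi>) * cis (2 * pi * (t * \<xi>))))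
        \<le> norm (fourier_transform f \<xi>)" for n
      using gauss_weight_bounds[of "1 / real (Suc n)"]
      by (intro AE_I2) (auto simp: norm_mult less_imp_le intro!: mult_left_le)
  qed (use ff in auto)
  moreover have "(\<integral>\<xi>. fourier_transform f \<xi> * (of_real 1 * cis (2 * pi * (t * \<xi>))) \<partial>lborel)
      = fourier_transform (fourier_transform f) (- t)"
    by (simp add: fourier_transform_cis[of "fourier_transform f"] mult_ac)
  ultimately show ?thesis
    by (simp add: gauss_summability[OF f])
qed

text \<open>Moves \<sigma> from the kernel into the argument of \<open>f\<close>; the Gaussian is
  then fixed and can serve as dominating function.\<close>

lemma gauss_mean_rescale:
  fixes f :: "real \<Rightarrow> complex"
  assumes "\<sigma> > 0"
  shows "(\<integral>s. f s * of_real (normal_density 0 \<sigma> (t - s)) \<partial>lborel) =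
         (\<integral>r. f (t - \<sigma> * r) * of_real (std_normal_density r) \<partial>lborel)"
proof -
  have D: "\<sigma> * normal_density 0 \<sigma> (\<sigma> * r) = std_normal_density r" for r
    using assms by (simp add: normal_density_def real_sqrt_mult power_mult_distrib field_simps)
  have "(\<integral>s. f s * of_real (normal_density 0 \<sigma> (t - s)) \<partial>lborel) =
      \<sigma> *\<^sub>R (\<integral>r. f (t - \<sigma> * r) * of_real (normal_density 0 \<sigma> (\<sigma> * r)) \<partial>lborel)"
    using assms by (subst lborel_integral_real_affine[of "-\<sigma>" _ t]) auto
  also have "\<dots> = (\<integral>r. f (t - \<sigma> * r) * of_real (\<sigma> * normal_density 0 \<sigma> (\<sigma> * r)) \<partial>lborel)"
    unfolding integral_scaleR_right[symmetric] by (simp add: scaleR_conv_of_real mult_ac)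
  finally show ?thesis unfolding D .
qed

lemma fourier_inversion_continuous:
  assumes f: "integrable lborel f" and ff: "integrable lborel (fourier_transform f)"
    and cont: "continuous_on UNIV f" and bdd: "\<And>x. norm (f x) \<le> K"
  shows "fourier_transform (fourier_transform f) (- t) = f t"
proof (rule LIMSEQ_unique[OF gauss_means_tendsto_inverse[OF f ff]])
  note [measurable] = borel_measurable_integrable[OF f]
  have C: "isCont f x" for x using cont by (simp add: continuous_on_eq_continuous_at)
  have "(\<lambda>n. \<integral>r. f (t - 1 / real (Suc n) * r) * of_real (std_normal_density r) \<partial>lborel)
      \<longlonglongrightarrow> (\<integral>r. f t * of_real (std_normal_density r) \<partial>lborel)"
  proof (rule integral_dominated_convergence[where w="\<lambda>r. K * std_normal_density r"])
    show "AE r in lborel. (\<lambda>n. f (t - 1 / real (Suc n) * r) * of_real (std_normal_density r))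
        \<longlonglongrightarrow> f t * of_real (std_normal_density r)"
    proof (intro AE_I2 tendsto_mult tendsto_const isCont_tendsto_compose[OF C])
      fix r :: real
      have "(\<lambda>n. t - 1 / real (Suc n) * r) \<longlonglongrightarrow> t - 0 * r"
        by (intro tendsto_intros LIMSEQ_Suc[OF lim_1_over_n])
      then show "(\<lambda>n. t - 1 / real (Suc n) * r) \<longlonglongrightarrow> t" by simp
    qed
    show "AE r in lborel. norm (f (t - 1 / real (Suc n) * r) * of_real (std_normal_density r))
        \<le> K * std_normal_density r" for n
      by (intro AE_I2) (auto simp: norm_mult intro!: mult_right_mono bdd)
  qed auto
  then show "(\<lambda>n. \<integral>s. f s * of_real (normal_density 0 (1 / real (Suc n)) (t - s)) \<partial>lborel) \<longlonglongrightarrow> f t"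
    by (simp add: gauss_mean_rescale)
qed

section \<open>Plancherel's inequality and integrability of Fourier transforms\<close>

lemma borel_measurable_cnj [measurable (raw)]:
  "f \<in> borel_measurable M \<Longrightarrow> (\<lambda>x. cnj (f x)) \<in> borel_measurable M"
  by (rule borel_measurable_continuous_on[where f=cnj]) (auto intro: continuous_on_cnj continuous_on_id)

text \<open>True also for functions that are not integrable, whose integral is 0 by
  convention.\<close>

lemma norm_integral_le_nn_integral:
  fixes f :: "_ \<Rightarrow> 'a :: {banach, second_countable_topology}"
  shows "ennreal (norm (integral\<^sup>L M f)) \<le> (\<integral>\<^sup>+x. norm (f x) \<partial>M)"
  by (cases "integrable M f")
     (auto simp: integral_norm_bound_ennreal not_integrable_integral_eq)

lemma nn_integral_normal_density:
  assumes "\<sigma> > 0"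
  shows "(\<integral>\<^sup>+s. ennreal (normal_density 0 \<sigma> (t - s)) \<partial>lborel) = 1"
proof -
  have "(\<integral>\<^sup>+s. ennreal (normal_density 0 \<sigma> (t - s)) \<partial>lborel) =
      ennreal (\<integral>s. normal_density 0 \<sigma> (t - s) \<partial>lborel)"
    by (intro nn_integral_eq_integral integrable_lborel_reflect) (use assms in auto)
  then show ?thesis
    using assms by (simp add: integral_lborel_reflect[where f="normal_density 0 \<sigma>"])
qed

text \<open>By the multiplication formula the left side is the integral of \<open>u\<close> against
  the conjugate of its own Gaussian mean. Then 2ab \<le> a^2 + b^2 separates the two values of
  \<open>u\<close>, and the kernel has mass 1 in either variable. The right side may be infinite,
  whence the extended integrals.\<close>

lemma plancherel_gauss_le:
  assumes u: "integrable lborel u" and \<sigma>: "\<sigma> > 0"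
  shows "(\<integral>\<^sup>+t. ennreal ((norm (fourier_transform u t))\<^sup>2 * gauss_weight \<sigma> t) \<partial>lborel)
       \<le> (\<integral>\<^sup>+\<xi>. ennreal ((norm (u \<xi>))\<^sup>2) \<partial>lborel)"
proof -
  note [measurable] = borel_measurable_integrable[OF u] borel_measurable_fourier_transform[OF u]
  let ?k = "normal_density 0 \<sigma>" and ?U = "fourier_transform u"
  define K where "K = (\<integral>t. norm (u t) \<partial>lborel)"
  have K: "norm (?U t) \<le> K" for t unfolding K_def by (rule norm_fourier_transform_le)
  have "K \<ge> 0" unfolding K_def by simp
  have int1: "integrable lborel (\<lambda>t. (norm (?U t))\<^sup>2 * gauss_weight \<sigma> t)"
  proof (rule Bochner_Integration.integrable_bound)
    show "integrable lborel (\<lambda>t. K\<^sup>2 * gauss_weight \<sigma> t)" using integrable_gauss_weight[OF \<sigma>] by simp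
  qed (use K in \<open>auto intro!: AE_I2 mult_mono power_mono simp: gauss_weight_bounds less_imp_le\<close>)
  have int2: "integrable lborel (\<lambda>t. cnj (?U t) * of_real (gauss_weight \<sigma> t))"
  proof (rule Bochner_Integration.integrable_bound)
    show "integrable lborel (\<lambda>t. K * gauss_weight \<sigma> t)" using integrable_gauss_weight[OF \<sigma>] by simp
    show "(\<lambda>t. cnj (?U t) * of_real (gauss_weight \<sigma> t)) \<in> borel_measurable lborel" by measurable
  qed (use K \<open>K \<ge> 0\<close> in \<open>auto intro!: AE_I2 mult_mono simp: norm_mult gauss_weight_bounds less_imp_le\<close>)
  have conj: "fourier_transform (\<lambda>t. cnj (?U t) * of_real (gauss_weight \<sigma> t)) \<xi> =
      cnj (\<integral>s. u s * of_real (?k (\<xi> - s)) \<partial>lborel)" for \<xi>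
    unfolding gauss_summability[OF u \<sigma>, symmetric] fourier_transform_cis[of "\<lambda>t. cnj (?U t) * _ t"]
    by (subst Bochner_Integration.integral_cnj[symmetric], rule Bochner_Integration.integral_cong)
       (simp_all add: cis_cnj mult_ac)
  have "complex_of_real (\<integral>t. (norm (?U t))\<^sup>2 * gauss_weight \<sigma> t \<partial>lborel) =
      (\<integral>t. ?U t * (cnj (?U t) * of_real (gauss_weight \<sigma> t)) \<partial>lborel)"
    unfolding integral_complex_of_real[symmetric]
    by (rule Bochner_Integration.integral_cong) (auto simp: complex_norm_square[symmetric] simp flip: mult.assoc)
  also have "\<dots> = (\<integral>\<xi>. u \<xi> * cnj (\<integral>s. u s * of_real (?k (\<xi> - s)) \<partial>lborel) \<partial>lborel)"
    unfolding fourier_transform_multiplication[OF u int2] conj ..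
  finally have eq: "complex_of_real (\<integral>t. (norm (?U t))\<^sup>2 * gauss_weight \<sigma> t \<partial>lborel) = \<dots>" .
  have "ennreal (\<integral>t. (norm (?U t))\<^sup>2 * gauss_weight \<sigma> t \<partial>lborel) =
      ennreal (norm (complex_of_real (\<integral>t. (norm (?U t))\<^sup>2 * gauss_weight \<sigma> t \<partial>lborel)))"
    by (simp add: integral_nonneg gauss_weight_bounds less_imp_le)
  also have "\<dots> \<le> (\<integral>\<^sup>+\<xi>. norm (u \<xi> * cnj (\<integral>s. u s * of_real (?k (\<xi> - s)) \<partial>lborel)) \<partial>lborel)"
    unfolding eq by (rule norm_integral_le_nn_integral)
  also have "\<dots> \<le> (\<integral>\<^sup>+\<xi>. \<integral>\<^sup>+s. ennreal (norm (u \<xi>) * (norm (u s) * ?k (\<xi> - s))) \<partial>lborel \<partial>lborel)"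
  proof (rule nn_integral_mono)
    fix \<xi>
    have "ennreal (norm (u \<xi> * cnj (\<integral>s. u s * of_real (?k (\<xi> - s)) \<partial>lborel))) =
        ennreal (norm (u \<xi>)) * ennreal (norm (\<integral>s. u s * of_real (?k (\<xi> - s)) \<partial>lborel))"
      by (simp add: norm_mult ennreal_mult)
    also have "\<dots> \<le> ennreal (norm (u \<xi>)) * (\<integral>\<^sup>+s. norm (u s * of_real (?k (\<xi> - s))) \<partial>lborel)"
      by (intro mult_left_mono norm_integral_le_nn_integral) auto
    also have "\<dots> = (\<integral>\<^sup>+s. ennreal (norm (u \<xi>) * (norm (u s) * ?k (\<xi> - s))) \<partial>lborel)"
      by (subst nn_integral_cmult[symmetric]) (auto simp: norm_mult ennreal_mult)
    finally show "ennreal (norm (u \<xi> * cnj (\<integral>s. u s * of_real (?k (\<xi> - s)) \<partial>lborel))) \<le> \<dots>" .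
  qed
  also have "\<dots> \<le> (\<integral>\<^sup>+\<xi>. \<integral>\<^sup>+s. (ennreal ((norm (u \<xi>))\<^sup>2 / 2) * ennreal (?k (\<xi> - s)) +
        ennreal ((norm (u s))\<^sup>2 / 2) * ennreal (?k (\<xi> - s))) \<partial>lborel \<partial>lborel)"
  proof (intro nn_integral_mono)
    fix \<xi> s
    have "norm (u \<xi>) * norm (u s) \<le> (norm (u \<xi>))\<^sup>2 / 2 + (norm (u s))\<^sup>2 / 2"
      using sum_squares_bound[of "norm (u \<xi>)" "norm (u s)"] by simp
    then have "norm (u \<xi>) * norm (u s) * ?k (\<xi> - s) \<le> ((norm (u \<xi>))\<^sup>2 / 2 + (norm (u s))\<^sup>2 / 2) * ?k (\<xi> - s)"
      by (rule mult_right_mono) simp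
    then show "ennreal (norm (u \<xi>) * (norm (u s) * ?k (\<xi> - s))) \<le>
        ennreal ((norm (u \<xi>))\<^sup>2 / 2) * ennreal (?k (\<xi> - s)) + ennreal ((norm (u s))\<^sup>2 / 2) * ennreal (?k (\<xi> - s))"
      by (simp add: ennreal_mult[symmetric] ennreal_plus[symmetric] distrib_right mult.assoc
           del: ennreal_plus)
  qed
  also have "\<dots> = (\<integral>\<^sup>+\<xi>. \<integral>\<^sup>+s. ennreal ((norm (u \<xi>))\<^sup>2 / 2) * ennreal (?k (\<xi> - s)) \<partial>lborel \<partial>lborel) +
      (\<integral>\<^sup>+\<xi>. \<integral>\<^sup>+s. ennreal ((norm (u s))\<^sup>2 / 2) * ennreal (?k (\<xi> - s)) \<partial>lborel \<partial>lborel)"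
    by (simp add: nn_integral_add)
  also have "(\<integral>\<^sup>+\<xi>. \<integral>\<^sup>+s. ennreal ((norm (u s))\<^sup>2 / 2) * ennreal (?k (\<xi> - s)) \<partial>lborel \<partial>lborel) =
      (\<integral>\<^sup>+s. \<integral>\<^sup>+\<xi>. ennreal ((norm (u s))\<^sup>2 / 2) * ennreal (?k (\<xi> - s)) \<partial>lborel \<partial>lborel)"
    by (rule lborel_pair.Fubini') measurable
  also have "\<dots> = (\<integral>\<^sup>+s. ennreal ((norm (u s))\<^sup>2 / 2) \<partial>lborel)"
    using nn_integral_normal_density[OF \<sigma>]
    by (simp add: nn_integral_cmult normal_density_symmetric[of \<sigma> _ s for s])
  also have "(\<integral>\<^sup>+\<xi>. \<integral>\<^sup>+s. ennreal ((norm (u \<xi>))\<^sup>2 / 2) * ennreal (?k (\<xi> - s)) \<partial>lborel \<partial>lborel) =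
      (\<integral>\<^sup>+s. ennreal ((norm (u s))\<^sup>2 / 2) \<partial>lborel)"
    using nn_integral_normal_density[OF \<sigma>] by (simp add: nn_integral_cmult)
  also have "(\<integral>\<^sup>+s. ennreal ((norm (u s))\<^sup>2 / 2) \<partial>lborel) + (\<integral>\<^sup>+s. ennreal ((norm (u s))\<^sup>2 / 2) \<partial>lborel) =
      (\<integral>\<^sup>+s. ennreal ((norm (u s))\<^sup>2) \<partial>lborel)"
    by (subst nn_integral_add[symmetric])
       (auto simp: ennreal_plus[symmetric] simp del: ennreal_plus)
  finally show ?thesis
    using nn_integral_eq_integral[OF int1] by (simp add: gauss_weight_bounds less_imp_le)
qed

text \<open>Fatou's lemma along \<sigma> = 1 / (n + 1).\<close>

lemma plancherel_le:
  assumes u: "integrable lborel u"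
  shows "(\<integral>\<^sup>+t. ennreal ((norm (fourier_transform u t))\<^sup>2) \<partial>lborel)
       \<le> (\<integral>\<^sup>+\<xi>. ennreal ((norm (u \<xi>))\<^sup>2) \<partial>lborel)"
proof -
  note [measurable] = borel_measurable_integrable[OF u] borel_measurable_fourier_transform[OF u]
  let ?g = "\<lambda>n t. ennreal ((norm (fourier_transform u t))\<^sup>2 * gauss_weight (1 / real (Suc n)) t)"
  have "(\<lambda>n. ?g n t) \<longlonglongrightarrow> ennreal ((norm (fourier_transform u t))\<^sup>2 * 1)" for t
    by (intro tendsto_ennrealI tendsto_intros gauss_weight_tendsto)
  then have "(\<integral>\<^sup>+t. ennreal ((norm (fourier_transform u t))\<^sup>2) \<partial>lborel) = (\<integral>\<^sup>+t. liminf (\<lambda>n. ?g n t) \<partial>lborel)"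
    by (intro nn_integral_cong lim_imp_Liminf[symmetric]) auto
  also have "\<dots> \<le> liminf (\<lambda>n. \<integral>\<^sup>+t. ?g n t \<partial>lborel)"
    by (rule nn_integral_liminf) measurable
  also have "\<dots> \<le> liminf (\<lambda>n. \<integral>\<^sup>+\<xi>. ennreal ((norm (u \<xi>))\<^sup>2) \<partial>lborel)"
    by (intro Liminf_mono always_eventually allI plancherel_gauss_le u) simp
  finally show ?thesis by (simp add: Liminf_const)
qed

section \<open>Functions with decay of order 1 / (1 + x^2)\<close>

lemma has_bochner_integral_inverse_1_plus_square:
  "has_bochner_integral lborel (\<lambda>x::real. 1 / (1 + x\<^sup>2)) pi"
  using integrable_inverse_1_plus_square LBINT_inverse_1_plus_square
  by (simp add: has_bochner_integral_iff set_integrable_def interval_lebesgue_integral_def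
      set_lebesgue_integral_def inverse_eq_divide)

lemma nn_integral_inverse_1_plus_square:
  "(\<integral>\<^sup>+x. ennreal (1 / (1 + (x::real)\<^sup>2)) \<partial>lborel) = ennreal pi"
  using has_bochner_integral_inverse_1_plus_square
  by (subst nn_integral_eq_integral) (auto simp: has_bochner_integral_iff)

lemma one_plus_square_gt_0 [simp]: "0 < 1 + (x::real)\<^sup>2" "1 + x\<^sup>2 \<noteq> 0"
  using add_pos_nonneg[of 1 "x\<^sup>2"] by auto

lemma integrable_decay:
  assumes "u \<in> borel_measurable borel" "\<And>x. norm (u x :: complex) \<le> M / (1 + x\<^sup>2)"
  shows "integrable lborel u"
proof (rule Bochner_Integration.integrable_bound)
  show "integrable lborel (\<lambda>x. M * (1 / (1 + x\<^sup>2)))"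
    using has_bochner_integral_inverse_1_plus_square
    by (intro integrable_mult_right) (auto simp: has_bochner_integral_iff)
  have "norm (u x) \<le> norm (M * (1 / (1 + x\<^sup>2)))" for x 
  proof -
    have "M / (1 + x\<^sup>2) \<le> \<bar>M\<bar> / (1 + x\<^sup>2)" by (intro divide_right_mono) auto
    then show ?thesis using assms(2)[of x] by simp
  qed
  then show "AE x in lborel. norm (u x) \<le> norm (M * (1 / (1 + x\<^sup>2)))" by simp
qed (use assms(1) in simp)

lemma nn_integral_square_decay:
  assumes "M \<ge> 0" "\<And>x. norm (u x :: complex) \<le> M / (1 + x\<^sup>2)"
  shows "(\<integral>\<^sup>+x. ennreal ((norm (u x))\<^sup>2) \<partial>lborel) \<le> ennreal (M\<^sup>2 * pi)"
proof -
  have "(\<integral>\<^sup>+x. ennreal ((norm (u x))\<^sup>2) \<partial>lborel) \<le> (\<integral>\<^sup>+x. ennreal (M\<^sup>2) * ennreal (1 / (1 + x\<^sup>2)) \<partial>lborel)"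
  proof (rule nn_integral_mono)
    fix x :: real
    have "(norm (u x))\<^sup>2 \<le> (M / (1 + x\<^sup>2))\<^sup>2" by (intro power_mono assms) simp
    also have "\<dots> = M\<^sup>2 * ((1 / (1 + x\<^sup>2)) * (1 / (1 + x\<^sup>2)))" by (simp add: power2_eq_square)
    also have "\<dots> \<le> M\<^sup>2 * (1 / (1 + x\<^sup>2) * 1)"
      by (intro mult_left_mono) auto
    finally have "(norm (u x))\<^sup>2 \<le> M\<^sup>2 * (1 / (1 + x\<^sup>2))" by simp
    then show "ennreal ((norm (u x))\<^sup>2) \<le> ennreal (M\<^sup>2) * ennreal (1 / (1 + x\<^sup>2))"
      by (subst ennreal_mult[symmetric]) (auto intro!: ennreal_leI)
  qed
  also have "\<dots> = ennreal (M\<^sup>2 * pi)"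
    by (subst nn_integral_cmult) (auto simp: nn_integral_inverse_1_plus_square ennreal_mult)
  finally show ?thesis .
qed

text \<open>Points with |x - y| \<le> 1 satisfy 1 + x^2 \<le> 3 (1 + y^2), so the mean value
  inequality loses only a factor 3, uniformly in \<open>h\<close>. Difference quotients stand in for
  \<open>u'\<close>, about whose continuity nothing is assumed.\<close>

lemma difference_quotient_decay:
  fixes u :: "real \<Rightarrow> complex"
  assumes M: "M \<ge> 0" and d: "\<And>x. (u has_vector_derivative u' x) (at x)"
    and b: "\<And>x. norm (u' x) \<le> M / (1 + x\<^sup>2)" and h: "0 < h" "h \<le> 1"
  shows "norm ((u (x - h) - u x) / of_real h) \<le> 3 * M / (1 + x\<^sup>2)"
proof -
  have "norm (u (x - h) - u x) \<le> (3 * M / (1 + x\<^sup>2)) * norm ((x - h) - x)"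
  proof (rule differentiable_bound[where S="{x-h..x}" and f'="\<lambda>y t. t *\<^sub>R u' y"])
    fix y assume y: "y \<in> {x-h..x}"
    show "(u has_derivative (\<lambda>t. t *\<^sub>R u' y)) (at y within {x - h..x})"
      using d[of y] unfolding has_vector_derivative_def by (rule has_derivative_at_withinI)
    have s: "(x - y)\<^sup>2 \<le> 1" using y h by (simp add: abs_square_le_1)
    have "x\<^sup>2 \<le> 2 * (x - y)\<^sup>2 + 2 * y\<^sup>2"
      using sum_squares_bound[of "x - y" y] by (simp add: power2_eq_square algebra_simps)
    then have "1 + x\<^sup>2 \<le> 3 * (1 + y\<^sup>2)" 
    proof -
      have "1 + x\<^sup>2 \<le> 1 + (2 * 1 + 2 * y\<^sup>2)"
        by (rule add_left_mono, rule order_trans[OF \<open>x\<^sup>2 \<le> _\<close>]) (use s in simp)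
      also have "\<dots> \<le> 3 * (1 + y\<^sup>2)" by simp
      finally show ?thesis .
    qed
    then have "M * (1 + x\<^sup>2) \<le> M * (3 * (1 + y\<^sup>2))"
      using M by (rule mult_left_mono)
    then have "M / (1 + y\<^sup>2) \<le> 3 * M / (1 + x\<^sup>2)"
      by (subst frac_le_eq) (auto simp: divide_le_0_iff algebra_simps)
    then have "norm (u' y) \<le> 3 * M / (1 + x\<^sup>2)" using b[of y] by simp
    then show "onorm (\<lambda>t. t *\<^sub>R u' y) \<le> 3 * M / (1 + x\<^sup>2)"
      by (intro onorm_le) (simp only: norm_scaleR mult.commute[of _ "norm t" for t] real_norm_def mult_right_mono abs_ge_zero)
  qed (use h in auto)
  then show ?thesis using h by (simp add: norm_divide field_simps)
qed

text \<open>Bernstein-type bound: one derivative in \<open>L\<^sup>2\<close> makes the transform integrable, since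
  \<open>\<bar>v\<bar> \<le> ((1 + t\<^sup>2) \<bar>v\<bar>\<^sup>2 / M + M / (1 + t\<^sup>2)) / 2\<close>.\<close>
lemma fourier_transform_decay:
  fixes u :: "real \<Rightarrow> complex"
  assumes M: "M > 0" and d: "\<And>x. (u has_vector_derivative u' x) (at x)"
    and b0: "\<And>x. norm (u x) \<le> M / (1 + x\<^sup>2)"
    and b1: "\<And>x. norm (u' x) \<le> M / (1 + x\<^sup>2)"
  shows "integrable lborel (fourier_transform u)" (is ?int)
    and "(\<integral>t. norm (fourier_transform u t) \<partial>lborel) \<le> 6 * pi * M" (is ?le)
proof -
  have "continuous_on UNIV u"
    by (intro continuous_at_imp_continuous_on ballI has_vector_derivative_continuous[OF d])
  then have mu [measurable]: "u \<in> borel_measurable borel"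
    by (rule borel_measurable_continuous_onI)
  have u: "integrable lborel u" using mu b0 by (rule integrable_decay)
  note [measurable] = borel_measurable_fourier_transform[OF u]
  let ?U = "fourier_transform u"
  define h where "h n = 1 / real (Suc n)" for n
  have h: "0 < h n" "h n \<le> 1" for n by (auto simp: h_def)
  have h0: "h \<longlonglongrightarrow> 0" unfolding h_def by (rule LIMSEQ_Suc[OF lim_1_over_n])
  have A: "(\<integral>\<^sup>+t. ennreal ((norm (?U t))\<^sup>2) \<partial>lborel) \<le> ennreal (M\<^sup>2 * pi)"
    using plancherel_le[OF u] nn_integral_square_decay[of M u] b0 M by force
  let ?D = "\<lambda>n x. (u (x - h n) - u x) / of_real (h n)"
  have FD: "fourier_transform (?D n) t = (cis (- 2 * pi * (h n * t)) - 1) / of_real (h n) * ?U t" for n t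
  proof -
    have "fourier_transform (?D n) t =
        (fourier_transform (\<lambda>x. u (x - h n)) t - ?U t) / of_real (h n)"
      unfolding fourier_transform_cis
      by (subst Bochner_Integration.integral_diff[symmetric])
         (auto simp: algebra_simps diff_divide_distrib u integrable_lborel_translate
            simp flip: integral_divide_zero)
    then show ?thesis by (simp add: fourier_transform_translate field_simps)
  qed
  have B1: "(\<integral>\<^sup>+t. ennreal ((norm (fourier_transform (?D n) t))\<^sup>2) \<partial>lborel) \<le> ennreal ((3 * M)\<^sup>2 * pi)" for n
  proof -
    have dec: "norm (?D n x) \<le> 3 * M / (1 + x\<^sup>2)" for x
      using M d b1 h by (intro difference_quotient_decay) auto
    have "integrable lborel (?D n)"
      using dec by (intro integrable_decay[where M="3*M"]) auto
    from plancherel_le[OF this] show ?thesis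
      using nn_integral_square_decay[of "3 * M" "?D n"] dec M by force
  qed
  have lim: "(\<lambda>n. norm (fourier_transform (?D n) t)) \<longlonglongrightarrow> 2 * pi * \<bar>t\<bar> * norm (?U t)" for t
  proof -
    define c where "c = \<i> * complex_of_real (- 2 * pi * t)"
    have "((\<lambda>z. exp (c * z)) has_field_derivative c) (at 0)"
      by (auto intro!: derivative_eq_intros)
    then have "((\<lambda>z. (exp (c * z) - 1) / z) \<longlongrightarrow> c) (at 0)"
      by (simp add: DERIV_def)
    then have "(\<lambda>n. (exp (c * of_real (h n)) - 1) / of_real (h n)) \<longlonglongrightarrow> c"
      by (rule filterlim_compose)
         (use h tendsto_of_real[OF h0, where 'a=complex] in \<open>auto simp: filterlim_at less_imp_neq[symmetric]\<close>)
    moreover have "exp (c * of_real (h n)) = cis (- 2 * pi * (h n * t))" for n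
      by (simp add: c_def cis_conv_exp mult_ac)
    ultimately have "(\<lambda>n. norm ((cis (- 2 * pi * (h n * t)) - 1) / of_real (h n) * ?U t)) \<longlonglongrightarrow> norm (c * ?U t)"
      by (intro tendsto_intros) simp
    then show ?thesis unfolding FD by (simp add: c_def norm_mult abs_mult)
  qed
  \<comment> \<open>Translation multiplies the transform by a character, so the transforms of the
    difference quotients tend in modulus to 2 pi |t| times that of \<open>u\<close>. Fatou's lemma
    carries their common bound over to the limit.\<close>
  have B: "(\<integral>\<^sup>+t. ennreal ((2 * pi * \<bar>t\<bar> * norm (?U t))\<^sup>2) \<partial>lborel) \<le> ennreal ((3 * M)\<^sup>2 * pi)"
  proof -
    have "(\<integral>\<^sup>+t. ennreal ((2 * pi * \<bar>t\<bar> * norm (?U t))\<^sup>2) \<partial>lborel) =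
        (\<integral>\<^sup>+t. liminf (\<lambda>n. ennreal ((norm (fourier_transform (?D n) t))\<^sup>2)) \<partial>lborel)"
    proof (intro nn_integral_cong lim_imp_Liminf[symmetric])
      fix t
      show "(\<lambda>n. ennreal ((norm (fourier_transform (?D n) t))\<^sup>2)) \<longlonglongrightarrow> ennreal ((2 * pi * \<bar>t\<bar> * norm (?U t))\<^sup>2)"
        by (intro tendsto_ennrealI tendsto_power lim)
    qed simp
    also have "\<dots> \<le> liminf (\<lambda>n. \<integral>\<^sup>+t. ennreal ((norm (fourier_transform (?D n) t))\<^sup>2) \<partial>lborel)"
      unfolding FD by (rule nn_integral_liminf) measurable
    also have "\<dots> \<le> liminf (\<lambda>n. ennreal ((3 * M)\<^sup>2 * pi))"
      by (intro Liminf_mono always_eventually allI B1)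
    finally show ?thesis by (simp add: Liminf_const)
  qed
  have "(\<integral>\<^sup>+t. ennreal (norm (?U t)) \<partial>lborel) \<le>
      (\<integral>\<^sup>+t. (ennreal (1 / (2 * M)) * ennreal ((norm (?U t))\<^sup>2) +
        ennreal (1 / (2 * M)) * ennreal ((2 * pi * \<bar>t\<bar> * norm (?U t))\<^sup>2)) +
        ennreal (M / 2) * ennreal (1 / (1 + t\<^sup>2)) \<partial>lborel)"
  proof (rule nn_integral_mono)
    fix t :: real
    define a where "a = norm (?U t)"
    have a: "a \<ge> 0" by (simp add: a_def)
    have "0 \<le> ((1 + t\<^sup>2) * a - M)\<^sup>2" by simp
    then have "2 * M * ((1 + t\<^sup>2) * a) \<le> ((1 + t\<^sup>2) * a)\<^sup>2 + M\<^sup>2"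
      by (simp add: power2_diff algebra_simps)
    also have "\<dots> = ((1 + t\<^sup>2) * a\<^sup>2 + M\<^sup>2 / (1 + t\<^sup>2)) * (1 + t\<^sup>2)"
    proof -
      have "M\<^sup>2 / (1 + t\<^sup>2) * (1 + t\<^sup>2) = M\<^sup>2" by simp
      then show ?thesis by (simp only: distrib_right[of "(1 + t\<^sup>2) * a\<^sup>2"]) (simp add: power2_eq_square)
    qed
    finally have "2 * M * a * (1 + t\<^sup>2) \<le> ((1 + t\<^sup>2) * a\<^sup>2 + M\<^sup>2 / (1 + t\<^sup>2)) * (1 + t\<^sup>2)"
      by (simp add: mult_ac)
    then have "2 * M * a \<le> (1 + t\<^sup>2) * a\<^sup>2 + M\<^sup>2 / (1 + t\<^sup>2)"
      by (simp only: mult_le_cancel_right) auto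
    also have "(1 + t\<^sup>2) * a\<^sup>2 \<le> a\<^sup>2 + (2 * pi * \<bar>t\<bar> * a)\<^sup>2"
    proof -
      have "1 \<le> 2 * pi" using pi_gt3 by simp
      then have "1\<^sup>2 \<le> (2 * pi)\<^sup>2" by (intro power_mono) auto
      then have "1 * (t\<^sup>2 * a\<^sup>2) \<le> (2 * pi)\<^sup>2 * (t\<^sup>2 * a\<^sup>2)" by (intro mult_right_mono) auto
      then show ?thesis by (simp add: power_mult_distrib algebra_simps)
    qed
    finally have "2 * M * a / (2 * M) \<le> (a\<^sup>2 + (2 * pi * \<bar>t\<bar> * a)\<^sup>2 + M\<^sup>2 / (1 + t\<^sup>2)) / (2 * M)"
      using M by (intro divide_right_mono) auto
    also have "\<dots> = (1 / (2 * M) * a\<^sup>2 + 1 / (2 * M) * (2 * pi * \<bar>t\<bar> * a)\<^sup>2) + M / 2 * (1 / (1 + t\<^sup>2))"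
      using M by (simp add: add_divide_distrib power2_eq_square)
    finally have "a \<le> (1 / (2 * M) * a\<^sup>2 + 1 / (2 * M) * (2 * pi * \<bar>t\<bar> * a)\<^sup>2) + M / 2 * (1 / (1 + t\<^sup>2))"
      using M by simp
    then show "ennreal (norm (?U t)) \<le> (ennreal (1 / (2 * M)) * ennreal ((norm (?U t))\<^sup>2) +
        ennreal (1 / (2 * M)) * ennreal ((2 * pi * \<bar>t\<bar> * norm (?U t))\<^sup>2)) +
        ennreal (M / 2) * ennreal (1 / (1 + t\<^sup>2))"
      unfolding a_def[symmetric] using M a
      by (simp add: ennreal_mult[symmetric] ennreal_plus[symmetric] del: ennreal_plus)
  qed
  also have "\<dots> = ennreal (1 / (2 * M)) * (\<integral>\<^sup>+t. ennreal ((norm (?U t))\<^sup>2) \<partial>lborel) +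
        ennreal (1 / (2 * M)) * (\<integral>\<^sup>+t. ennreal ((2 * pi * \<bar>t\<bar> * norm (?U t))\<^sup>2) \<partial>lborel) +
        ennreal (M / 2) * ennreal pi"
    by (simp add: nn_integral_add nn_integral_cmult nn_integral_inverse_1_plus_square)
  also have "\<dots> \<le> ennreal (1 / (2 * M)) * ennreal (M\<^sup>2 * pi) +
        ennreal (1 / (2 * M)) * ennreal ((3 * M)\<^sup>2 * pi) + ennreal (M / 2) * ennreal pi"
    by (intro add_mono mult_left_mono A B) auto
  also have "\<dots> = ennreal (1 / (2 * M) * (M\<^sup>2 * pi) + 1 / (2 * M) * ((3 * M)\<^sup>2 * pi) + M / 2 * pi)"
    using M by (simp add: ennreal_mult[symmetric] ennreal_plus[symmetric] del: ennreal_plus)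
  \<comment> \<open>The shares are 1/2 from the transform, 9/2 from the difference quotients with
    their factor 3, and 1/2 from the weight; the total 11/2 is rounded up to 6.\<close>
  also have "1 / (2 * M) * (M\<^sup>2 * pi) + 1 / (2 * M) * ((3 * M)\<^sup>2 * pi) + M / 2 * pi = 11/2 * pi * M"
    using M by (simp add: power2_eq_square field_simps)
  also have "ennreal (11/2 * pi * M) \<le> ennreal (6 * pi * M)" using M by (intro ennreal_leI) auto
  finally have fin: "(\<integral>\<^sup>+t. ennreal (norm (?U t)) \<partial>lborel) \<le> ennreal (6 * pi * M)" .
  then show ?int
    by (intro integrableI_bounded) (auto intro: le_less_trans)
  then show ?le
    using fin M by (subst (asm) nn_integral_eq_integral) (auto simp: ennreal_le_iff)
qed

section \<open>Closed subspaces of the integrable functions\<close>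

lemma integrable_indicator_Icc [simp]:
  "integrable lborel (indicator {a..b::real} :: real \<Rightarrow> 'a :: {real_normed_algebra_1, banach, second_countable_topology})"
proof -
  have "integrable lborel (\<lambda>t. indicator {a..b} t *\<^sub>R (1 :: 'a))"
    by (intro integrable_indicator) (auto simp: emeasure_lborel_Icc_eq)
  moreover have "(\<lambda>t. indicator {a..b} t *\<^sub>R (1 :: 'a)) = indicator {a..b}"
    by (auto simp: indicator_def)
  ultimately show ?thesis by simp
qed

text \<open>Made of functions, not of classes modulo null sets; the last clause lets a member be
  replaced by any integrable function equal to it almost everywhere.\<close>

definition closed_L1_subspace :: "(real \<Rightarrow> complex) set \<Rightarrow> bool" where
  "closed_L1_subspace V \<longleftrightarrow>
     (\<forall>f\<in>V. integrable lborel f) \<and> (\<lambda>_. 0) \<in> V \<and>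
     (\<forall>f\<in>V. \<forall>g\<in>V. (\<lambda>t. f t + g t) \<in> V) \<and>
     (\<forall>c. \<forall>f\<in>V. (\<lambda>t. c * f t) \<in> V) \<and>
     (\<forall>f. integrable lborel f \<longrightarrow>
        (\<forall>\<epsilon>>0. \<exists>g\<in>V. (\<integral>t. norm (f t - g t) \<partial>lborel) < \<epsilon>) \<longrightarrow> f \<in> V)"

lemma
  assumes "closed_L1_subspace V"
  shows closed_L1_subspace_integrable: "f \<in> V \<Longrightarrow> integrable lborel f"
    and closed_L1_subspace_zero: "(\<lambda>_. 0) \<in> V"
    and closed_L1_subspace_add: "f \<in> V \<Longrightarrow> g \<in> V \<Longrightarrow> (\<lambda>t. f t + g t) \<in> V"
    and closed_L1_subspace_cmult: "f \<in> V \<Longrightarrow> (\<lambda>t. c * f t) \<in> V"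
    and closed_L1_subspace_closed: "integrable lborel f \<Longrightarrow>
        (\<And>\<epsilon>. \<epsilon> > 0 \<Longrightarrow> \<exists>g\<in>V. (\<integral>t. norm (f t - g t) \<partial>lborel) < \<epsilon>) \<Longrightarrow> f \<in> V"
  using assms unfolding closed_L1_subspace_def by blast+

lemma closed_L1_subspace_diff:
  assumes V: "closed_L1_subspace V" and fg: "f \<in> V" "g \<in> V"
  shows "(\<lambda>t. f t - g t) \<in> V"
  using closed_L1_subspace_add[OF V fg(1) closed_L1_subspace_cmult[OF V fg(2), of "-1"]] by simp

lemma closed_L1_subspace_sum:
  assumes V: "closed_L1_subspace V" and f: "\<And>i. i \<in> I \<Longrightarrow> f i \<in> V"
  shows "(\<lambda>t. \<Sum>i\<in>I. f i t) \<in> V"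
  using f
  by (induction I rule: infinite_finite_induct)
     (auto intro: closed_L1_subspace_zero[OF V] closed_L1_subspace_add[OF V])

lemma closed_L1_subspace_limit:
  assumes V: "closed_L1_subspace V" and f: "integrable lborel f"
    and s: "\<And>n. s n \<in> V" and lim: "(\<lambda>n. \<integral>t. norm (f t - s n t) \<partial>lborel) \<longlonglongrightarrow> 0"
  shows "f \<in> V"
proof (rule closed_L1_subspace_closed[OF V f])
  fix \<epsilon> :: real assume "\<epsilon> > 0"
  with lim have "\<forall>\<^sub>F n in sequentially. (\<integral>t. norm (f t - s n t) \<partial>lborel) < \<epsilon>"
    by (rule order_tendstoD)
  then obtain n where "(\<integral>t. norm (f t - s n t) \<partial>lborel) < \<epsilon>"
    by (auto simp: eventually_sequentially)
  then show "\<exists>g\<in>V. (\<integral>t. norm (f t - g t) \<partial>lborel) < \<epsilon>" using s by blast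
qed

lemma closed_L1_subspace_dominated:
  assumes V: "closed_L1_subspace V" and f: "f \<in> borel_measurable borel"
    and s: "\<And>n. s n \<in> V" and w: "integrable lborel w"
    and lim: "\<And>t. (\<lambda>n. s n t) \<longlonglongrightarrow> f t" and bd: "\<And>n t. norm (s n t) \<le> w t"
  shows "f \<in> V"
proof (rule closed_L1_subspace_limit[OF V])
  have bf: "norm (f t) \<le> w t" for t
    by (rule Lim_bounded[OF tendsto_norm[OF lim]]) (simp add: bd)
  have w0: "w t \<ge> 0" for t using bf[of t] norm_ge_zero order_trans by blast
  show int: "integrable lborel f"
    by (rule Bochner_Integration.integrable_bound[OF w]) (use f bf w0 in auto)
  note [measurable] = f closed_L1_subspace_integrable[OF V s, THEN borel_measurable_integrable]
  have "(\<lambda>n. \<integral>t. norm (f t - s n t) \<partial>lborel) \<longlonglongrightarrow> (\<integral>t. 0 \<partial>(lborel :: real measure))"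
  proof (rule integral_dominated_convergence[where w="\<lambda>t. 2 * w t"])
    show "AE t in lborel. (\<lambda>n. norm (f t - s n t)) \<longlonglongrightarrow> 0"
    proof (rule AE_I2)
      fix t
      have "(\<lambda>n. norm (f t - s n t)) \<longlonglongrightarrow> norm (f t - f t)" by (intro tendsto_intros lim)
      then show "(\<lambda>n. norm (f t - s n t)) \<longlonglongrightarrow> 0" by simp
    qed
    show "AE t in lborel. norm (norm (f t - s n t)) \<le> 2 * w t" for n
    proof (rule AE_I2)
      fix t
      have "norm (f t - s n t) \<le> norm (f t) + norm (s n t)" by (rule norm_triangle_ineq4)
      then show "norm (norm (f t - s n t)) \<le> 2 * w t" using bf[of t] bd[of n t] by simp
    qed
  qed (use w in auto)
  then show "(\<lambda>n. \<integral>t. norm (f t - s n t) \<partial>lborel) \<longlonglongrightarrow> 0" by simp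
qed (use s in auto)

text \<open>Dynkin's argument on the half-lines \<open>{..a}\<close>, which are stable under
  intersection. Cutting with \<open>{-N..N}\<close> keeps complements integrable.\<close>

lemma closed_L1_subspace_indicator:
  assumes V: "closed_L1_subspace V"
    and iv: "\<And>a b :: real. (\<lambda>t. indicator {a..b} t) \<in> V"
    and A: "A \<in> sets borel"
  shows "(\<lambda>t. indicator (A \<inter> {-N..N}) t) \<in> V"
proof -
  have "Int_stable (range (\<lambda>a::real. {..a}))" by (auto simp: Int_stable_def)
  moreover have "range (\<lambda>a::real. {..a}) \<subseteq> Pow UNIV" by simp
  moreover have "A \<in> sigma_sets UNIV (range (\<lambda>a::real. {..a}))"
    using A unfolding borel_eq_atMost by simp
  ultimately show ?thesis
  proof (induction rule: sigma_sets_induct_disjoint)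
    case (basic B)
    then obtain a where "B = {..a}" by auto
    then have "B \<inter> {-N..N} = {-N..min a N}" by auto
    then show ?case using iv by simp
  next
    case empty
    then show ?case using closed_L1_subspace_zero[OF V] by simp
  next
    case (compl B)
    have "(indicator ((UNIV - B) \<inter> {-N..N}) t :: complex) =
        indicator {-N..N} t - indicator (B \<inter> {-N..N}) t" for t
      by (auto simp: indicator_def)
    then show ?case using closed_L1_subspace_diff[OF V iv compl.IH, of "-N" N] by simp
  next
    case (union B)
    then have meas: "\<And>i. B i \<in> sets borel" unfolding borel_eq_atMost by auto
    show ?case
    proof (rule closed_L1_subspace_dominated[OF V])
      show "(\<lambda>t. indicator ((\<Union>i. B i) \<inter> {-N..N}) t) \<in> borel_measurable borel"
        using meas by auto
      show "(\<lambda>t. \<Sum>i<n. indicator (B i \<inter> {-N..N}) t) \<in> V" for n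
        by (rule closed_L1_subspace_sum[OF V]) (use union in auto)
      have disj: "disjoint_family (\<lambda>i. B i \<inter> {-N..N})"
        using union(1) by (auto simp: disjoint_family_on_def)
      have eq: "(\<Sum>i<n. indicator (B i \<inter> {-N..N}) t) = (indicator (\<Union>i<n. B i \<inter> {-N..N}) t :: complex)" for n t
        using disj by (subst indicator_UN_disjoint) (auto simp: disjoint_family_on_def)
      show "(\<lambda>n. \<Sum>i<n. indicator (B i \<inter> {-N..N}) t) \<longlonglongrightarrow>
          (indicator ((\<Union>i. B i) \<inter> {-N..N}) t :: complex)" for t
        unfolding eq using LIMSEQ_indicator_UN[of "\<lambda>i. B i \<inter> {-N..N}" t] by simp
      show "integrable lborel (\<lambda>t. indicator {-N..N} t :: real)" by simp
      show "norm (\<Sum>i<n. indicator (B i \<inter> {-N..N}) t :: complex) \<le> indicator {-N..N} t" for n t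
        unfolding eq by (auto simp: indicator_def)
    qed
  qed
qed

text \<open>Serves as an induction principle: a property of integrable functions that defines a
  closed subspace has to be checked on intervals only. Continuity of translation and stability under
  convolution are proved this way.\<close>

lemma closed_L1_subspace_induct:
  assumes V: "closed_L1_subspace V"
    and iv: "\<And>a b :: real. (\<lambda>t. indicator {a..b} t) \<in> V"
    and f: "integrable lborel f"
  shows "f \<in> V"
  using f
proof (induction rule: integrable_induct)
  case (base A c)
  then have A[measurable]: "A \<in> sets borel" by simp
  have "(\<lambda>t. indicator A t) \<in> V"
  proof (rule closed_L1_subspace_dominated[OF V])
    show "(\<lambda>t. indicator (A \<inter> {- real n..real n}) t) \<in> V" for n
      by (rule closed_L1_subspace_indicator[OF V iv A])
    show "integrable lborel (\<lambda>t. indicator A t :: real)" using base by simp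
    show "(\<lambda>n. indicator (A \<inter> {- real n..real n}) t) \<longlonglongrightarrow> (indicator A t :: complex)" for t
    proof (rule tendsto_eventually)
      obtain m where "\<bar>t\<bar> \<le> real m" using real_arch_simple by blast
      then show "\<forall>\<^sub>F n in sequentially. indicator (A \<inter> {- real n..real n}) t = (indicator A t :: complex)"
        by (auto simp: eventually_sequentially indicator_def intro!: exI[of _ m])
    qed
  qed (auto simp: indicator_def)
  moreover have "(\<lambda>t. indicator A t *\<^sub>R c) = (\<lambda>t. c * indicator A t)"
    by (auto simp: indicator_def fun_eq_iff)
  ultimately show ?case using closed_L1_subspace_cmult[OF V, of "indicator A" c] by simp
next
  case (add f g)
  then show ?case using closed_L1_subspace_add[OF V] by blast
next
  case (lim f s)
  show ?case
    by (rule closed_L1_subspace_dominated[OF V, where s=s and w="\<lambda>t. 2 * norm (f t)"])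
       (use lim borel_measurable_integrable in auto)
qed

section \<open>Continuity of translation and convergence of Gaussian means in L1\<close>

lemma integral_norm_triangle:
  fixes f g :: "real \<Rightarrow> complex"
  assumes "integrable lborel f" "integrable lborel g"
  shows "(\<integral>t. norm (f t + g t) \<partial>lborel) \<le> (\<integral>t. norm (f t) \<partial>lborel) + (\<integral>t. norm (g t) \<partial>lborel)"
proof -
  have "(\<integral>t. norm (f t + g t) \<partial>lborel) \<le> (\<integral>t. norm (f t) + norm (g t) \<partial>lborel)"
    by (rule integral_mono) (use assms in \<open>auto intro: norm_triangle_ineq\<close>)
  then show ?thesis using assms by simp
qed

definition L1_modulus :: "(real \<Rightarrow> complex) \<Rightarrow> real \<Rightarrow> real" where
  "L1_modulus f s = (\<integral>t. norm (f (t - s) - f t) \<partial>lborel)"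

lemma L1_modulus_le:
  assumes "integrable lborel f"
  shows "L1_modulus f s \<le> 2 * (\<integral>t. norm (f t) \<partial>lborel)"
proof -
  have "L1_modulus f s \<le> (\<integral>t. norm (f (t - s)) \<partial>lborel) + (\<integral>t. norm (- f t) \<partial>lborel)"
    unfolding L1_modulus_def
    using integral_norm_triangle[of "\<lambda>t. f (t - s)" "\<lambda>t. - f t"] assms
    by (simp add: integrable_lborel_translate)
  then show ?thesis
    by (simp add: integral_lborel_translate[where f="\<lambda>t. norm (f t)"])
qed

lemma L1_modulus_add:
  assumes f: "integrable lborel f" and g: "integrable lborel g"
  shows "L1_modulus (\<lambda>t. f t + g t) s \<le> L1_modulus f s + L1_modulus g s"
proof -
  have "L1_modulus (\<lambda>t. f t + g t) s = (\<integral>t. norm ((f (t - s) - f t) + (g (t - s) - g t)) \<partial>lborel)"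
    unfolding L1_modulus_def by (simp add: algebra_simps)
  also have "\<dots> \<le> L1_modulus f s + L1_modulus g s"
    unfolding L1_modulus_def
    by (rule integral_norm_triangle) (use f g in \<open>auto intro: integrable_lborel_translate\<close>)
  finally show ?thesis .
qed

lemma L1_modulus_nonneg [simp]: "0 \<le> L1_modulus f s"
  by (simp add: L1_modulus_def)

text \<open>The functions with this property form a closed subspace. For an interval, a shift by s
  changes the indicator only within |s| of an endpoint, which gives the modulus at most 4
  |s|.\<close>

lemma L1_modulus_tendsto:
  assumes f: "integrable lborel f"
  shows "(L1_modulus f \<longlongrightarrow> 0) (at 0)"
proof -
  define V where "V = {f. integrable lborel f \<and> (L1_modulus f \<longlongrightarrow> 0) (at 0)}"
  have closed: "closed_L1_subspace V"
    unfolding closed_L1_subspace_def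
  proof (intro conjI ballI allI impI)
    show "integrable lborel f" if "f \<in> V" for f using that by (simp add: V_def)
    show "(\<lambda>_. 0) \<in> V" by (simp add: V_def L1_modulus_def[abs_def])
  next
    fix f g assume fg: "f \<in> V" "g \<in> V"
    then have "((\<lambda>s. L1_modulus f s + L1_modulus g s) \<longlongrightarrow> 0 + 0) (at 0)"
      by (intro tendsto_add) (auto simp: V_def)
    then have lim: "((\<lambda>s. L1_modulus f s + L1_modulus g s) \<longlongrightarrow> 0) (at 0)" by simp
    have "(L1_modulus (\<lambda>t. f t + g t) \<longlongrightarrow> 0) (at 0)"
    proof (rule tendsto_sandwich[OF always_eventually always_eventually tendsto_const lim])
      show "\<forall>s. L1_modulus (\<lambda>t. f t + g t) s \<le> L1_modulus f s + L1_modulus g s"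
        using fg L1_modulus_add[of f g] by (simp add: V_def)
    qed simp
    then show "(\<lambda>t. f t + g t) \<in> V" using fg by (simp add: V_def)
  next
    fix c f assume f: "f \<in> V"
    have "L1_modulus (\<lambda>t. c * f t) = (\<lambda>s. norm c * L1_modulus f s)"
      unfolding L1_modulus_def integral_mult_right_zero[symmetric]
      by (simp add: right_diff_distrib[symmetric] norm_mult fun_eq_iff)
    moreover have "((\<lambda>s. norm c * L1_modulus f s) \<longlongrightarrow> norm c * 0) (at 0)"
      using f by (intro tendsto_intros) (simp add: V_def)
    ultimately show "(\<lambda>t. c * f t) \<in> V" using f by (simp add: V_def)
  next
    fix f assume f: "integrable lborel f"
      and ap: "\<forall>\<epsilon>>0. \<exists>g\<in>V. (\<integral>t. norm (f t - g t) \<partial>lborel) < \<epsilon>"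
    have "(L1_modulus f \<longlongrightarrow> 0) (at 0)"
    proof (rule tendstoI)
      fix e :: real assume e: "e > 0"
      obtain g where g: "g \<in> V" "(\<integral>t. norm (f t - g t) \<partial>lborel) < e / 4"
        using ap e by (meson zero_less_divide_iff zero_less_numeral)
      have gi: "integrable lborel g" using g by (simp add: V_def)
      have "(L1_modulus g \<longlongrightarrow> 0) (at 0)" using g by (simp add: V_def)
      then have "\<forall>\<^sub>F s in at 0. L1_modulus g s < e / 2" by (rule order_tendstoD) (use e in simp)
      then show "\<forall>\<^sub>F s in at 0. dist (L1_modulus f s) 0 < e"
      proof eventually_elim
        case (elim s)
        have "L1_modulus f s \<le> L1_modulus (\<lambda>t. f t - g t) s + L1_modulus g s"
          using L1_modulus_add[of "\<lambda>t. f t - g t" g s] f gi by simp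
        moreover have "L1_modulus (\<lambda>t. f t - g t) s \<le> 2 * (\<integral>t. norm (f t - g t) \<partial>lborel)"
          by (rule L1_modulus_le) (use f gi in simp)
        ultimately show ?case using g elim by simp
      qed
    qed
    then show "f \<in> V" using f by (simp add: V_def)
  qed
  have iv: "(\<lambda>t. indicator {a..b} t) \<in> V" for a b :: real
  proof -
    have le: "L1_modulus (\<lambda>t. indicator {a..b} t) s \<le> 4 * \<bar>s\<bar>" for s
    proof -
      have "L1_modulus (\<lambda>t. indicator {a..b} t) s \<le>
          (\<integral>t. indicator {a-\<bar>s\<bar>..a+\<bar>s\<bar>} t + indicator {b-\<bar>s\<bar>..b+\<bar>s\<bar>} t \<partial>lborel)"
        unfolding L1_modulus_def
      proof (rule integral_mono)
        show "integrable lborel (\<lambda>t. cmod (indicator {a..b} (t - s) - indicator {a..b} t))"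
          using integrable_lborel_translate[of "\<lambda>t. indicator {a..b} t :: complex" s]
          by (intro integrable_norm Bochner_Integration.integrable_diff) auto
        fix t
        show "cmod (indicator {a..b} (t - s) - indicator {a..b} t) \<le>
            indicator {a-\<bar>s\<bar>..a+\<bar>s\<bar>} t + indicator {b-\<bar>s\<bar>..b+\<bar>s\<bar>} t"
        proof (cases "\<bar>t - a\<bar> \<le> \<bar>s\<bar> \<or> \<bar>t - b\<bar> \<le> \<bar>s\<bar>")
          case True
          then have "t \<in> {a-\<bar>s\<bar>..a+\<bar>s\<bar>} \<or> t \<in> {b-\<bar>s\<bar>..b+\<bar>s\<bar>}" unfolding atLeastAtMost_iff by linarith
          moreover have "cmod (indicator {a..b} (t - s) - indicator {a..b} t) \<le> 1"
            by (simp split: split_indicator)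
          ultimately show ?thesis by (elim disjE order_trans) (simp_all split: split_indicator)
        next
          case False
          then have "t - s \<in> {a..b} \<longleftrightarrow> t \<in> {a..b}" unfolding atLeastAtMost_iff by linarith
          then show ?thesis by (simp add: indicator_def)
        qed
      qed simp
      also have "\<dots> = 4 * \<bar>s\<bar>" by simp
      finally show ?thesis .
    qed
    have "((\<lambda>s::real. 4 * \<bar>s\<bar>) \<longlongrightarrow> 4 * \<bar>0\<bar>) (at 0)" by (intro tendsto_intros)
    then have lim: "((\<lambda>s::real. 4 * \<bar>s\<bar>) \<longlongrightarrow> 0) (at 0)" by simp
    have "(L1_modulus (\<lambda>t. indicator {a..b} t) \<longlongrightarrow> 0) (at 0)"
      by (rule tendsto_sandwich[OF always_eventually always_eventually tendsto_const lim])
         (simp, use le in blast)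
    then show ?thesis by (simp add: V_def)
  qed
  have "f \<in> V" by (rule closed_L1_subspace_induct[OF closed iv f])
  then show ?thesis by (simp add: V_def)
qed

lemma nn_integral_L1_modulus:
  assumes f: "integrable lborel f"
  shows "(\<integral>\<^sup>+t. ennreal (norm (f (t - s) - f (t - q))) \<partial>lborel) = ennreal (L1_modulus f (s - q))"
proof -
  have "(\<integral>\<^sup>+t. ennreal (norm (f (t - s) - f (t - q))) \<partial>lborel) =
      ennreal (\<integral>t. norm (f (t - s) - f (t - q)) \<partial>lborel)"
    using f by (intro nn_integral_eq_integral)
      (auto intro!: integrable_norm Bochner_Integration.integrable_diff integrable_lborel_translate)
  also have "(\<integral>t. norm (f (t - s) - f (t - q)) \<partial>lborel) = L1_modulus f (s - q)"
    unfolding L1_modulus_def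
    using integral_lborel_translate[where f="\<lambda>t. norm (f (t - (s - q)) - f t)" and x=q] by simp
  finally show ?thesis .
qed

lemma L1_modulus_measurable:
  assumes "integrable lborel f"
  shows "L1_modulus f \<in> borel_measurable borel"
proof -
  note [measurable] = borel_measurable_integrable[OF assms]
  show ?thesis unfolding L1_modulus_def by measurable
qed

lemma L1_modulus_0 [simp]: "L1_modulus f 0 = 0"
  by (simp add: L1_modulus_def)

lemma L1_modulus_isCont: "integrable lborel f \<Longrightarrow> isCont (L1_modulus f) 0"
  using L1_modulus_tendsto by (simp add: isCont_def)

text \<open>Minkowski's integral inequality for the L1 norm, by Tonelli.\<close>

lemma nn_integral_norm_integral_le:
  fixes G :: "real \<Rightarrow> real \<Rightarrow> complex"
  assumes [measurable]: "(\<lambda>(r, t). G r t) \<in> borel_measurable (lborel \<Otimes>\<^sub>M lborel)"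
  shows "(\<integral>\<^sup>+t. ennreal (norm (\<integral>r. G r t \<partial>lborel)) \<partial>lborel) \<le>
         (\<integral>\<^sup>+r. \<integral>\<^sup>+t. ennreal (norm (G r t)) \<partial>lborel \<partial>lborel)"
proof -
  have "(\<integral>\<^sup>+t. ennreal (norm (\<integral>r. G r t \<partial>lborel)) \<partial>lborel) \<le>
      (\<integral>\<^sup>+t. \<integral>\<^sup>+r. ennreal (norm (G r t)) \<partial>lborel \<partial>lborel)"
    by (intro nn_integral_mono norm_integral_le_nn_integral)
  also have "\<dots> = (\<integral>\<^sup>+r. \<integral>\<^sup>+t. ennreal (norm (G r t)) \<partial>lborel \<partial>lborel)"
    by (rule lborel_pair.Fubini') measurable
  finally show ?thesis .
qed

lemma std_normal_density_le_1: "std_normal_density x \<le> 1"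
proof -
  have "sqrt (2 * pi) \<ge> 1" using pi_gt3 by simp
  then have "1 / sqrt (2 * pi) * exp (- x\<^sup>2 / 2) \<le> 1 * 1" by (intro mult_mono) auto
  then show ?thesis by (simp add: std_normal_density_def)
qed

text \<open>The Gaussian mean minus \<open>f\<close> is an average of the differences f(t - \<sigma>
  r) - f(t) over a normally distributed r; Minkowski's inequality bounds its norm by the average of
  the moduli.\<close>

lemma gauss_means_L1_bound:
  assumes f: "integrable lborel f" and \<sigma>: "\<sigma> > 0"
  shows "(\<integral>\<^sup>+t. ennreal (norm (f t - (\<integral>s. f s * of_real (normal_density 0 \<sigma> (t - s)) \<partial>lborel))) \<partial>lborel)
       \<le> ennreal (\<integral>r. std_normal_density r * L1_modulus f (\<sigma> * r) \<partial>lborel)"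
proof -
  note [measurable] = borel_measurable_integrable[OF f] L1_modulus_measurable[OF f]
  let ?N = std_normal_density
  have eq: "(\<integral>s. f s * of_real (normal_density 0 \<sigma> (t - s)) \<partial>lborel) - f t =
      (\<integral>r. (f (t - \<sigma> * r) - f t) * of_real (?N r) \<partial>lborel)" for t
  proof -
    have "integrable lborel (\<lambda>r. f (t - \<sigma> * r))"
      using lborel_integrable_real_affine[OF f, of "-\<sigma>" t] \<sigma> by simp
    then have "integrable lborel (\<lambda>r. f (t - \<sigma> * r) * of_real (?N r))"
      by (rule Bochner_Integration.integrable_bound)
         (auto simp: norm_mult intro!: mult_left_le std_normal_density_le_1)
    moreover have "integrable lborel (\<lambda>r. f t * of_real (?N r))" by (auto simp: integrable_of_real)
    moreover have "(\<integral>r. f t * of_real (?N r) \<partial>lborel) = f t"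
      by (simp add: integral_complex_of_real)
    ultimately show ?thesis
      by (simp add: gauss_mean_rescale[OF \<sigma>] left_diff_distrib)
  qed
  have "(\<integral>\<^sup>+t. ennreal (norm (f t - (\<integral>s. f s * of_real (normal_density 0 \<sigma> (t - s)) \<partial>lborel))) \<partial>lborel)
      = (\<integral>\<^sup>+t. ennreal (norm (\<integral>r. (f (t - \<sigma> * r) - f t) * of_real (?N r) \<partial>lborel)) \<partial>lborel)"
    by (simp add: norm_minus_commute eq[symmetric])
  also have "\<dots> \<le> (\<integral>\<^sup>+r. \<integral>\<^sup>+t. ennreal (norm ((f (t - \<sigma> * r) - f t) * of_real (?N r))) \<partial>lborel \<partial>lborel)"
    by (rule nn_integral_norm_integral_le) measurable
  also have "\<dots> = (\<integral>\<^sup>+r. ennreal (?N r * L1_modulus f (\<sigma> * r)) \<partial>lborel)"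
    using nn_integral_L1_modulus[OF f, of _ 0]
    by (simp add: norm_mult ennreal_mult nn_integral_cmult mult.commute)
  also have "\<dots> = ennreal (\<integral>r. ?N r * L1_modulus f (\<sigma> * r) \<partial>lborel)"
  proof (rule nn_integral_eq_integral)
    show "integrable lborel (\<lambda>r. ?N r * L1_modulus f (\<sigma> * r))"
      by (rule Bochner_Integration.integrable_bound[where f="\<lambda>r. ?N r * (2 * (\<integral>t. norm (f t) \<partial>lborel))"])
         (use L1_modulus_le[OF f] in \<open>auto simp: abs_mult intro!: mult_left_mono\<close>)
  qed simp
  finally show ?thesis .
qed

lemma gauss_means_L1_tendsto:
  assumes f: "integrable lborel f"
  shows "(\<lambda>n. \<integral>r. std_normal_density r * L1_modulus f (1 / real (Suc n) * r) \<partial>lborel) \<longlonglongrightarrow> 0"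
proof -
  note [measurable] = L1_modulus_measurable[OF f]
  have "(\<lambda>n. \<integral>r. std_normal_density r * L1_modulus f (1 / real (Suc n) * r) \<partial>lborel)
      \<longlonglongrightarrow> (\<integral>r. std_normal_density r * L1_modulus f 0 \<partial>lborel)"
  proof (rule integral_dominated_convergence[where w="\<lambda>r. std_normal_density r * (2 * (\<integral>t. norm (f t) \<partial>lborel))"])
    show "AE r in lborel. (\<lambda>n. std_normal_density r * L1_modulus f (1 / real (Suc n) * r))
        \<longlonglongrightarrow> std_normal_density r * L1_modulus f 0"
    proof (intro AE_I2 tendsto_mult tendsto_const isCont_tendsto_compose[OF L1_modulus_isCont[OF f]])
      fix r :: real
      have "(\<lambda>n. 1 / real (Suc n) * r) \<longlonglongrightarrow> 0 * r"
        by (intro tendsto_intros LIMSEQ_Suc[OF lim_1_over_n])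
      then show "(\<lambda>n. 1 / real (Suc n) * r) \<longlonglongrightarrow> 0" by simp
    qed
    show "AE r in lborel. norm (std_normal_density r * L1_modulus f (1 / real (Suc n) * r))
        \<le> std_normal_density r * (2 * (\<integral>t. norm (f t) \<partial>lborel))" for n
      using L1_modulus_le[OF f] by (intro AE_I2) (simp add: abs_mult mult_left_mono)
  qed auto
  then show ?thesis by simp
qed

text \<open>The Gaussian means converge pointwise to the inverse transform and in L1 to
  \<open>f\<close>; Fatou's lemma identifies the two limits. The window itself is covered only by
  this version, as it is merely integrable.\<close>

lemma fourier_inversion_AE:
  assumes f: "integrable lborel f" and ff: "integrable lborel (fourier_transform f)"
  shows "AE t in lborel. fourier_transform (fourier_transform f) (- t) = f t"
proof -
  note [measurable] = borel_measurable_integrable[OF f] borel_measurable_fourier_transform[OF ff]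
  let ?m = "\<lambda>n t. \<integral>s. f s * of_real (normal_density 0 (1 / real (Suc n)) (t - s)) \<partial>lborel"
  let ?I = "\<lambda>t. fourier_transform (fourier_transform f) (- t)"
  have "(\<integral>\<^sup>+t. ennreal (norm (f t - ?I t)) \<partial>lborel) =
      (\<integral>\<^sup>+t. liminf (\<lambda>n. ennreal (norm (f t - ?m n t))) \<partial>lborel)"
    by (intro nn_integral_cong lim_imp_Liminf[symmetric] tendsto_ennrealI tendsto_intros
        gauss_means_tendsto_inverse f ff) simp
  also have "\<dots> \<le> liminf (\<lambda>n. \<integral>\<^sup>+t. ennreal (norm (f t - ?m n t)) \<partial>lborel)"
    by (rule nn_integral_liminf) measurable
  also have "\<dots> \<le> liminf (\<lambda>n. ennreal (\<integral>r. std_normal_density r * L1_modulus f (1 / real (Suc n) * r) \<partial>lborel))"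
    by (intro Liminf_mono always_eventually allI gauss_means_L1_bound f) simp
  also have "\<dots> = ennreal 0"
    by (intro lim_imp_Liminf tendsto_ennrealI gauss_means_L1_tendsto f) simp
  finally have "(\<integral>\<^sup>+t. ennreal (norm (f t - ?I t)) \<partial>lborel) = 0" by simp
  then have "AE t in lborel. ennreal (norm (f t - ?I t)) = 0"
    by (subst (asm) nn_integral_0_iff_AE) auto
  then show ?thesis by eventually_elim auto
qed

section \<open>Convolution in L1\<close>

definition L1_conv :: "(real \<Rightarrow> complex) \<Rightarrow> (real \<Rightarrow> complex) \<Rightarrow> real \<Rightarrow> complex" where
  "L1_conv h \<psi> t = (\<integral>s. h s * \<psi> (t - s) \<partial>lborel)"

lemma integrable_L1_conv:
  assumes h: "integrable lborel h" and \<psi>: "integrable lborel \<psi>"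
  shows "integrable lborel (L1_conv h \<psi>)"
  unfolding L1_conv_def[abs_def]
  using lborel_pair.integrable_snd[OF integrable_convolution_pair[OF h \<psi>]] by simp

lemma AE_integrable_L1_conv:
  fixes h \<psi> :: "real \<Rightarrow> complex"
  assumes h: "integrable lborel h" and \<psi>: "integrable lborel \<psi>"
  shows "AE t in lborel. integrable lborel (\<lambda>s. h s * \<psi> (t - s))"
  using lborel_pair.AE_integrable_snd[OF integrable_convolution_pair[OF h \<psi>]] by simp

lemma L1_conv_norm_le:
  assumes h: "integrable lborel h" and \<psi>: "integrable lborel \<psi>"
  shows "(\<integral>t. norm (L1_conv h \<psi> t) \<partial>lborel) \<le> (\<integral>t. norm (h t) \<partial>lborel) * (\<integral>t. norm (\<psi> t) \<partial>lborel)"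
proof -
  note [measurable] = borel_measurable_integrable[OF h] borel_measurable_integrable[OF \<psi>]
  have tr: "(\<integral>\<^sup>+t. ennreal (norm (\<psi> (t - s))) \<partial>lborel) = ennreal (\<integral>t. norm (\<psi> t) \<partial>lborel)" for s
    using integrable_lborel_translate[OF \<psi>, of s]
    by (subst nn_integral_eq_integral) (auto simp: integral_lborel_translate[where f="\<lambda>t. norm (\<psi> t)"])
  have "ennreal (\<integral>t. norm (L1_conv h \<psi> t) \<partial>lborel) = (\<integral>\<^sup>+t. ennreal (norm (L1_conv h \<psi> t)) \<partial>lborel)"
    using integrable_L1_conv[OF h \<psi>] by (subst nn_integral_eq_integral) auto
  also have "\<dots> \<le> (\<integral>\<^sup>+s. \<integral>\<^sup>+t. ennreal (norm (h s * \<psi> (t - s))) \<partial>lborel \<partial>lborel)"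
    unfolding L1_conv_def by (rule nn_integral_norm_integral_le) measurable
  also have "\<dots> = (\<integral>\<^sup>+s. ennreal (norm (h s)) * ennreal (\<integral>t. norm (\<psi> t) \<partial>lborel) \<partial>lborel)"
    by (simp add: norm_mult ennreal_mult nn_integral_cmult tr)
  also have "\<dots> = ennreal ((\<integral>t. norm (h t) \<partial>lborel) * (\<integral>t. norm (\<psi> t) \<partial>lborel))"
    using h by (simp add: nn_integral_multc ennreal_mult nn_integral_eq_integral)
  finally show ?thesis by (simp add: ennreal_le_iff)
qed

text \<open>Needed because \<open>L1_conv\<close> is known to be additive only where the defining
  integrals exist, that is, almost everywhere.\<close>

lemma closed_L1_subspace_AE:
  assumes V: "closed_L1_subspace V" and f: "f \<in> V" and g: "integrable lborel g"
    and eq: "AE t in lborel. g t = f t"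
  shows "g \<in> V"
proof (rule closed_L1_subspace_closed[OF V g])
  fix \<epsilon> :: real assume "\<epsilon> > 0"
  have "(\<integral>t. norm (g t - f t) \<partial>lborel) = 0"
    by (rule integral_eq_zero_AE) (use eq in auto)
  then show "\<exists>f\<in>V. (\<integral>t. norm (g t - f t) \<partial>lborel) < \<epsilon>" using f \<open>\<epsilon> > 0\<close> by (intro bexI[of _ f]) simp_all
qed

text \<open>Riemann sums on the grid of mesh \<open>\<kappa>\<close>: replacing \<open>s\<close> by \<open>\<lfloor>s / \<kappa>\<rfloor> \<kappa>\<close> turns the
  convolution with an interval into a finite combination of translates.\<close>
lemma closed_L1_subspace_conv_indicator:
  assumes V: "closed_L1_subspace V" and \<psi>: "integrable lborel \<psi>"
    and tr: "\<And>x. (\<lambda>t. \<psi> (t - x)) \<in> V"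
  shows "L1_conv (indicator {a..b}) \<psi> \<in> V"
proof (rule closed_L1_subspace_closed[OF V])
  let ?I = "indicator {a..b} :: real \<Rightarrow> complex"
  have I: "integrable lborel ?I" by simp
  show "integrable lborel (L1_conv ?I \<psi>)" using I \<psi> by (rule integrable_L1_conv)
  fix \<epsilon> :: real assume \<epsilon>: "\<epsilon> > 0"
  \<comment> \<open>The 1 keeps \<open>L\<close> positive when the interval is a single
    point.\<close>
  define L where "L = \<bar>b - a\<bar> + 1"
  have L: "L > 0" unfolding L_def by (intro add_nonneg_pos) auto
  define \<delta> where "\<delta> = \<epsilon> / (2 * L)"
  have \<delta>: "\<delta> > 0" using \<epsilon> L by (simp add: \<delta>_def)
  note [measurable] = borel_measurable_integrable[OF \<psi>]
  have "(L1_modulus \<psi> \<longlongrightarrow> 0) (at 0)" by (rule L1_modulus_tendsto[OF \<psi>])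
  then have "\<forall>\<^sub>F s in at 0. L1_modulus \<psi> s < \<delta>" by (rule order_tendstoD) (rule \<delta>)
  then obtain \<eta> where \<eta>: "\<eta> > 0" "\<And>s. s \<noteq> 0 \<Longrightarrow> \<bar>s\<bar> < \<eta> \<Longrightarrow> L1_modulus \<psi> s < \<delta>"
    unfolding eventually_at by (auto simp: dist_real_def)
  define \<kappa> where "\<kappa> = \<eta> / 2"
  have \<kappa>: "\<kappa> > 0" using \<eta> by (simp add: \<kappa>_def)
  define q where "q s = of_int \<lfloor>s / \<kappa>\<rfloor> * \<kappa>" for s
  have q: "0 \<le> s - q s" "s - q s < \<eta>" for s
  proof -
    have "of_int \<lfloor>s / \<kappa>\<rfloor> \<le> s / \<kappa>" "s / \<kappa> < of_int \<lfloor>s / \<kappa>\<rfloor> + 1"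
      using floor_correct[of "s / \<kappa>"] by auto
    then have "of_int \<lfloor>s / \<kappa>\<rfloor> * \<kappa> \<le> s" "s < (of_int \<lfloor>s / \<kappa>\<rfloor> + 1) * \<kappa>"
      using \<kappa> by (simp_all only: pos_le_divide_eq pos_divide_less_eq)
    then show "0 \<le> s - q s" "s - q s < \<eta>" using \<kappa> \<eta>(1)
      by (auto simp: q_def distrib_right \<kappa>_def)
  qed
  have mod: "L1_modulus \<psi> (s - q s) \<le> \<delta>" for s
    using \<eta>(2)[of "s - q s"] q[of s] \<delta> by (cases "s - q s = 0") auto
  have [measurable]: "q \<in> borel_measurable borel" unfolding q_def by measurable
  define J where "J = {\<lfloor>a / \<kappa>\<rfloor>..\<lfloor>b / \<kappa>\<rfloor>}"
  \<comment> \<open>The length of the part of the interval that lies in the j-th grid cell.\<close>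
  define c where "c j = (\<integral>s. ?I s * of_bool (\<lfloor>s / \<kappa>\<rfloor> = j) \<partial>lborel)" for j
  define S where "S t = (\<Sum>j\<in>J. c j * \<psi> (t - of_int j * \<kappa>))" for t
  have S: "S \<in> V" unfolding S_def[abs_def]
    by (intro closed_L1_subspace_sum[OF V] closed_L1_subspace_cmult[OF V] tr)
  have intj: "integrable lborel (\<lambda>s. ?I s * of_bool (\<lfloor>s / \<kappa>\<rfloor> = j))" for j
    by (rule Bochner_Integration.integrable_bound[OF I]) (auto simp: indicator_def)
  have pw: "?I s * \<psi> (t - q s) = (\<Sum>j\<in>J. ?I s * of_bool (\<lfloor>s / \<kappa>\<rfloor> = j) * \<psi> (t - of_int j * \<kappa>))" for s t
  proof (cases "s \<in> {a..b}")
    case True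
    then have "\<lfloor>s / \<kappa>\<rfloor> \<in> J" using \<kappa> by (auto simp: J_def intro!: floor_mono divide_right_mono)
    moreover have "finite J" by (simp add: J_def)
    ultimately show ?thesis using True
      by (subst sum.remove[of J "\<lfloor>s / \<kappa>\<rfloor>"]) (auto simp: q_def intro!: sum.neutral)
  qed simp
  have Sq: "S t = (\<integral>s. ?I s * \<psi> (t - q s) \<partial>lborel)" "integrable lborel (\<lambda>s. ?I s * \<psi> (t - q s))" for t
  proof -
    show "S t = (\<integral>s. ?I s * \<psi> (t - q s) \<partial>lborel)"
      unfolding pw S_def c_def by (subst Bochner_Integration.integral_sum) (auto intro!: intj integrable_mult_left)
    show "integrable lborel (\<lambda>s. ?I s * \<psi> (t - q s))"
      unfolding pw by (auto intro!: intj integrable_mult_left)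
  qed
  have "AE t in lborel. L1_conv ?I \<psi> t - S t = (\<integral>s. ?I s * (\<psi> (t - s) - \<psi> (t - q s)) \<partial>lborel)"
    using AE_integrable_L1_conv[OF I \<psi>]
    by eventually_elim (simp add: L1_conv_def Sq right_diff_distrib)
  then have "(\<integral>\<^sup>+t. ennreal (norm (L1_conv ?I \<psi> t - S t)) \<partial>lborel) =
      (\<integral>\<^sup>+t. ennreal (norm (\<integral>s. ?I s * (\<psi> (t - s) - \<psi> (t - q s)) \<partial>lborel)) \<partial>lborel)"
    by (intro nn_integral_cong_AE) auto
  also have "\<dots> \<le> (\<integral>\<^sup>+s. \<integral>\<^sup>+t. ennreal (norm (?I s * (\<psi> (t - s) - \<psi> (t - q s)))) \<partial>lborel \<partial>lborel)"
    by (rule nn_integral_norm_integral_le) measurable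
  also have "\<dots> = (\<integral>\<^sup>+s. ennreal (norm (?I s)) * ennreal (L1_modulus \<psi> (s - q s)) \<partial>lborel)"
    by (simp add: norm_mult ennreal_mult nn_integral_cmult nn_integral_L1_modulus[OF \<psi>])
  also have "\<dots> \<le> (\<integral>\<^sup>+s. ennreal \<delta> * indicator {a..b} s \<partial>lborel)"
    using mod by (intro nn_integral_mono) (auto simp: indicator_def intro: ennreal_leI)
  also have "\<dots> \<le> ennreal (\<delta> * L)"
    unfolding L_def using \<delta> by (subst nn_integral_cmult_indicator)
      (auto simp: emeasure_lborel_Icc_eq ennreal_mult[symmetric] intro!: ennreal_leI)
  also have "\<delta> * L = \<epsilon> / 2" using L by (simp add: \<delta>_def)
  finally have "(\<integral>\<^sup>+t. ennreal (norm (L1_conv ?I \<psi> t - S t)) \<partial>lborel) \<le> ennreal (\<epsilon> / 2)" .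
  moreover have "integrable lborel (\<lambda>t. L1_conv ?I \<psi> t - S t)"
    using integrable_L1_conv[OF I \<psi>] closed_L1_subspace_integrable[OF V S] by simp
  ultimately have "(\<integral>t. norm (L1_conv ?I \<psi> t - S t) \<partial>lborel) \<le> \<epsilon> / 2"
    using \<epsilon> by (subst (asm) nn_integral_eq_integral) (auto simp: ennreal_le_iff)
  then show "\<exists>g\<in>V. (\<integral>t. norm (L1_conv ?I \<psi> t - g t) \<partial>lborel) < \<epsilon>"
    using S \<epsilon> by (intro bexI[of _ S]) auto
qed

text \<open>For fixed \<psi> the functions \<open>h\<close> that satisfy the conclusion form a
  closed subspace, since convolution with \<psi> is bounded on L1, and the Riemann sums put the
  interval indicators into it.\<close>

lemma closed_L1_subspace_conv:
  assumes V: "closed_L1_subspace V" and \<psi>: "integrable lborel \<psi>"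
    and tr: "\<And>x. (\<lambda>t. \<psi> (t - x)) \<in> V" and h: "integrable lborel h"
  shows "L1_conv h \<psi> \<in> V"
proof -
  define W where "W = {h. integrable lborel h \<and> L1_conv h \<psi> \<in> V}"
  have "closed_L1_subspace W"
    unfolding closed_L1_subspace_def
  proof (intro conjI ballI allI impI)
    show "integrable lborel f" if "f \<in> W" for f using that by (simp add: W_def)
    show "(\<lambda>_. 0) \<in> W" using closed_L1_subspace_zero[OF V] by (simp add: W_def L1_conv_def[abs_def])
  next
    fix f g assume "f \<in> W" "g \<in> W"
    then have fg: "integrable lborel f" "integrable lborel g" "L1_conv f \<psi> \<in> V" "L1_conv g \<psi> \<in> V"
      by (auto simp: W_def)
    have "AE t in lborel. L1_conv (\<lambda>t. f t + g t) \<psi> t = L1_conv f \<psi> t + L1_conv g \<psi> t"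
      using AE_integrable_L1_conv[OF fg(1) \<psi>] AE_integrable_L1_conv[OF fg(2) \<psi>]
      by eventually_elim (simp add: L1_conv_def distrib_right)
    from closed_L1_subspace_AE[OF V closed_L1_subspace_add[OF V fg(3,4)] _ this] fg \<psi>
    show "(\<lambda>t. f t + g t) \<in> W" by (simp add: W_def integrable_L1_conv)
  next
    fix c f assume "f \<in> W"
    moreover have "L1_conv (\<lambda>t. c * f t) \<psi> = (\<lambda>t. c * L1_conv f \<psi> t)"
      by (auto simp: L1_conv_def mult.assoc)
    ultimately show "(\<lambda>t. c * f t) \<in> W"
      using closed_L1_subspace_cmult[OF V] by (simp add: W_def)
  next
    fix f assume f: "integrable lborel f"
      and ap: "\<forall>\<epsilon>>0. \<exists>g\<in>W. (\<integral>t. norm (f t - g t) \<partial>lborel) < \<epsilon>"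
    define K where "K = (\<integral>t. norm (\<psi> t) \<partial>lborel)"
    have K: "K \<ge> 0" by (simp add: K_def)
    have "L1_conv f \<psi> \<in> V"
    proof (rule closed_L1_subspace_closed[OF V integrable_L1_conv[OF f \<psi>]])
      fix \<epsilon> :: real assume \<epsilon>: "\<epsilon> > 0"
      then obtain g where g: "g \<in> W" "(\<integral>t. norm (f t - g t) \<partial>lborel) < \<epsilon> / (K + 1)"
        using ap K by (meson add_nonneg_pos zero_less_divide_iff zero_less_one)
      have gi: "integrable lborel g" using g by (simp add: W_def)
      have fgi: "integrable lborel (\<lambda>t. f t - g t)" using f gi by simp
      have "AE t in lborel. L1_conv f \<psi> t - L1_conv g \<psi> t = L1_conv (\<lambda>t. f t - g t) \<psi> t"
        using AE_integrable_L1_conv[OF f \<psi>] AE_integrable_L1_conv[OF gi \<psi>]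
        by eventually_elim (simp add: L1_conv_def left_diff_distrib)
      then have "(\<integral>t. norm (L1_conv f \<psi> t - L1_conv g \<psi> t) \<partial>lborel) =
          (\<integral>t. norm (L1_conv (\<lambda>t. f t - g t) \<psi> t) \<partial>lborel)"
        using integrable_L1_conv[OF f \<psi>] integrable_L1_conv[OF gi \<psi>] integrable_L1_conv[OF fgi \<psi>]
        by (intro integral_cong_AE) auto
      also have "\<dots> \<le> (\<integral>t. norm (f t - g t) \<partial>lborel) * K"
        unfolding K_def by (rule L1_conv_norm_le[OF fgi \<psi>])
      also have "\<dots> \<le> (\<integral>t. norm (f t - g t) \<partial>lborel) * (K + 1)"
        by (intro mult_left_mono) auto
      also have "\<dots> < \<epsilon> / (K + 1) * (K + 1)" using g K by (intro mult_strict_right_mono) auto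
      finally show "\<exists>g\<in>V. (\<integral>t. norm (L1_conv f \<psi> t - g t) \<partial>lborel) < \<epsilon>"
        using g K by (intro bexI[of _ "L1_conv g \<psi>"]) (auto simp: W_def)
    qed
    then show "f \<in> W" using f by (simp add: W_def)
  qed
  moreover have "(\<lambda>t. indicator {a..b} t) \<in> W" for a b :: real
    using closed_L1_subspace_conv_indicator[OF V \<psi> tr, of a b] by (simp add: W_def)
  ultimately have "h \<in> W" using h by (rule closed_L1_subspace_induct)
  then show ?thesis by (simp add: W_def)
qed

section \<open>Density of all translates\<close>

lemma power_le_fact_exp:
  fixes y :: real assumes "y \<ge> 0"
  shows "y ^ k \<le> fact k * exp y"
proof -
  have "(\<Sum>i\<in>{k}. y ^ i /\<^sub>R fact i) \<le> (\<Sum>i. y ^ i /\<^sub>R fact i)"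
    using assms by (intro sum_le_suminf summable_exp_generic) auto
  then show ?thesis by (simp add: exp_def field_simps)
qed

lemma one_plus_power_le:
  fixes x :: real shows "1 + x ^ (2 * n) \<le> 2 * (1 + \<bar>x\<bar>) ^ (2 * n)"
proof -
  have "x ^ (2 * n) = \<bar>x\<bar> ^ (2 * n)" by (simp add: power_even_abs)
  also have "\<dots> \<le> (1 + \<bar>x\<bar>) ^ (2 * n)" by (intro power_mono) auto
  finally show ?thesis using one_le_power[of "1 + \<bar>x\<bar>" "2 * n"] by linarith
qed

lemma one_plus_power_pos: "0 < 1 + (x::real) ^ (2 * n)"
  using zero_le_even_power[of "2 * n" x] by (simp add: add_pos_nonneg)

lemma one_plus_square_le: "1 + (x::real)\<^sup>2 \<le> (1 + \<bar>x\<bar>)\<^sup>2"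
  by (simp add: power2_eq_square algebra_simps)

lemma polynomial_exp_bounded:
  fixes c :: real assumes "c > 0"
  obtains K where "K > 0" "\<And>x. (1 + \<bar>x\<bar>) ^ k * exp (- c * \<bar>x\<bar>) \<le> K"
proof
  let ?K = "fact k * exp c / c ^ k"
  show "?K > 0" using assms by simp
  fix x :: real
  have "(c * (1 + \<bar>x\<bar>)) ^ k \<le> fact k * exp (c * (1 + \<bar>x\<bar>))"
    using assms by (intro power_le_fact_exp) auto
  then have "c ^ k * (1 + \<bar>x\<bar>) ^ k * exp (- c * \<bar>x\<bar>) \<le> fact k * exp (c * (1 + \<bar>x\<bar>)) * exp (- c * \<bar>x\<bar>)"
    by (intro mult_right_mono) (auto simp: power_mult_distrib)
  also have "\<dots> = fact k * exp c" by (simp add: mult.assoc distrib_left flip: exp_add)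
  finally show "(1 + \<bar>x\<bar>) ^ k * exp (- c * \<bar>x\<bar>) \<le> ?K" using assms by (simp add: field_simps)
qed

lemma polynomial_gauss_bounded:
  fixes c a :: real assumes "a > 0"
  obtains K where "K > 0" "\<And>x. (1 + \<bar>x\<bar>) ^ k * exp (c * \<bar>x\<bar>) * exp (- a * x\<^sup>2) \<le> K"
proof
  \<comment> \<open>The power is absorbed by \<open>exp (1 + \<bar>x\<bar>)\<close>; completing the
    square then bounds (c + 1) |x| - a x^2 by (c + 1)^2 / (4 a).\<close>
  let ?K = "fact k * exp (1 + (c + 1)\<^sup>2 / (4 * a))"
  show "?K > 0" by simp
  fix x :: real
  have "(1 + \<bar>x\<bar>) ^ k * exp (c * \<bar>x\<bar>) * exp (- a * x\<^sup>2) \<le> fact k * exp (1 + \<bar>x\<bar>) * exp (c * \<bar>x\<bar>) * exp (- a * x\<^sup>2)"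
    by (intro mult_right_mono power_le_fact_exp) auto
  also have "\<dots> = fact k * exp (1 + \<bar>x\<bar> + c * \<bar>x\<bar> - a * x\<^sup>2)" by (simp add: mult.assoc flip: exp_add)
  also have "1 + \<bar>x\<bar> + c * \<bar>x\<bar> - a * x\<^sup>2 \<le> 1 + (c + 1)\<^sup>2 / (4 * a)"
  proof -
    have "0 \<le> (2 * a * \<bar>x\<bar> - (c + 1))\<^sup>2" by simp
    then have "4 * a * ((c + 1) * \<bar>x\<bar> - a * x\<^sup>2) \<le> (c + 1)\<^sup>2"
      by (simp add: power2_diff power_mult_distrib algebra_simps power2_eq_square)
    then have "(c + 1) * \<bar>x\<bar> - a * x\<^sup>2 \<le> (c + 1)\<^sup>2 / (4 * a)"
      using assms by (simp add: field_simps)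
    then show ?thesis by (simp add: algebra_simps)
  qed
  finally show "(1 + \<bar>x\<bar>) ^ k * exp (c * \<bar>x\<bar>) * exp (- a * x\<^sup>2) \<le> ?K"
    by simp
qed

section \<open>Windows whose transform decays like exp (- 2 pi |\<xi>|)\<close>

locale exp_decay_window =
  fixes \<phi> :: "real \<Rightarrow> complex" and n :: nat and A B C :: real
  assumes integrable_window: "integrable lborel \<phi>"
    and pos: "A > 0" "B > 0" "C > 0"
    and lower: "\<And>\<xi>. A * exp (- 2 * pi * \<bar>\<xi>\<bar>) / (1 + \<xi> ^ (2 * n)) \<le> norm (fourier_transform \<phi> \<xi>)"
    and upper: "\<And>\<xi>. norm (fourier_transform \<phi> \<xi>) \<le> B * (1 + \<xi> ^ (2 * n)) * exp (- 2 * pi * \<bar>\<xi>\<bar>)"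
    and differentiable: "\<And>\<xi>. fourier_transform \<phi> differentiable (at \<xi>)"
    and deriv_bound: "\<And>\<xi>. norm (vector_derivative (fourier_transform \<phi>) (at \<xi>))
                  \<le> C * (1 + \<xi> ^ (2 * n)) * exp (- 2 * pi * \<bar>\<xi>\<bar>)"
begin

abbreviation "\<Phi> \<equiv> fourier_transform \<phi>"
abbreviation "\<Phi>' \<xi> \<equiv> vector_derivative \<Phi> (at \<xi>)"

lemma has_vector_derivative_\<Phi>: "(\<Phi> has_vector_derivative \<Phi>' \<xi>) (at \<xi>)"
  using differentiable vector_derivative_works by blast

lemma upper': "norm (\<Phi> \<xi>) \<le> 2 * B * (1 + \<bar>\<xi>\<bar>) ^ (2 * n) * exp (- 2 * pi * \<bar>\<xi>\<bar>)"
  using order_trans[OF upper mult_right_mono[OF mult_left_mono[OF one_plus_power_le]]] pos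
  by (simp add: mult_ac)

lemma deriv_bound': "norm (\<Phi>' \<xi>) \<le> 2 * C * (1 + \<bar>\<xi>\<bar>) ^ (2 * n) * exp (- 2 * pi * \<bar>\<xi>\<bar>)"
  using order_trans[OF deriv_bound mult_right_mono[OF mult_left_mono[OF one_plus_power_le]]] pos
  by (simp add: mult_ac)

lemma inverse_bound: "\<Phi> \<xi> \<noteq> 0" "1 / norm (\<Phi> \<xi>) \<le> 1 / A * (1 + \<xi> ^ (2 * n)) * exp (2 * pi * \<bar>\<xi>\<bar>)"
proof -
  let ?p = "1 + \<xi> ^ (2 * n)"
  have L: "0 < A * exp (- 2 * pi * \<bar>\<xi>\<bar>) / ?p" using pos one_plus_power_pos by auto
  then show "\<Phi> \<xi> \<noteq> 0" using lower[of \<xi>] by auto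
  have "1 / norm (\<Phi> \<xi>) \<le> 1 / (A * exp (- 2 * pi * \<bar>\<xi>\<bar>) / ?p)"
    using L lower[of \<xi>] by (intro divide_left_mono mult_pos_pos) auto
  also have "\<dots> = 1 / A * ?p * exp (2 * pi * \<bar>\<xi>\<bar>)" by (simp add: exp_minus field_simps)
  finally show "1 / norm (\<Phi> \<xi>) \<le> 1 / A * ?p * exp (2 * pi * \<bar>\<xi>\<bar>)" .
qed

lemma inverse_bound': "1 / norm (\<Phi> \<xi>) \<le> 2 / A * (1 + \<bar>\<xi>\<bar>) ^ (2 * n) * exp (2 * pi * \<bar>\<xi>\<bar>)"
  using order_trans[OF inverse_bound(2) mult_right_mono[OF mult_left_mono[OF one_plus_power_le]]] pos
  by (simp add: mult_ac)

lemma integrable_\<Phi>: "integrable lborel \<Phi>"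
proof -
  obtain K where K: "\<And>x. (1 + \<bar>x\<bar>) ^ (2 * n + 2) * exp (- (2 * pi) * \<bar>x\<bar>) \<le> K"
    using polynomial_exp_bounded[of "2 * pi" "2 * n + 2"] by auto
  have "norm (\<Phi> x) \<le> (2 * B * K) / (1 + x\<^sup>2)" for x
  proof -
    have "norm (\<Phi> x) * (1 + x\<^sup>2) \<le> 2 * B * (1 + \<bar>x\<bar>) ^ (2 * n) * exp (- 2 * pi * \<bar>x\<bar>) * (1 + \<bar>x\<bar>)\<^sup>2"
      using pos by (intro mult_mono upper' one_plus_square_le) auto
    also have "\<dots> = 2 * B * ((1 + \<bar>x\<bar>) ^ (2 * n + 2) * exp (- (2 * pi) * \<bar>x\<bar>))"
      by (simp add: power_add power2_eq_square mult_ac)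
    also have "\<dots> \<le> 2 * B * K" using pos by (intro mult_left_mono K) auto
    finally show ?thesis by (simp add: pos_le_divide_eq)
  qed
  then show ?thesis
    by (rule integrable_decay[OF borel_measurable_fourier_transform[OF integrable_window]])
qed

lemma window_inversion: "AE t in lborel. \<phi> t = fourier_transform \<Phi> (- t)"
  using fourier_inversion_AE[OF integrable_window integrable_\<Phi>] by eventually_elim simp

lemma gauss_weight_has_derivative:
  "((\<lambda>x. complex_of_real (gauss_weight \<sigma> x)) has_vector_derivative
     of_real (- 4 * pi\<^sup>2 * \<sigma>\<^sup>2 * \<xi> * gauss_weight \<sigma> \<xi>)) (at \<xi>)"
proof -
  have "(gauss_weight \<sigma> has_real_derivative - 4 * pi\<^sup>2 * \<sigma>\<^sup>2 * \<xi> * gauss_weight \<sigma> \<xi>) (at \<xi>)"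
    unfolding gauss_weight_def[abs_def]
    by (auto intro!: derivative_eq_intros simp: power2_eq_square algebra_simps)
  then show ?thesis
    by (rule has_vector_derivative_of_real)
qed

text \<open>The Gaussian is \<open>h * \<phi>\<close> with \<open>h\<close> the inverse transform of \<open>gauss_weight \<sigma> / \<Phi>\<close>, which is
  integrable because the quotient and its derivative still decay.\<close>
lemma gauss_eq_conv:
  assumes \<sigma>: "\<sigma> > 0"
  obtains h where "integrable lborel h" "\<And>t. L1_conv h \<phi> t = of_real (normal_density 0 \<sigma> t)"
proof -
  let ?E = "gauss_weight \<sigma>"
  define \<tau> where "\<tau> \<xi> = of_real (?E \<xi>) / \<Phi> \<xi>" for \<xi>
  define \<tau>' where "\<tau>' \<xi> = of_real (- 4 * pi\<^sup>2 * \<sigma>\<^sup>2 * \<xi> * ?E \<xi>) / \<Phi> \<xi> - of_real (?E \<xi>) * \<Phi>' \<xi> / (\<Phi> \<xi>)\<^sup>2" for \<xi>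
  have nz: "\<Phi> \<xi> \<noteq> 0" for \<xi> by (rule inverse_bound)
  have d: "(\<tau> has_vector_derivative \<tau>' \<xi>) (at \<xi>)" for \<xi>
  proof -
    have "((\<lambda>x. inverse (\<Phi> x)) has_vector_derivative - (inverse (\<Phi> \<xi>) * \<Phi>' \<xi> * inverse (\<Phi> \<xi>))) (at \<xi>)"
      using Deriv.has_derivative_inverse[OF nz[of \<xi>] has_vector_derivative_\<Phi>[of \<xi>, unfolded has_vector_derivative_def]]
      unfolding has_vector_derivative_def by (simp add: mult_ac scaleR_conv_of_real)
    from has_vector_derivative_mult[OF gauss_weight_has_derivative[of \<sigma>] this]
    show ?thesis unfolding \<tau>_def[abs_def] divide_inverse
      by (rule has_vector_derivative_eq_rhs)
         (simp add: \<tau>'_def divide_inverse power2_eq_square algebra_simps)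
  qed
  define a where "a = 2 * pi\<^sup>2 * \<sigma>\<^sup>2"
  have a: "a > 0" using \<sigma> by (simp add: a_def)
  have E: "?E x = exp (- a * x\<^sup>2)" for x by (simp add: gauss_weight_def a_def)
  have E0: "0 \<le> ?E x" for x by (simp add: gauss_weight_bounds less_imp_le)
  let ?P = "\<lambda>x::real. 1 + \<bar>x\<bar>"
  have P1: "1 \<le> ?P x" for x by simp
  \<comment> \<open>The worst power comes from \<Phi>' / \<Phi>^2, which has 2n + 2 (2n) = 6n; the
    derivative of the Gaussian brings 2n + 1. So 6n + 1 covers both for every n, and two more powers
    leave 1 / (1 + x^2). The exponentials combine to exp (2 pi |x|) in each term.\<close>
  obtain K where K: "K > 0" "\<And>x. ?P x ^ (6 * n + 3) * exp (2 * pi * \<bar>x\<bar>) * exp (- a * x\<^sup>2) \<le> K"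
    using polynomial_gauss_bounded[OF a, of "6 * n + 3" "2 * pi"] by blast
  have K': "c * ?P x ^ j * exp (2 * pi * \<bar>x\<bar>) * ?E x \<le> c * K / (1 + x\<^sup>2)" if "j \<le> 6 * n + 1" "c \<ge> 0" for c j x
  proof -
    have "(?P x ^ j * exp (2 * pi * \<bar>x\<bar>) * ?E x) * (1 + x\<^sup>2) \<le> (?P x ^ (6 * n + 1) * exp (2 * pi * \<bar>x\<bar>) * ?E x) * (?P x)\<^sup>2"
      using that by (intro mult_mono one_plus_square_le power_increasing) (auto simp: E0)
    also have "\<dots> = ?P x ^ (6 * n + 1 + 2) * exp (2 * pi * \<bar>x\<bar>) * exp (- a * x\<^sup>2)"
      unfolding power_add[of _ "6 * n + 1" 2] E by (simp only: mult_ac)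
    also have "\<dots> \<le> K" using K(2)[of x] by (simp add: numeral_3_eq_3)
    finally have "c * ((?P x ^ j * exp (2 * pi * \<bar>x\<bar>) * ?E x) * (1 + x\<^sup>2)) \<le> c * K"
      using that by (intro mult_left_mono) auto
    then show ?thesis by (simp add: pos_le_divide_eq mult_ac)
  qed
  define c0 where "c0 = 2 / A"
  define c1 where "c1 = 4 * pi\<^sup>2 * \<sigma>\<^sup>2 * (2 / A)"
  define c2 where "c2 = 2 * C * (2 / A)\<^sup>2"
  have c: "c0 > 0" "c1 > 0" "c2 > 0" using pos \<sigma> by (auto simp: c0_def c1_def c2_def)
  have b0: "norm (\<tau> x) \<le> c0 * K / (1 + x\<^sup>2)" for x
  proof -
    have "norm (\<tau> x) = ?E x * (1 / norm (\<Phi> x))" by (simp add: \<tau>_def norm_divide E0)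
    also have "\<dots> \<le> ?E x * (2 / A * ?P x ^ (2 * n) * exp (2 * pi * \<bar>x\<bar>))"
      by (intro mult_left_mono inverse_bound' E0)
    also have "\<dots> = c0 * ?P x ^ (2 * n) * exp (2 * pi * \<bar>x\<bar>) * ?E x" by (simp add: c0_def)
    also have "\<dots> \<le> c0 * K / (1 + x\<^sup>2)" by (rule K') (use c in auto)
    finally show ?thesis .
  qed
  have b1: "norm (\<tau>' x) \<le> (c1 + c2) * K / (1 + x\<^sup>2)" for x
  proof -
    have "norm (of_real (- 4 * pi\<^sup>2 * \<sigma>\<^sup>2 * x * ?E x) / \<Phi> x) = 4 * pi\<^sup>2 * \<sigma>\<^sup>2 * \<bar>x\<bar> * ?E x * (1 / norm (\<Phi> x))"
      unfolding norm_divide norm_of_real by (simp add: abs_mult E0)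
    also have "\<dots> \<le> 4 * pi\<^sup>2 * \<sigma>\<^sup>2 * ?P x * ?E x * (2 / A * ?P x ^ (2 * n) * exp (2 * pi * \<bar>x\<bar>))"
      using pos by (intro mult_mono inverse_bound') (auto simp: E0)
    also have "\<dots> = c1 * ?P x ^ (2 * n + 1) * exp (2 * pi * \<bar>x\<bar>) * ?E x" by (simp add: c1_def)
    also have "\<dots> \<le> c1 * K / (1 + x\<^sup>2)" by (rule K') (use c in auto)
    finally have 1: "norm (of_real (- 4 * pi\<^sup>2 * \<sigma>\<^sup>2 * x * ?E x) / \<Phi> x) \<le> c1 * K / (1 + x\<^sup>2)" .
    have "norm (of_real (?E x) * \<Phi>' x / (\<Phi> x)\<^sup>2) = ?E x * norm (\<Phi>' x) * (1 / norm (\<Phi> x))\<^sup>2"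
      by (simp add: norm_divide norm_mult norm_power E0 power_divide)
    also have "\<dots> \<le> ?E x * (2 * C * ?P x ^ (2 * n) * exp (- 2 * pi * \<bar>x\<bar>)) *
        (2 / A * ?P x ^ (2 * n) * exp (2 * pi * \<bar>x\<bar>))\<^sup>2"
      using pos by (intro mult_mono inverse_bound' power_mono deriv_bound') (auto simp: E0)
    also have "\<dots> = c2 * ?P x ^ (6 * n) * exp (2 * pi * \<bar>x\<bar>) * ?E x"
    proof -
      have "exp (- 2 * pi * \<bar>x\<bar>) * exp (2 * pi * \<bar>x\<bar>) = 1" by (simp flip: exp_add)
      moreover have "?P x ^ (2 * n) * (?P x ^ (2 * n))\<^sup>2 = ?P x ^ (6 * n)"
        by (simp add: power2_eq_square flip: power_add)
      moreover have "?E x * (2 * C * ?P x ^ (2 * n) * exp (- 2 * pi * \<bar>x\<bar>)) *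
          (2 / A * ?P x ^ (2 * n) * exp (2 * pi * \<bar>x\<bar>))\<^sup>2 =
          (2 * C * (2 / A)\<^sup>2) * (?P x ^ (2 * n) * (?P x ^ (2 * n))\<^sup>2) *
          ((exp (- 2 * pi * \<bar>x\<bar>) * exp (2 * pi * \<bar>x\<bar>)) * exp (2 * pi * \<bar>x\<bar>)) * ?E x"
        by (simp only: power_mult_distrib power2_eq_square mult_ac)
      ultimately show ?thesis by (simp add: c2_def)
    qed
    also have "\<dots> \<le> c2 * K / (1 + x\<^sup>2)" by (rule K') (use c in auto)
    finally have 2: "norm (of_real (?E x) * \<Phi>' x / (\<Phi> x)\<^sup>2) \<le> c2 * K / (1 + x\<^sup>2)" .
    show ?thesis unfolding \<tau>'_def
      using order_trans[OF norm_triangle_ineq4 add_mono[OF 1 2]] by (simp add: distrib_right add_divide_distrib)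
  qed
  define M where "M = (c0 + c1 + c2) * K"
  have M: "M > 0" using c K by (simp add: M_def)
  have bM: "norm (\<tau> x) \<le> M / (1 + x\<^sup>2)" "norm (\<tau>' x) \<le> M / (1 + x\<^sup>2)" for x
    using c K by (auto intro!: order_trans[OF b0] order_trans[OF b1] divide_right_mono mult_right_mono simp: M_def)
  have cont: "continuous_on UNIV \<tau>"
    by (intro continuous_at_imp_continuous_on ballI has_vector_derivative_continuous[OF d])
  have int\<tau>: "integrable lborel \<tau>"
    by (rule integrable_decay[OF borel_measurable_continuous_onI[OF cont] bM(1)])
  have intF: "integrable lborel (fourier_transform \<tau>)"
    by (rule fourier_transform_decay[OF M d bM])
  define h where "h s = fourier_transform \<tau> (- s)" for s
  have h: "integrable lborel h"
    using integrable_lborel_reflect[OF intF, of 0] by (simp add: h_def[abs_def])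
  have Fh: "fourier_transform h \<xi> = \<tau> \<xi>" for \<xi>
  proof -
    have "fourier_transform h \<xi> = (\<integral>s. fourier_transform \<tau> (0 - s) * cis (- 2 * pi * ((0 - s) * (- \<xi>))) \<partial>lborel)"
      unfolding fourier_transform_cis[of h] h_def by simp
    also have "\<dots> = fourier_transform (fourier_transform \<tau>) (- \<xi>)"
      unfolding fourier_transform_cis[of "fourier_transform \<tau>"]
      by (rule integral_lborel_reflect[where f="\<lambda>s. fourier_transform \<tau> s * cis (- 2 * pi * (s * (- \<xi>)))"])
    also have "\<dots> = \<tau> \<xi>"
    proof (rule fourier_inversion_continuous[OF int\<tau> intF cont])
      show "norm (\<tau> x) \<le> M" for x
        using order_trans[OF bM(1)[of x]] M by (simp add: divide_le_eq)
    qed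
    finally show ?thesis .
  qed
  have "L1_conv h \<phi> t = of_real (normal_density 0 \<sigma> t)" for t
  proof -
    have g: "integrable lborel (\<lambda>\<xi>. \<Phi> \<xi> * cis (2 * pi * (t * \<xi>)))"
      using integrable_\<Phi> by (rule integrable_times_cis) auto
    \<comment> \<open>Inversion of the window holds almost everywhere in s, which suffices under the
      integral; the identity for the convolution then holds at every t.\<close>
    have ae: "AE s in lborel. \<phi> (t - s) = fourier_transform \<Phi> (s - t)"
    proof -
      note [measurable] = borel_measurable_fourier_transform[OF integrable_\<Phi>]
        borel_measurable_integrable[OF integrable_window]
      have "AE s in lborel. \<phi> (t + (-1) * s) = fourier_transform \<Phi> (- (t + (-1) * s))"
        by (rule AE_borel_affine[OF _ _ window_inversion]) (auto intro!: pred_eq_const1)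
      then show ?thesis by simp
    qed
    have "L1_conv h \<phi> t = (\<integral>s. h s * fourier_transform \<Phi> (s - t) \<partial>lborel)"
      unfolding L1_conv_def
    proof (rule integral_cong_AE)
      note [measurable] = borel_measurable_fourier_transform[OF integrable_\<Phi>]
        borel_measurable_integrable[OF integrable_window] borel_measurable_integrable[OF h]
      show "(\<lambda>s. h s * \<phi> (t - s)) \<in> borel_measurable lborel"
        "(\<lambda>s. h s * fourier_transform \<Phi> (s - t)) \<in> borel_measurable lborel" by measurable
      show "AE s in lborel. h s * \<phi> (t - s) = h s * fourier_transform \<Phi> (s - t)"
        using ae by eventually_elim simp
    qed
    also have "\<dots> = (\<integral>\<xi>. fourier_transform h \<xi> * (\<Phi> \<xi> * cis (2 * pi * (t * \<xi>))) \<partial>lborel)"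
      by (simp add: fourier_transform_multiplication[OF h g] fourier_transform_modulate)
    also have "\<dots> = (\<integral>\<xi>. of_real (?E \<xi>) * cis (- 2 * pi * (\<xi> * (- t))) \<partial>lborel)"
      by (simp add: Fh \<tau>_def nz mult_ac)
    also have "\<dots> = of_real (normal_density 0 \<sigma> (- t))"
      unfolding fourier_transform_gauss_weight[OF \<sigma>, symmetric] fourier_transform_cis ..
    finally show ?thesis using normal_density_symmetric[of \<sigma> 0 t] by simp
  qed
  with h show ?thesis by (rule that)
qed

text \<open>Stability under convolution is used twice: with \<phi> as second factor it yields all
  translates of the Gaussians, and with a Gaussian as second factor it yields the Gaussian means of
  \<open>f\<close>, which tend to \<open>f\<close> in L1.\<close>

theorem translates_dense:
  assumes V: "closed_L1_subspace V" and tr: "\<And>x. (\<lambda>t. \<phi> (t - x)) \<in> V"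
    and f: "integrable lborel f"
  shows "f \<in> V"
proof (rule closed_L1_subspace_limit[OF V f])
  let ?k = "\<lambda>m t. complex_of_real (normal_density 0 (1 / real (Suc m)) t)"
  have k: "(\<lambda>t. ?k m (t - x)) \<in> V" for m x
  proof -
    obtain h where h: "integrable lborel h" "\<And>t. L1_conv h \<phi> t = ?k m t"
      using gauss_eq_conv[of "1 / real (Suc m)"] by auto
    have "L1_conv (\<lambda>s. h (s - x)) \<phi> t = ?k m (t - x)" for t
      unfolding h(2)[symmetric] L1_conv_def
      using integral_lborel_translate[where f="\<lambda>s. h s * \<phi> (t - x - s)" and x=x] by simp
    moreover have "L1_conv (\<lambda>s. h (s - x)) \<phi> \<in> V"
      by (rule closed_L1_subspace_conv[OF V integrable_window tr integrable_lborel_translate[OF h(1)]])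
    ultimately show ?thesis by (metis (no_types, lifting) ext)
  qed
  have ki: "integrable lborel (?k m)" for m by (auto simp: integrable_of_real)
  show s: "L1_conv f (?k m) \<in> V" for m
    by (rule closed_L1_subspace_conv[OF V ki k f])
  have le: "(\<integral>t. norm (f t - L1_conv f (?k m) t) \<partial>lborel) \<le>
      (\<integral>r. std_normal_density r * L1_modulus f (1 / real (Suc m) * r) \<partial>lborel)" for m
  proof -
    have "ennreal (\<integral>t. norm (f t - L1_conv f (?k m) t) \<partial>lborel) =
        (\<integral>\<^sup>+t. ennreal (norm (f t - L1_conv f (?k m) t)) \<partial>lborel)"
      using f closed_L1_subspace_integrable[OF V s[of m]] by (subst nn_integral_eq_integral) auto
    also have "\<dots> \<le> ennreal (\<integral>r. std_normal_density r * L1_modulus f (1 / real (Suc m) * r) \<partial>lborel)"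
      unfolding L1_conv_def by (rule gauss_means_L1_bound[OF f]) simp
    finally show ?thesis by (simp add: ennreal_le_iff)
  qed
  show "(\<lambda>m. \<integral>t. norm (f t - L1_conv f (?k m) t) \<partial>lborel) \<longlonglongrightarrow> 0"
    by (rule tendsto_sandwich[OF always_eventually always_eventually tendsto_const gauss_means_L1_tendsto[OF f]])
       (simp, use le in blast)
qed

end

section \<open>Blaschke interpolation\<close>

text \<open>The product is the reciprocal of \<open>v\<close> times a Blaschke product with zeros \<open>P\<close>, normalised
  so that the partial fraction at \<open>0\<close> has coefficient \<open>1\<close>.\<close>
lemma blaschke_partial_fractions:
  fixes P :: "real set"
  assumes "finite P" "0 \<notin> P"
  shows "\<exists>c :: real \<Rightarrow> complex. \<forall>v. v \<noteq> 0 \<longrightarrow> (\<forall>p\<in>P. v \<noteq> of_real p) \<longrightarrow>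
    1 / v * (\<Prod>p\<in>P. - of_real p * (1 - of_real p * v) / (v - of_real p)) =
    1 / v - (\<Sum>p\<in>P. c p / (v - of_real p))"
  using assms
proof (induction P rule: finite_induct)
  case empty
  then show ?case by simp
next
  case (insert q P)
  then obtain c :: "real \<Rightarrow> complex" where c: "\<And>v. v \<noteq> 0 \<Longrightarrow> (\<forall>p\<in>P. v \<noteq> of_real p) \<Longrightarrow>
    1 / v * (\<Prod>p\<in>P. - of_real p * (1 - of_real p * v) / (v - of_real p)) =
    1 / v - (\<Sum>p\<in>P. c p / (v - of_real p))" by auto
  define Q where "Q = complex_of_real q"
  \<comment> \<open>\<open>\<alpha> p\<close> is the value of the new factor at p, and
    \<open>\<beta> p\<close> the residue at Q of the new factor divided by v - p. Old coefficients
    are multiplied by the former; the new coefficient collects the latter together with the residue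
    Q^2 - 1 that comes from 1 / v.\<close>
  define \<alpha> where "\<alpha> p = - Q * (1 - Q * of_real p) / (of_real p - Q)" for p :: real
  define \<beta> where "\<beta> p = - Q * (1 - Q * Q) / (Q - of_real p)" for p :: real
  define c' where "c' p = (if p = q then (\<Sum>p\<in>P. c p * \<beta> p) - (Q * Q - 1) else c p * \<alpha> p)" for p
  have "1 / v * (\<Prod>p\<in>insert q P. - of_real p * (1 - of_real p * v) / (v - of_real p)) =
      1 / v - (\<Sum>p\<in>insert q P. c' p / (v - of_real p))"
    if v: "v \<noteq> 0" "\<forall>p\<in>insert q P. v \<noteq> of_real p" for v
  proof -
    define F where "F = - Q * (1 - Q * v) / (v - Q)"
    have vQ: "v - Q \<noteq> 0" using v by (auto simp: Q_def)
    have 1: "1 / v * F = 1 / v + (Q * Q - 1) / (v - Q)"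
      unfolding F_def using vQ v(1) by (simp add: field_simps)
    have 2: "c p / (v - of_real p) * F = c p * \<alpha> p / (v - of_real p) + c p * \<beta> p / (v - Q)" if "p \<in> P" for p
    proof -
      define z where "z = complex_of_real p"
      have ne: "v - z \<noteq> 0" "z - Q \<noteq> 0" "Q - z \<noteq> 0"
        using v that insert.hyps by (auto simp: Q_def z_def)
      have "1 / (v - z) * F = \<alpha> p / (v - z) + \<beta> p / (v - Q)"
        unfolding F_def \<alpha>_def \<beta>_def z_def[symmetric] using ne vQ
        by (simp add: divide_simps) (simp add: algebra_simps)
      then have "c p * (1 / (v - z) * F) = c p * (\<alpha> p / (v - z) + \<beta> p / (v - Q))" by simp
      then show ?thesis by (simp add: z_def distrib_left)
    qed
    have "1 / v * (\<Prod>p\<in>insert q P. - of_real p * (1 - of_real p * v) / (v - of_real p)) =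
        (1 / v - (\<Sum>p\<in>P. c p / (v - of_real p))) * F"
    proof -
      have ins: "(\<Prod>p\<in>insert q P. - of_real p * (1 - of_real p * v) / (v - of_real p)) =
          F * (\<Prod>p\<in>P. - of_real p * (1 - of_real p * v) / (v - of_real p))"
        using insert.hyps by (simp add: F_def Q_def)
      have "\<forall>p\<in>P. v \<noteq> of_real p" using v by simp
      from c[OF v(1) this] show ?thesis unfolding ins by (simp only: mult.assoc mult.commute[of _ F] mult.left_commute[of _ F])
    qed
    also have "\<dots> = 1 / v * F - (\<Sum>p\<in>P. c p / (v - of_real p) * F)"
      by (simp add: left_diff_distrib sum_distrib_right)
    also have "(\<Sum>p\<in>P. c p / (v - of_real p) * F) =
        (\<Sum>p\<in>P. c p * \<alpha> p / (v - of_real p)) + (\<Sum>p\<in>P. c p * \<beta> p) / (v - Q)"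
    proof -
      have "(\<Sum>p\<in>P. c p / (v - of_real p) * F) =
          (\<Sum>p\<in>P. c p * \<alpha> p / (v - of_real p) + c p * \<beta> p / (v - Q))"
        by (rule sum.cong[OF refl 2])
      then show ?thesis by (simp only: sum.distrib sum_divide_distrib)
    qed
    also have "(\<Sum>p\<in>P. c p * \<alpha> p / (v - of_real p)) = (\<Sum>p\<in>P. c' p / (v - of_real p))"
      using insert.hyps by (intro sum.cong) (auto simp: c'_def)
    finally show ?thesis
      using insert.hyps unfolding 1 by (simp add: c'_def Q_def diff_divide_distrib)
  qed
  then show ?case by blast
qed

lemma norm_blaschke_factor:
  fixes v :: complex and p :: real
  assumes "norm v = 1"
  shows "norm (1 - of_real p * v) = norm (v - of_real p)"
proof -
  have "1 - of_real p * v = v * cnj (v - of_real p)"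
    using assms complex_norm_square[of v] by (simp add: algebra_simps)
  then show ?thesis using assms by (simp only: norm_mult complex_mod_cnj)
qed

text \<open>Up to the factor 2 pi i, the expression is the contour integral of \<open>f\<close>
  against the kernel of \<open>blaschke_partial_fractions\<close> at v = u - 1, and on the circle
  this kernel has the constant modulus \<Prod> |p|. It matters that the coefficients are chosen
  before \<open>f\<close>: later one choice has to work for all \<xi> at once.\<close>

lemma blaschke_interpolation:
  fixes P :: "real set"
  assumes P: "finite P" "P \<subseteq> {-1<..<0}"
  obtains c :: "real \<Rightarrow> complex"
  where "\<And>f G. \<lbrakk>continuous_on (cball 1 1) f; f holomorphic_on ball 1 1;
      \<And>u. norm (u - 1) = 1 \<Longrightarrow> norm (f u) \<le> G\<rbrakk>
    \<Longrightarrow> norm (f 1 - (\<Sum>p\<in>P. c p * f (1 + of_real p))) \<le> G * (\<Prod>p\<in>P. \<bar>p\<bar>)"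
proof -
  have "0 \<notin> P" using P by auto
  from blaschke_partial_fractions[OF P(1) this] obtain c :: "real \<Rightarrow> complex" where
    c: "\<And>v. v \<noteq> 0 \<Longrightarrow> (\<forall>p\<in>P. v \<noteq> of_real p) \<Longrightarrow>
      1 / v * (\<Prod>p\<in>P. - of_real p * (1 - of_real p * v) / (v - of_real p)) =
      1 / v - (\<Sum>p\<in>P. c p / (v - of_real p))" by blast
  have "norm (f 1 - (\<Sum>p\<in>P. c p * f (1 + of_real p))) \<le> G * (\<Prod>p\<in>P. \<bar>p\<bar>)"
    if f: "continuous_on (cball 1 1) f" "f holomorphic_on ball 1 1"
      and G: "\<And>u. norm (u - 1) = 1 \<Longrightarrow> norm (f u) \<le> G" for f G
  proof -
    let ?R = "\<lambda>u. f u / (u - 1) - (\<Sum>p\<in>P. c p * (f u / (u - (1 + of_real p))))"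
    let ?I = "f 1 - (\<Sum>p\<in>P. c p * f (1 + of_real p))"
    have "G \<ge> 0" using order_trans[OF norm_ge_zero G[of 2]] by simp
    have "(?R has_contour_integral (2 * of_real pi * \<i> * f 1 -
        (\<Sum>p\<in>P. c p * (2 * of_real pi * \<i> * f (1 + of_real p))))) (circlepath 1 1)"
    proof (intro has_contour_integral_diff has_contour_integral_sum has_contour_integral_lmul
        Cauchy_integral_circlepath f P)
      show "norm (1 + of_real p - 1 :: complex) < 1" if "p \<in> P" for p
        using P that by auto
    qed simp
    moreover have "2 * of_real pi * \<i> * f 1 - (\<Sum>p\<in>P. c p * (2 * of_real pi * \<i> * f (1 + of_real p)))
        = 2 * of_real pi * \<i> * ?I"
      by (simp add: right_diff_distrib sum_distrib_left mult_ac)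
    ultimately have I: "(?R has_contour_integral (2 * of_real pi * \<i> * ?I)) (circlepath 1 1)" by simp
    have "norm (2 * of_real pi * \<i> * ?I) \<le> (G * (\<Prod>p\<in>P. \<bar>p\<bar>)) * (2 * pi * 1)"
    proof (rule has_contour_integral_bound_circlepath[OF I])
      show "0 \<le> G * (\<Prod>p\<in>P. \<bar>p\<bar>)" using \<open>G \<ge> 0\<close> by (simp add: prod_nonneg)
      fix u :: complex assume u: "norm (u - 1) = 1"
      define v where "v = u - 1"
      have nv: "norm v = 1" using u by (simp add: v_def)
      have v: "v \<noteq> 0" "\<forall>p\<in>P. v \<noteq> of_real p" using nv P by auto
      have "?R u = f u * (1 / v - (\<Sum>p\<in>P. c p / (v - of_real p)))"
        by (simp add: v_def right_diff_distrib sum_distrib_left algebra_simps)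
      also have "\<dots> = f u * (1 / v * (\<Prod>p\<in>P. - of_real p * (1 - of_real p * v) / (v - of_real p)))"
        by (simp only: c[OF v])
      also have "norm \<dots> = norm (f u) * (\<Prod>p\<in>P. \<bar>p\<bar>)"
      proof -
        have "norm (- of_real p * (1 - of_real p * v) / (v - of_real p)) = \<bar>p\<bar>" if "p \<in> P" for p
          using norm_blaschke_factor[OF nv, of p] v that by (simp add: norm_mult norm_divide)
        then have "(\<Prod>p\<in>P. norm (- of_real p * (1 - of_real p * v) / (v - of_real p))) = (\<Prod>p\<in>P. \<bar>p\<bar>)"
          by (intro prod.cong) auto
        then show ?thesis using nv by (simp only: norm_mult norm_divide prod_norm[symmetric]) simp
      qed
      also have "\<dots> \<le> G * (\<Prod>p\<in>P. \<bar>p\<bar>)"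
        using G[OF u] by (intro mult_right_mono) (auto simp: prod_nonneg)
      finally show "norm (?R u) \<le> G * (\<Prod>p\<in>P. \<bar>p\<bar>)" .
    qed simp
    then show ?thesis by (simp add: norm_mult)
  qed
  then show ?thesis by (rule that)
qed

section \<open>Powers of u on the tangent disc\<close>

lemma cball_1_1_Re: "norm (u - 1) \<le> 1 \<Longrightarrow> (norm u)\<^sup>2 \<le> 2 * Re u"
proof -
  assume "norm (u - 1) \<le> 1"
  then have "(norm (u - 1))\<^sup>2 \<le> 1" by (simp add: abs_square_le_1)
  then show ?thesis unfolding cmod_power2 by (simp add: power2_eq_square algebra_simps)
qed

lemma norm_exp_Ln_bound:
  assumes "norm (u - 1) \<le> 1" and nz: "u \<noteq> 0"
  shows "norm (exp (\<i> * of_real a * Ln u)) \<le> exp (\<bar>a\<bar> * \<bar>Im (Ln u)\<bar>)" "\<bar>Im (Ln u)\<bar> \<le> pi / 2"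
proof -
  have "norm (exp (\<i> * of_real a * Ln u)) = exp (- (a * Im (Ln u)))" by (simp add: norm_exp_eq_Re)
  also have "\<dots> \<le> exp (\<bar>a\<bar> * \<bar>Im (Ln u)\<bar>)" by (simp flip: abs_mult)
  finally show "norm (exp (\<i> * of_real a * Ln u)) \<le> exp (\<bar>a\<bar> * \<bar>Im (Ln u)\<bar>)" .
  show "\<bar>Im (Ln u)\<bar> \<le> pi / 2"
  proof -
    have "0 \<le> Re u" using cball_1_1_Re[OF assms(1)] zero_le_power2[of "norm u"] by linarith
    then show ?thesis using Re_Ln_pos_le[OF nz] by simp
  qed
qed

text \<open>One power of u tames \<open>k\<close>, the other m give the decay and force continuity
  at 0. On the circle |u| = 2 sin d \<le> 2 d, where d is the angle between u and the imaginary
  axis, while the exponential is at most exp (pi |a| / 2) exp (- |a| d). So each factor |u| is paid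
  for by |a| d, using y^m \<le> m! exp y. The parameter \<open>k\<close> allows the derivative in
  \<xi> to be treated along with the function.\<close>

lemma interpolant_bounds:
  fixes k :: "complex \<Rightarrow> complex" and a D :: real and m :: nat
  assumes k: "continuous_on (cball 1 1 - {0}) k" "k holomorphic_on ball 1 1"
    and D: "\<And>u. norm (u - 1) \<le> 1 \<Longrightarrow> norm u * norm (k u) \<le> D" and m: "m > 0"
  defines "f \<equiv> \<lambda>u. u ^ Suc m * k u * exp (\<i> * of_real a * Ln u)"
  shows "continuous_on (cball 1 1) f" "f holomorphic_on ball 1 1"
    and "norm (u - 1) = 1 \<Longrightarrow>
      norm (f u) \<le> D * 4 ^ m * fact m * exp 1 * exp (pi / 2 * \<bar>a\<bar>) / (1 + \<bar>a\<bar> / 4) ^ m"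
proof -
  have D0: "D \<ge> 0" using D[of 1] by (auto intro: order_trans[OF norm_ge_zero])
  have bd: "norm (f u) \<le> D * norm u ^ m * exp (\<bar>a\<bar> * \<bar>Im (Ln u)\<bar>)" if u: "norm (u - 1) \<le> 1" "u \<noteq> 0" for u
  proof -
    have "norm (f u) = norm u ^ m * (norm u * norm (k u)) * norm (exp (\<i> * of_real a * Ln u))"
      by (simp add: f_def norm_mult norm_power mult_ac)
    also have "\<dots> \<le> norm u ^ m * D * exp (\<bar>a\<bar> * \<bar>Im (Ln u)\<bar>)"
      using D0 by (intro mult_mono D u norm_exp_Ln_bound mult_left_mono) auto
    finally show ?thesis by (simp add: mult_ac)
  qed
  have Re: "Re u > 0" if "norm (u - 1) \<le> 1" "u \<noteq> 0" for u
    using cball_1_1_Re[OF that(1)] that(2) by (smt (verit) zero_less_norm_iff zero_less_power2)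
  have nonpos: "u \<notin> \<real>\<^sub>\<le>\<^sub>0" if "norm (u - 1) \<le> 1" "u \<noteq> 0" for u :: complex
    using Re[OF that] by (auto simp: complex_nonpos_Reals_iff)
  show "f holomorphic_on ball 1 1"
    unfolding f_def
  proof (intro holomorphic_intros k)
    show "(ball 1 1 :: complex set) \<inter> \<real>\<^sub>\<le>\<^sub>0 = {}"
    proof (rule equals0I)
      fix x :: complex assume "x \<in> ball 1 1 \<inter> \<real>\<^sub>\<le>\<^sub>0"
      then have x: "x \<in> ball 1 1" "x \<in> \<real>\<^sub>\<le>\<^sub>0" by auto
      have "norm (x - 1) \<le> 1" using x(1) by (simp add: dist_norm norm_minus_commute)
      moreover have "x \<noteq> 0" using x(1) by auto
      ultimately show False using nonpos x(2) by blast
    qed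
  qed
  have c1: "continuous_on (cball 1 1 - {0}) f"
    unfolding f_def
  proof (intro continuous_intros k)
    fix z :: complex assume "z \<in> cball 1 1 - {0}"
    then show "z \<notin> \<real>\<^sub>\<le>\<^sub>0" using nonpos[of z] by (auto simp: dist_norm norm_minus_commute)
  qed
  have c0: "(f \<longlongrightarrow> f 0) (at 0 within cball 1 1)"
  proof -
    have "((\<lambda>u::complex. D * norm u ^ m * exp (\<bar>a\<bar> * (pi / 2))) \<longlongrightarrow> D * norm (0::complex) ^ m * exp (\<bar>a\<bar> * (pi / 2))) (at 0 within cball 1 1)"
      by (intro tendsto_intros)
    then have lim: "((\<lambda>u. D * norm u ^ m * exp (\<bar>a\<bar> * (pi / 2))) \<longlongrightarrow> 0) (at (0::complex) within cball 1 1)"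
      using m by (simp only: norm_zero zero_power mult_zero_right mult_zero_left)
    have "\<forall>\<^sub>F u in at 0 within cball 1 1. norm (f u) \<le> D * norm u ^ m * exp (\<bar>a\<bar> * (pi / 2))"
      unfolding eventually_at_filter
    proof (intro always_eventually allI impI)
      fix u :: complex assume "u \<noteq> 0" "u \<in> cball 1 1"
      then have u: "norm (u - 1) \<le> 1" "u \<noteq> 0" by (simp_all add: dist_norm norm_minus_commute)
      show "norm (f u) \<le> D * norm u ^ m * exp (\<bar>a\<bar> * (pi / 2))"
      proof -
        have "\<bar>a\<bar> * \<bar>Im (Ln u)\<bar> \<le> \<bar>a\<bar> * (pi / 2)"
          by (intro mult_left_mono norm_exp_Ln_bound(2)[OF u]) simp
        then show ?thesis
          using D0 by (intro order_trans[OF bd[OF u]] mult_left_mono) simp_all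
      qed
    qed
    from Lim_null_comparison[OF this lim] show ?thesis by (simp add: f_def)
  qed
  show "continuous_on (cball 1 1) f"
    unfolding continuous_on_def
  proof
    fix z :: complex assume z: "z \<in> cball 1 1"
    show "(f \<longlongrightarrow> f z) (at z within cball 1 1)"
    proof (cases "z = 0")
      case False
      then have "(f \<longlongrightarrow> f z) (at z within (cball 1 1 - {0}))" using c1 z by (simp add: continuous_on_def)
      moreover have "at z within (cball 1 1 - {0}) = at z within cball 1 1"
        using False by (intro at_within_nhd[of _ "- {0}"]) auto
      ultimately show ?thesis by simp
    qed (use c0 in simp)
  qed
  show "norm (f u) \<le> D * 4 ^ m * fact m * exp 1 * exp (pi / 2 * \<bar>a\<bar>) / (1 + \<bar>a\<bar> / 4) ^ m"
    if u: "norm (u - 1) = 1"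
  proof (cases "u = 0")
    case True
    then show ?thesis using D0 by (simp add: f_def)
  next
    case False
    define \<theta> where "\<theta> = \<bar>Im (Ln u)\<bar>"
    define d where "d = pi / 2 - \<theta>"
    \<comment> \<open>For the exponent a = 4 sg \<xi> used later this is |\<xi>|.\<close>
    define x where "x = \<bar>a\<bar> / 4"
    have u': "norm (u - 1) \<le> 1" "u \<noteq> 0" using u False by simp_all
    have d: "0 \<le> d" "d \<le> pi / 2" using norm_exp_Ln_bound(2)[OF u'] by (auto simp: d_def \<theta>_def)
    have x: "x \<ge> 0" by (simp add: x_def)
    have "(norm (u - 1))\<^sup>2 = 1" using u by simp
    then have "(norm u)\<^sup>2 = 2 * Re u" unfolding cmod_power2 by (simp add: power2_eq_square algebra_simps)
    also have "Re u = norm u * cos (Im (Ln u))"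
      using False by (metis Re_exp exp_Ln norm_exp_eq_Re)
    finally have "norm u * norm u = norm u * (2 * cos (Im (Ln u)))" by (simp add: power2_eq_square)
    then have "norm u = 2 * cos \<theta>" using False by (simp add: \<theta>_def)
    also have "cos \<theta> = sin d" by (simp add: d_def sin_diff)
    also have "sin d \<le> d" using d by (intro sin_x_le_x)
    finally have nu: "norm u \<le> 2 * d" by simp
    have key: "(norm u * (1 + x)) ^ m * exp (- 4 * x * d) \<le> 4 ^ m * fact m * exp 1"
    proof -
      have "norm u * (1 + x) \<le> 2 * d * (1 + x)" using nu x by (intro mult_right_mono) auto
      also have "\<dots> \<le> 4 * (1 + 4 * x * d)"
      proof -
        have "2 * d \<le> 4" using d pi_less_4 by linarith
        moreover have "0 \<le> x * d" using x d by simp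
        ultimately show ?thesis by (simp add: algebra_simps)
      qed
      finally have "(norm u * (1 + x)) ^ m \<le> (4 * (1 + 4 * x * d)) ^ m"
        using x by (intro power_mono) auto
      also have "\<dots> \<le> 4 ^ m * (fact m * exp (1 + 4 * x * d))"
        unfolding power_mult_distrib using x d by (intro mult_left_mono power_le_fact_exp) auto
      finally have "(norm u * (1 + x)) ^ m * exp (- 4 * x * d) \<le>
          4 ^ m * (fact m * exp (1 + 4 * x * d)) * exp (- 4 * x * d)"
        by (intro mult_right_mono) auto
      also have "\<dots> = 4 ^ m * fact m * exp 1" by (simp add: mult.assoc flip: exp_add)
      finally show ?thesis .
    qed
    have e: "exp (\<bar>a\<bar> * \<theta>) = exp (pi / 2 * \<bar>a\<bar>) * exp (- 4 * x * d)"
      by (simp add: x_def d_def algebra_simps flip: exp_add)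
    have "norm (f u) * (1 + x) ^ m \<le> D * norm u ^ m * exp (\<bar>a\<bar> * \<theta>) * (1 + x) ^ m"
      using bd[OF u'] x by (intro mult_right_mono) (auto simp: \<theta>_def)
    also have "\<dots> = D * exp (pi / 2 * \<bar>a\<bar>) * ((norm u * (1 + x)) ^ m * exp (- 4 * x * d))"
      unfolding e by (simp add: power_mult_distrib)
    also have "\<dots> \<le> D * exp (pi / 2 * \<bar>a\<bar>) * (4 ^ m * fact m * exp 1)"
      using D0 by (intro mult_left_mono key) auto
    finally have "norm (f u) * (1 + x) ^ m \<le> D * 4 ^ m * fact m * exp 1 * exp (pi / 2 * \<bar>a\<bar>)"
      by (simp add: mult_ac)
    then show ?thesis using x by (simp add: pos_le_divide_eq x_def)
  qed
qed

lemma norm_mult_Ln_bound: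
  assumes "norm (u - 1) \<le> 1"
  shows "norm u * norm (Ln u) \<le> 10"
proof (cases "u = 0")
  case False
  define r where "r = norm u"
  have "norm u \<le> norm (u - 1) + norm (1 :: complex)" using norm_triangle_ineq[of "u - 1" 1] by simp
  then have r: "0 < r" "r \<le> 2" using False assms by (auto simp: r_def)
  have "norm (Ln u) \<le> \<bar>Re (Ln u)\<bar> + \<bar>Im (Ln u)\<bar>" by (rule cmod_le)
  also have "\<dots> \<le> \<bar>ln r\<bar> + pi / 2"
    using norm_exp_Ln_bound(2)[OF assms False] False by (simp add: r_def)
  finally have "r * norm (Ln u) \<le> r * (\<bar>ln r\<bar> + pi / 2)" using r by (intro mult_left_mono) auto
  also have "\<dots> = r * \<bar>ln r\<bar> + r * (pi / 2)" by (simp add: distrib_left)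
  also have "r * \<bar>ln r\<bar> \<le> 2"
  proof -
    have "ln r \<le> 1" using ln_le_minus_one[of r] r by linarith
    moreover have "- ln r \<le> 1 / r" using ln_le_minus_one[of "1 / r"] r by (simp add: ln_div)
    ultimately have "\<bar>ln r\<bar> \<le> max 1 (1 / r)" by (auto simp: abs_le_iff)
    then have "r * \<bar>ln r\<bar> \<le> r * max 1 (1 / r)" using r by (intro mult_left_mono) auto
    also have "\<dots> \<le> 2" using r by (auto simp: max_def)
    finally show ?thesis .
  qed
  also have "r * (pi / 2) \<le> 2 * 2" using r pi_less_4 by (intro mult_mono) auto
  finally show ?thesis by (simp add: r_def)
qed simp

text \<open>With u = exp (- pi sg z / 2) the set \<open>S\<close> goes into the interval (0, 1), and
  exp (- 2 pi i z \<xi>) is u to the power 4 i sg \<xi>. The kernel 1 gives the first bound. The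
  kernel 4 i sg Ln u, which differentiation in \<xi> brings down, gives the second; it vanishes at u
  = 1, so no leading term remains. The same \<open>d\<close> works in both because the interpolation
  coefficients do not depend on the interpolated function.\<close>

lemma exponential_interpolation:
  fixes m :: nat
  assumes m: "m > 0"
  obtains K :: real where "K > 0"
    "\<And>(S :: real set) sg :: real. \<lbrakk>finite S; sg = 1 \<or> sg = -1; \<And>\<mu>. \<mu> \<in> S \<Longrightarrow> sg * \<mu> > 0\<rbrakk> \<Longrightarrow>
      \<exists>d :: real \<Rightarrow> complex. \<forall>\<xi>.
        norm (1 - (\<Sum>\<mu>\<in>S. d \<mu> * cis (- 2 * pi * (\<mu> * \<xi>))))
          \<le> K * (\<Prod>\<mu>\<in>S. 1 - exp (- (pi / 2) * \<bar>\<mu>\<bar>)) * exp (2 * pi * \<bar>\<xi>\<bar>) / (1 + \<bar>\<xi>\<bar>) ^ m \<and>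
        norm (\<Sum>\<mu>\<in>S. d \<mu> * (\<i> * of_real (- 2 * pi * \<mu>)) * cis (- 2 * pi * (\<mu> * \<xi>)))
          \<le> K * (\<Prod>\<mu>\<in>S. 1 - exp (- (pi / 2) * \<bar>\<mu>\<bar>)) * exp (2 * pi * \<bar>\<xi>\<bar>) / (1 + \<bar>\<xi>\<bar>) ^ m"
proof -
  \<comment> \<open>The number 40 bounds |u| |k u| on the disc for both kernels: for 4 i sg Ln u it
    is 4 times the bound in \<open>norm_mult_Ln_bound\<close>, and for the constant 1 it is
    ample.\<close>
  define K :: real where "K = 40 * 4 ^ m * fact m * exp 1"
  have "K > 0" by (simp add: K_def)
  moreover have "\<exists>d :: real \<Rightarrow> complex. \<forall>\<xi>.
        norm (1 - (\<Sum>\<mu>\<in>S. d \<mu> * cis (- 2 * pi * (\<mu> * \<xi>))))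
          \<le> K * (\<Prod>\<mu>\<in>S. 1 - exp (- (pi / 2) * \<bar>\<mu>\<bar>)) * exp (2 * pi * \<bar>\<xi>\<bar>) / (1 + \<bar>\<xi>\<bar>) ^ m \<and>
        norm (\<Sum>\<mu>\<in>S. d \<mu> * (\<i> * of_real (- 2 * pi * \<mu>)) * cis (- 2 * pi * (\<mu> * \<xi>)))
          \<le> K * (\<Prod>\<mu>\<in>S. 1 - exp (- (pi / 2) * \<bar>\<mu>\<bar>)) * exp (2 * pi * \<bar>\<xi>\<bar>) / (1 + \<bar>\<xi>\<bar>) ^ m"
    if S: "finite S" and sg: "sg = 1 \<or> sg = -1" and S0: "\<And>\<mu>. \<mu> \<in> S \<Longrightarrow> sg * \<mu> > 0" for S :: "real set" and sg :: real
  proof -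
    define w where "w \<mu> = exp (- (pi / 2) * (sg * \<mu>))" for \<mu>
    define p where "p \<mu> = w \<mu> - 1" for \<mu>
    have abs: "\<bar>\<mu>\<bar> = sg * \<mu>" if "\<mu> \<in> S" for \<mu> using sg S0[OF that] by auto
    have sg2: "sg * sg = 1" using sg by auto
    have inj: "inj_on p S" using sg by (auto simp: inj_on_def p_def w_def)
    have P: "finite (p ` S)" "p ` S \<subseteq> {-1<..<0}" using S S0 by (auto simp: p_def w_def)
    obtain c :: "real \<Rightarrow> complex" where c: "\<And>f G. \<lbrakk>continuous_on (cball 1 1) f; f holomorphic_on ball 1 1;
      \<And>u. norm (u - 1) = 1 \<Longrightarrow> norm (f u) \<le> G\<rbrakk>
      \<Longrightarrow> norm (f 1 - (\<Sum>p\<in>p ` S. c p * f (1 + of_real p))) \<le> G * (\<Prod>p\<in>p ` S. \<bar>p\<bar>)"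
      using blaschke_interpolation[OF P] by metis
    define d where "d \<mu> = c (p \<mu>) * of_real (w \<mu>) ^ Suc m" for \<mu>
    have wp: "1 + complex_of_real (p \<mu>) = of_real (w \<mu>)" for \<mu> by (simp add: p_def)
    have prod: "(\<Prod>p\<in>p ` S. \<bar>p\<bar>) = (\<Prod>\<mu>\<in>S. 1 - exp (- (pi / 2) * \<bar>\<mu>\<bar>))"
    proof -
      have "\<bar>p \<mu>\<bar> = 1 - exp (- (pi / 2) * \<bar>\<mu>\<bar>)" if "\<mu> \<in> S" for \<mu>
      proof -
        have "p \<mu> < 0" using P(2) that by auto
        then show ?thesis by (simp add: p_def w_def abs[OF that])
      qed
      then show ?thesis by (subst prod.reindex[OF inj], intro prod.cong) auto
    qed
    have Lnw: "Ln (of_real (w \<mu>)) = of_real (- (pi / 2) * (sg * \<mu>))" for \<mu>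
      by (simp add: w_def Ln_of_real)
    have ew: "exp (\<i> * of_real (4 * sg * \<xi>) * Ln (of_real (w \<mu>))) = cis (- 2 * pi * (\<mu> * \<xi>))" for \<mu> \<xi>
    proof -
      have "\<i> * of_real (4 * sg * \<xi>) * Ln (of_real (w \<mu>)) =
          \<i> * of_real ((4 * sg * \<xi>) * (- (pi / 2) * (sg * \<mu>)))"
        unfolding Lnw of_real_mult by (simp only: mult.assoc)
      also have "(4 * sg * \<xi>) * (- (pi / 2) * (sg * \<mu>)) = (sg * sg) * (- 2 * pi * (\<mu> * \<xi>))" by simp
      finally show ?thesis by (simp only: sg2 mult_1 cis_conv_exp)
    qed
    have est: "norm (k 1 - (\<Sum>\<mu>\<in>S. d \<mu> * k (of_real (w \<mu>)) * cis (- 2 * pi * (\<mu> * \<xi>))))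
        \<le> K * (\<Prod>\<mu>\<in>S. 1 - exp (- (pi / 2) * \<bar>\<mu>\<bar>)) * exp (2 * pi * \<bar>\<xi>\<bar>) / (1 + \<bar>\<xi>\<bar>) ^ m"
      if k: "continuous_on (cball 1 1 - {0}) k" "k holomorphic_on ball 1 1"
        "\<And>u. norm (u - 1) \<le> 1 \<Longrightarrow> norm u * norm (k u) \<le> 40" for k \<xi>
    proof -
      let ?f = "\<lambda>u. u ^ Suc m * k u * exp (\<i> * of_real (4 * sg * \<xi>) * Ln u)"
      let ?G = "K * exp (2 * pi * \<bar>\<xi>\<bar>) / (1 + \<bar>\<xi>\<bar>) ^ m"
      have a: "\<bar>4 * sg * \<xi>\<bar> = 4 * \<bar>\<xi>\<bar>" using sg by auto
      have ib: "continuous_on (cball 1 1) ?f" "?f holomorphic_on ball 1 1"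
        by (rule interpolant_bounds[where D=40]; use k m in auto)+
      have "norm (?f 1 - (\<Sum>p\<in>p ` S. c p * ?f (1 + of_real p))) \<le> ?G * (\<Prod>p\<in>p ` S. \<bar>p\<bar>)"
      proof (rule c[OF ib(1,2)])
        show "norm (?f u) \<le> ?G" if "norm (u - 1) = 1" for u
          using interpolant_bounds(3)[OF k(1,2) _ m that, of 40 "4 * sg * \<xi>"] k(3)
          by (simp add: K_def a mult.assoc[of 2 pi])
      qed
      moreover have "?f 1 = k 1" by simp
      moreover have "(\<Sum>p\<in>p ` S. c p * ?f (1 + of_real p)) =
          (\<Sum>\<mu>\<in>S. d \<mu> * k (of_real (w \<mu>)) * cis (- 2 * pi * (\<mu> * \<xi>)))"
        unfolding sum.reindex[OF inj] comp_def wp ew d_def by (simp only: mult.assoc)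
      ultimately show ?thesis unfolding prod by (simp add: mult_ac)
    qed
    have est1: "norm (1 - (\<Sum>\<mu>\<in>S. d \<mu> * cis (- 2 * pi * (\<mu> * \<xi>))))
          \<le> K * (\<Prod>\<mu>\<in>S. 1 - exp (- (pi / 2) * \<bar>\<mu>\<bar>)) * exp (2 * pi * \<bar>\<xi>\<bar>) / (1 + \<bar>\<xi>\<bar>) ^ m" for \<xi>
    proof -
      have "norm u * norm (1 :: complex) \<le> 40" if "norm (u - 1) \<le> 1" for u :: complex
        using norm_triangle_ineq[of "u - 1" 1] that by simp
      with est[of "\<lambda>_. 1"] show ?thesis by simp
    qed
    have est2: "norm (\<Sum>\<mu>\<in>S. d \<mu> * (\<i> * of_real (- 2 * pi * \<mu>)) * cis (- 2 * pi * (\<mu> * \<xi>)))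
          \<le> K * (\<Prod>\<mu>\<in>S. 1 - exp (- (pi / 2) * \<bar>\<mu>\<bar>)) * exp (2 * pi * \<bar>\<xi>\<bar>) / (1 + \<bar>\<xi>\<bar>) ^ m" for \<xi>
    proof -
      let ?k = "\<lambda>u. \<i> * of_real (4 * sg) * Ln u"
      have nonpos: "u \<notin> \<real>\<^sub>\<le>\<^sub>0" if "norm (u - 1) \<le> 1" "u \<noteq> 0" for u :: complex
      proof -
        have "0 < (norm u)\<^sup>2" using that by simp
        then have "0 < Re u" using cball_1_1_Re[OF that(1)] by linarith
        then show ?thesis by (auto simp: complex_nonpos_Reals_iff)
      qed
      have "norm (?k 1 - (\<Sum>\<mu>\<in>S. d \<mu> * ?k (of_real (w \<mu>)) * cis (- 2 * pi * (\<mu> * \<xi>))))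
          \<le> K * (\<Prod>\<mu>\<in>S. 1 - exp (- (pi / 2) * \<bar>\<mu>\<bar>)) * exp (2 * pi * \<bar>\<xi>\<bar>) / (1 + \<bar>\<xi>\<bar>) ^ m"
      proof (rule est)
        show "continuous_on (cball 1 1 - {0}) ?k"
          using nonpos by (intro continuous_intros) (auto simp: dist_norm norm_minus_commute)
        show "?k holomorphic_on ball 1 1"
        proof (intro holomorphic_intros)
          show "(ball 1 1 :: complex set) \<inter> \<real>\<^sub>\<le>\<^sub>0 = {}"
          proof (rule equals0I)
            fix x :: complex assume "x \<in> ball 1 1 \<inter> \<real>\<^sub>\<le>\<^sub>0"
      then have x: "x \<in> ball 1 1" "x \<in> \<real>\<^sub>\<le>\<^sub>0" by auto
            have "norm (x - 1) \<le> 1" using x(1) by (simp add: dist_norm norm_minus_commute)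
            moreover have "x \<noteq> 0" using x(1) by auto
            ultimately show False using nonpos x(2) by blast
          qed
        qed
        show "norm u * norm (?k u) \<le> 40" if "norm (u - 1) \<le> 1" for u
        proof -
          have "norm u * norm (?k u) = 4 * (norm u * norm (Ln u))" using sg by (auto simp: norm_mult)
          then show ?thesis using norm_mult_Ln_bound[OF that] by linarith
        qed
      qed
      moreover have "?k (of_real (w \<mu>)) = \<i> * of_real (- 2 * pi * \<mu>)" for \<mu>
      proof -
        have "?k (of_real (w \<mu>)) = \<i> * of_real ((4 * sg) * (- (pi / 2) * (sg * \<mu>)))"
          unfolding Lnw of_real_mult by (simp only: mult.assoc)
        also have "(4 * sg) * (- (pi / 2) * (sg * \<mu>)) = (sg * sg) * (- 2 * pi * \<mu>)" by simp
        finally show ?thesis by (simp only: sg2 mult_1)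
      qed
      ultimately show ?thesis by (simp only: Ln_1 mult_zero_right diff_0 norm_minus_cancel)
    qed
    show ?thesis using est1 est2 by blast
  qed
  ultimately show ?thesis by (rule that)
qed

section \<open>Approximating the window by its translates\<close>

context exp_decay_window
begin

text \<open>The difference has transform \<Phi> times the exponential sum \<rho>, whose growth exp
  (2 pi |\<xi>|) cancels the decay of \<Phi>. By the product rule the derivative obeys the same
  bound, and \<open>fourier_transform_decay\<close> converts the two bounds into one for the L1
  norm.\<close>

lemma window_approximation:
  obtains K where "K > 0"
    "\<And>S sg. \<lbrakk>finite S; sg = 1 \<or> sg = -1; \<And>\<mu>. \<mu> \<in> S \<Longrightarrow> sg * \<mu> > 0\<rbrakk> \<Longrightarrow>
      \<exists>d. (\<integral>t. norm (\<phi> t - (\<Sum>\<mu>\<in>S. d \<mu> * \<phi> (t - \<mu>))) \<partial>lborel) \<le>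
        K * (\<Prod>\<mu>\<in>S. 1 - exp (- (pi / 2) * \<bar>\<mu>\<bar>))"
proof -
  \<comment> \<open>Of these powers 2n cancel the polynomial growth allowed for \<Phi> and \<Phi>';
    the remaining two leave the factor 1 / (1 + |\<xi>|)^2 that
    \<open>fourier_transform_decay\<close> asks for.\<close>
  define m where "m = 2 * n + 2"
  have "m > 0" by (simp add: m_def)
  then obtain K0 where K0: "K0 > 0"
    "\<And>S sg. \<lbrakk>finite S; sg = 1 \<or> sg = -1; \<And>\<mu>. \<mu> \<in> S \<Longrightarrow> sg * \<mu> > 0\<rbrakk> \<Longrightarrow>
      \<exists>d :: real \<Rightarrow> complex. \<forall>\<xi>.
        norm (1 - (\<Sum>\<mu>\<in>S. d \<mu> * cis (- 2 * pi * (\<mu> * \<xi>))))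
          \<le> K0 * (\<Prod>\<mu>\<in>S. 1 - exp (- (pi / 2) * \<bar>\<mu>\<bar>)) * exp (2 * pi * \<bar>\<xi>\<bar>) / (1 + \<bar>\<xi>\<bar>) ^ m \<and>
        norm (\<Sum>\<mu>\<in>S. d \<mu> * (\<i> * of_real (- 2 * pi * \<mu>)) * cis (- 2 * pi * (\<mu> * \<xi>)))
          \<le> K0 * (\<Prod>\<mu>\<in>S. 1 - exp (- (pi / 2) * \<bar>\<mu>\<bar>)) * exp (2 * pi * \<bar>\<xi>\<bar>) / (1 + \<bar>\<xi>\<bar>) ^ m"
    by (rule exponential_interpolation) blast
  define K where "K = 6 * pi * (2 * (B + C) * K0)"
  have "K > 0" using pos K0(1) by (simp add: K_def)
  moreover have "\<exists>d. (\<integral>t. norm (\<phi> t - (\<Sum>\<mu>\<in>S. d \<mu> * \<phi> (t - \<mu>))) \<partial>lborel) \<le>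
        K * (\<Prod>\<mu>\<in>S. 1 - exp (- (pi / 2) * \<bar>\<mu>\<bar>))"
    if S: "finite S" "sg = 1 \<or> sg = -1" "\<And>\<mu>. \<mu> \<in> S \<Longrightarrow> sg * \<mu> > 0" for S sg
  proof -
    define \<omega> where "\<omega> = (\<Prod>\<mu>\<in>S. 1 - exp (- (pi / 2) * \<bar>\<mu>\<bar>))"
    have nz: "\<mu> \<noteq> 0" if "\<mu> \<in> S" for \<mu> using S(3)[OF that] by auto
    have \<omega>: "\<omega> > 0" unfolding \<omega>_def using nz by (intro prod_pos) auto
    obtain d :: "real \<Rightarrow> complex" where
      d1: "\<And>\<xi>. norm (1 - (\<Sum>\<mu>\<in>S. d \<mu> * cis (- 2 * pi * (\<mu> * \<xi>))))
          \<le> K0 * \<omega> * exp (2 * pi * \<bar>\<xi>\<bar>) / (1 + \<bar>\<xi>\<bar>) ^ m" and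
      d2: "\<And>\<xi>. norm (\<Sum>\<mu>\<in>S. d \<mu> * (\<i> * of_real (- 2 * pi * \<mu>)) * cis (- 2 * pi * (\<mu> * \<xi>)))
          \<le> K0 * \<omega> * exp (2 * pi * \<bar>\<xi>\<bar>) / (1 + \<bar>\<xi>\<bar>) ^ m"
      using K0(2)[OF S] unfolding \<omega>_def by blast
    define \<rho> where "\<rho> \<xi> = 1 - (\<Sum>\<mu>\<in>S. d \<mu> * cis (- 2 * pi * (\<mu> * \<xi>)))" for \<xi>
    define \<rho>' where "\<rho>' \<xi> = - (\<Sum>\<mu>\<in>S. d \<mu> * (\<i> * of_real (- 2 * pi * \<mu>)) * cis (- 2 * pi * (\<mu> * \<xi>)))" for \<xi>
    have d\<rho>: "(\<rho> has_vector_derivative \<rho>' \<xi>) (at \<xi>)" for \<xi>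
    proof -
      have "((\<lambda>x. d \<mu> * cis (- 2 * pi * (\<mu> * x))) has_vector_derivative
          d \<mu> * (\<i> * of_real (- 2 * pi * \<mu>)) * cis (- 2 * pi * (\<mu> * \<xi>))) (at \<xi>)" for \<mu>
      proof -
        have "((\<lambda>x. d \<mu> * exp (\<i> * of_real (- 2 * pi * \<mu>) * x)) has_field_derivative
          d \<mu> * (\<i> * of_real (- 2 * pi * \<mu>)) * exp (\<i> * of_real (- 2 * pi * \<mu>) * of_real \<xi>)) (at (of_real \<xi>))"
          by (auto intro!: derivative_eq_intros)
        from has_vector_derivative_real_field[OF this] show ?thesis
          by (simp add: cis_conv_exp o_def mult_ac)
      qed
      then have "(\<rho> has_vector_derivative 0 - (\<Sum>\<mu>\<in>S. d \<mu> * (\<i> * of_real (- 2 * pi * \<mu>)) * cis (- 2 * pi * (\<mu> * \<xi>)))) (at \<xi>)"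
        unfolding \<rho>_def[abs_def] by (intro derivative_intros)
      then show ?thesis by (simp add: \<rho>'_def)
    qed
    define W where "W \<xi> = \<Phi> \<xi> * \<rho> \<xi>" for \<xi>
    define W' where "W' \<xi> = \<Phi> \<xi> * \<rho>' \<xi> + \<Phi>' \<xi> * \<rho> \<xi>" for \<xi>
    have dW: "(W has_vector_derivative W' \<xi>) (at \<xi>)" for \<xi>
      unfolding W_def[abs_def] W'_def by (intro has_vector_derivative_mult has_vector_derivative_\<Phi> d\<rho>)
    have prodle: "norm x * norm y \<le> 2 * b * K0 * \<omega> / (1 + \<xi>\<^sup>2)"
      if x: "norm x \<le> 2 * b * (1 + \<bar>\<xi>\<bar>) ^ (2 * n) * exp (- 2 * pi * \<bar>\<xi>\<bar>)"
        and y: "norm y \<le> K0 * \<omega> * exp (2 * pi * \<bar>\<xi>\<bar>) / (1 + \<bar>\<xi>\<bar>) ^ m" and b: "b > 0"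
      for x y :: complex and b \<xi> :: real
    proof -
      let ?q = "1 + \<bar>\<xi>\<bar>"
      have q: "?q > 0" by simp
      have "norm x * norm y \<le> (2 * b * ?q ^ (2 * n) * exp (- 2 * pi * \<bar>\<xi>\<bar>)) * (K0 * \<omega> * exp (2 * pi * \<bar>\<xi>\<bar>) / ?q ^ m)"
        using b by (intro mult_mono x y) auto
      also have "\<dots> = 2 * b * K0 * \<omega> * (exp (- 2 * pi * \<bar>\<xi>\<bar>) * exp (2 * pi * \<bar>\<xi>\<bar>)) * (?q ^ (2 * n) / ?q ^ m)"
        by simp
      also have "exp (- 2 * pi * \<bar>\<xi>\<bar>) * exp (2 * pi * \<bar>\<xi>\<bar>) = 1" by (simp flip: exp_add)
      also have "?q ^ (2 * n) / ?q ^ m = 1 / ?q\<^sup>2" unfolding m_def power_add using q by simp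
      also have "2 * b * K0 * \<omega> * 1 * (1 / ?q\<^sup>2) \<le> 2 * b * K0 * \<omega> * 1 * (1 / (1 + \<xi>\<^sup>2))"
        using b K0(1) \<omega> one_plus_square_le[of \<xi>] by (intro mult_left_mono divide_left_mono) auto
      finally show ?thesis by simp
    qed
    have n\<rho>: "norm (\<rho> \<xi>) \<le> K0 * \<omega> * exp (2 * pi * \<bar>\<xi>\<bar>) / (1 + \<bar>\<xi>\<bar>) ^ m"
      "norm (\<rho>' \<xi>) \<le> K0 * \<omega> * exp (2 * pi * \<bar>\<xi>\<bar>) / (1 + \<bar>\<xi>\<bar>) ^ m" for \<xi>
      using d1 d2 by (simp_all only: \<rho>_def \<rho>'_def norm_minus_cancel)
    define M where "M = 2 * (B + C) * K0 * \<omega>"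
    have M: "M > 0" using pos K0 \<omega> by (simp add: M_def)
    have bW: "norm (W \<xi>) \<le> M / (1 + \<xi>\<^sup>2)" for \<xi>
    proof -
      have "norm (W \<xi>) \<le> 2 * B * K0 * \<omega> / (1 + \<xi>\<^sup>2)"
        unfolding W_def norm_mult by (rule prodle[OF upper' n\<rho>(1) pos(2)])
      also have "\<dots> \<le> M / (1 + \<xi>\<^sup>2)"
        unfolding M_def using pos K0 \<omega> by (intro divide_right_mono mult_right_mono) auto
      finally show ?thesis .
    qed
    have bW': "norm (W' \<xi>) \<le> M / (1 + \<xi>\<^sup>2)" for \<xi>
    proof -
      have "norm (W' \<xi>) \<le> norm (\<Phi> \<xi>) * norm (\<rho>' \<xi>) + norm (\<Phi>' \<xi>) * norm (\<rho> \<xi>)"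
        unfolding W'_def norm_mult[symmetric] by (rule norm_triangle_ineq)
      also have "\<dots> \<le> 2 * B * K0 * \<omega> / (1 + \<xi>\<^sup>2) + 2 * C * K0 * \<omega> / (1 + \<xi>\<^sup>2)"
        by (rule add_mono[OF prodle[OF upper' n\<rho>(2) pos(2)] prodle[OF deriv_bound' n\<rho>(1) pos(3)]])
      also have "\<dots> = M / (1 + \<xi>\<^sup>2)" by (simp add: M_def algebra_simps add_divide_distrib)
      finally show ?thesis .
    qed
    note FW = fourier_transform_decay[OF M dW bW bW']
    have FWeq: "fourier_transform W (- t) = fourier_transform \<Phi> (- t) -
        (\<Sum>\<mu>\<in>S. d \<mu> * fourier_transform \<Phi> (- (t - \<mu>)))" for t
    proof -
      have i: "integrable lborel (\<lambda>\<xi>. \<Phi> \<xi> * cis (2 * pi * (- \<mu> * \<xi>)))" for \<mu>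
        using integrable_\<Phi> by (rule integrable_times_cis) auto
      have "fourier_transform W (- t) = (\<integral>\<xi>. \<Phi> \<xi> * cis (- 2 * pi * (\<xi> * - t)) -
          (\<Sum>\<mu>\<in>S. d \<mu> * ((\<Phi> \<xi> * cis (2 * pi * (- \<mu> * \<xi>))) * cis (- 2 * pi * (\<xi> * - t)))) \<partial>lborel)"
        unfolding fourier_transform_cis[of W] W_def \<rho>_def
        by (intro Bochner_Integration.integral_cong)
           (auto simp: right_diff_distrib left_diff_distrib sum_distrib_left sum_distrib_right mult_ac)
      also have "\<dots> = fourier_transform \<Phi> (- t) -
          (\<Sum>\<mu>\<in>S. d \<mu> * fourier_transform (\<lambda>\<xi>. \<Phi> \<xi> * cis (2 * pi * (- \<mu> * \<xi>))) (- t))"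
        unfolding fourier_transform_cis[of \<Phi>] fourier_transform_cis[of "\<lambda>\<xi>. \<Phi> \<xi> * cis (2 * pi * (- \<mu> * \<xi>))" for \<mu>]
      proof -
        let ?h = "\<lambda>\<mu> \<xi>. d \<mu> * ((\<Phi> \<xi> * cis (2 * pi * (- \<mu> * \<xi>))) * cis (- 2 * pi * (\<xi> * - t)))"
        have ih: "integrable lborel (?h \<mu>)" for \<mu>
          by (intro integrable_mult_right integrable_times_cis[OF i]) simp
        have "(\<integral>\<xi>. \<Phi> \<xi> * cis (- 2 * pi * (\<xi> * - t)) - (\<Sum>\<mu>\<in>S. ?h \<mu> \<xi>) \<partial>lborel) =
            (\<integral>\<xi>. \<Phi> \<xi> * cis (- 2 * pi * (\<xi> * - t)) \<partial>lborel) - (\<integral>\<xi>. (\<Sum>\<mu>\<in>S. ?h \<mu> \<xi>) \<partial>lborel)"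
          by (intro Bochner_Integration.integral_diff Bochner_Integration.integrable_sum ih
              integrable_times_cis[OF integrable_\<Phi>]) simp
        also have "(\<integral>\<xi>. (\<Sum>\<mu>\<in>S. ?h \<mu> \<xi>) \<partial>lborel) = (\<Sum>\<mu>\<in>S. \<integral>\<xi>. ?h \<mu> \<xi> \<partial>lborel)"
          by (intro Bochner_Integration.integral_sum ih)
        finally show "(\<integral>\<xi>. \<Phi> \<xi> * cis (- 2 * pi * (\<xi> * - t)) - (\<Sum>\<mu>\<in>S. ?h \<mu> \<xi>) \<partial>lborel) =
            (\<integral>\<xi>. \<Phi> \<xi> * cis (- 2 * pi * (\<xi> * - t)) \<partial>lborel) - (\<Sum>\<mu>\<in>S. d \<mu> *
              (\<integral>\<xi>. (\<Phi> \<xi> * cis (2 * pi * (- \<mu> * \<xi>))) * cis (- 2 * pi * (\<xi> * - t)) \<partial>lborel))"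
          by (simp only: integral_mult_right_zero)
      qed
      finally show ?thesis unfolding fourier_transform_modulate by simp
    qed
    have AEt: "AE t in lborel. \<phi> (t - \<mu>) = fourier_transform \<Phi> (- (t - \<mu>))" for \<mu>
    proof -
      note [measurable] = borel_measurable_fourier_transform[OF integrable_\<Phi>]
        borel_measurable_integrable[OF integrable_window]
      have "AE t in lborel. \<phi> (- \<mu> + 1 * t) = fourier_transform \<Phi> (- (- \<mu> + 1 * t))"
        by (rule AE_borel_affine[OF _ _ window_inversion]) auto
      then show ?thesis by (simp add: algebra_simps)
    qed
    have "AE t in lborel. \<forall>\<mu>\<in>S. \<phi> (t - \<mu>) = fourier_transform \<Phi> (- (t - \<mu>))"
      using S(1) AEt by (intro AE_finite_allI) auto
    then have AE: "AE t in lborel. \<phi> t - (\<Sum>\<mu>\<in>S. d \<mu> * \<phi> (t - \<mu>)) = fourier_transform W (- t)"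
      using window_inversion
    proof eventually_elim
      case (elim t)
      have "(\<Sum>\<mu>\<in>S. d \<mu> * \<phi> (t - \<mu>)) = (\<Sum>\<mu>\<in>S. d \<mu> * fourier_transform \<Phi> (- (t - \<mu>)))"
        using elim(1) by (intro sum.cong) auto
      then show ?case unfolding FWeq by (simp only: elim(2))
    qed
    have "(\<integral>t. norm (\<phi> t - (\<Sum>\<mu>\<in>S. d \<mu> * \<phi> (t - \<mu>))) \<partial>lborel) =
        (\<integral>t. norm (fourier_transform W (0 - t)) \<partial>lborel)"
    proof (rule integral_cong_AE)
      note [measurable] = borel_measurable_integrable[OF FW(1)]
        borel_measurable_integrable[OF integrable_window]
      show "(\<lambda>t. norm (\<phi> t - (\<Sum>\<mu>\<in>S. d \<mu> * \<phi> (t - \<mu>)))) \<in> borel_measurable lborel"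
        "(\<lambda>t. norm (fourier_transform W (0 - t))) \<in> borel_measurable lborel" by measurable
      show "AE t in lborel. norm (\<phi> t - (\<Sum>\<mu>\<in>S. d \<mu> * \<phi> (t - \<mu>))) = norm (fourier_transform W (0 - t))"
        using AE by eventually_elim simp
    qed
    also have "\<dots> = (\<integral>t. norm (fourier_transform W t) \<partial>lborel)"
      by (rule integral_lborel_reflect[where f="\<lambda>t. norm (fourier_transform W t)"])
    also have "\<dots> \<le> 6 * pi * M" by (rule FW(2))
    also have "\<dots> = K * \<omega>" by (simp add: M_def K_def)
    finally show ?thesis unfolding \<omega>_def by blast
  qed
  ultimately show ?thesis by (rule that)
qed

end

section \<open>Closed spans and divergent sums\<close>

definition L1_closed_span :: "'i set \<Rightarrow> ('i \<Rightarrow> real \<Rightarrow> complex) \<Rightarrow> (real \<Rightarrow> complex) set" where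
  "L1_closed_span I g = {f. integrable lborel f \<and> (\<forall>\<epsilon>>0. \<exists>F c. finite F \<and> F \<subseteq> I \<and>
      (\<integral>t. norm (f t - (\<Sum>i\<in>F. c i * g i t)) \<partial>lborel) < \<epsilon>)}"

lemma spans_L1_iff:
  assumes g: "\<And>i. i \<in> I \<Longrightarrow> integrable lborel (g i)"
  shows "spans_L1 I g \<longleftrightarrow> (\<forall>f. integrable lborel f \<longrightarrow> f \<in> L1_closed_span I g)"
proof -
  have int: "integrable lborel (\<lambda>t. f t - (\<Sum>i\<in>F. c i * g i t))" if "integrable lborel f" "F \<subseteq> I" for f F c
    using that g by (intro Bochner_Integration.integrable_diff Bochner_Integration.integrable_sum
        integrable_mult_right) auto
  have "(\<exists>F c. finite F \<and> F \<subseteq> I \<and> integrable lborel (\<lambda>t. f t - (\<Sum>i\<in>F. c i * g i t)) \<and>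
        (\<integral>t. norm (f t - (\<Sum>i\<in>F. c i * g i t)) \<partial>lborel) < \<epsilon>) \<longleftrightarrow>
      (\<exists>F c. finite F \<and> F \<subseteq> I \<and> (\<integral>t. norm (f t - (\<Sum>i\<in>F. c i * g i t)) \<partial>lborel) < \<epsilon>)"
    if "integrable lborel f" for f \<epsilon>
    by (intro ex_cong1) (auto simp: int[OF that])
  then show ?thesis unfolding spans_L1_def L1_def L1_closed_span_def by simp
qed

lemma sum_union_coefficients:
  fixes a :: "'i \<Rightarrow> 'a :: comm_ring"
  assumes "finite F" "finite G"
  shows "(\<Sum>i\<in>F. c i * a i) + (\<Sum>i\<in>G. d i * a i) =
    (\<Sum>i\<in>F \<union> G. ((if i \<in> F then c i else 0) + (if i \<in> G then d i else 0)) * a i)"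
proof -
  have "(\<Sum>i\<in>F. c i * a i) = (\<Sum>i\<in>F \<union> G. (if i \<in> F then c i else 0) * a i)"
    using assms by (intro sum.mono_neutral_cong_left) auto
  moreover have "(\<Sum>i\<in>G. d i * a i) = (\<Sum>i\<in>F \<union> G. (if i \<in> G then d i else 0) * a i)"
    using assms by (intro sum.mono_neutral_cong_left) auto
  ultimately show ?thesis by (simp add: sum.distrib distrib_right)
qed

lemma closed_L1_subspace_closed_span:
  assumes g: "\<And>i. i \<in> I \<Longrightarrow> integrable lborel (g i)"
  shows "closed_L1_subspace (L1_closed_span I g)"
proof -
  have int: "integrable lborel (\<lambda>t. f t - (\<Sum>i\<in>F. c i * g i t))" if "integrable lborel f" "F \<subseteq> I" for f F c
    using that g by (intro Bochner_Integration.integrable_diff Bochner_Integration.integrable_sum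
        integrable_mult_right) auto
  show ?thesis
    unfolding closed_L1_subspace_def
  proof (intro conjI ballI allI impI)
    show "integrable lborel f" if "f \<in> L1_closed_span I g" for f
      using that by (simp add: L1_closed_span_def)
    show "(\<lambda>_. 0) \<in> L1_closed_span I g"
      by (auto simp: L1_closed_span_def intro!: exI[of _ "{}"])
  next
    fix f h assume fh: "f \<in> L1_closed_span I g" "h \<in> L1_closed_span I g"
    then have i: "integrable lborel f" "integrable lborel h" by (auto simp: L1_closed_span_def)
    have "\<exists>F c. finite F \<and> F \<subseteq> I \<and> (\<integral>t. norm (f t + h t - (\<Sum>i\<in>F. c i * g i t)) \<partial>lborel) < \<epsilon>"
      if "\<epsilon> > 0" for \<epsilon>
    proof -
      have e: "\<epsilon> / 2 > 0" using that by simp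
      obtain F c where F: "finite F" "F \<subseteq> I" "(\<integral>t. norm (f t - (\<Sum>i\<in>F. c i * g i t)) \<partial>lborel) < \<epsilon> / 2"
        using fh(1) e unfolding L1_closed_span_def by blast
      obtain G d where G: "finite G" "G \<subseteq> I" "(\<integral>t. norm (h t - (\<Sum>i\<in>G. d i * g i t)) \<partial>lborel) < \<epsilon> / 2"
        using fh(2) e unfolding L1_closed_span_def by blast
      let ?c = "\<lambda>i. (if i \<in> F then c i else 0) + (if i \<in> G then d i else 0)"
      have "(\<integral>t. norm (f t + h t - (\<Sum>i\<in>F \<union> G. ?c i * g i t)) \<partial>lborel) =
          (\<integral>t. norm ((f t - (\<Sum>i\<in>F. c i * g i t)) + (h t - (\<Sum>i\<in>G. d i * g i t))) \<partial>lborel)"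
        unfolding sum_union_coefficients[OF F(1) G(1), symmetric] by (simp add: algebra_simps)
      also have "\<dots> \<le> (\<integral>t. norm (f t - (\<Sum>i\<in>F. c i * g i t)) \<partial>lborel) + (\<integral>t. norm (h t - (\<Sum>i\<in>G. d i * g i t)) \<partial>lborel)"
        by (intro integral_norm_triangle int i F G)
      also have "\<dots> < \<epsilon>" using F G by simp
      finally show ?thesis using F G by (intro exI[of _ "F \<union> G"] exI[of _ ?c]) auto
    qed
    then show "(\<lambda>t. f t + h t) \<in> L1_closed_span I g" using i by (simp add: L1_closed_span_def)
  next
    fix a f assume f: "f \<in> L1_closed_span I g"
    have "\<exists>F c. finite F \<and> F \<subseteq> I \<and> (\<integral>t. norm (a * f t - (\<Sum>i\<in>F. c i * g i t)) \<partial>lborel) < \<epsilon>"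
      if "\<epsilon> > 0" for \<epsilon>
    proof -
      define b where "b = norm a + 1"
      have b: "b > 0" unfolding b_def by (simp add: add_nonneg_pos)
      then have "\<epsilon> / b > 0" using that by simp
      then obtain F c where F: "finite F" "F \<subseteq> I" "(\<integral>t. norm (f t - (\<Sum>i\<in>F. c i * g i t)) \<partial>lborel) < \<epsilon> / b"
        using f unfolding L1_closed_span_def by blast
      have "(\<integral>t. norm (a * f t - (\<Sum>i\<in>F. (a * c i) * g i t)) \<partial>lborel) =
          norm a * (\<integral>t. norm (f t - (\<Sum>i\<in>F. c i * g i t)) \<partial>lborel)"
        unfolding integral_mult_right_zero[symmetric] norm_mult[symmetric]
        by (simp add: right_diff_distrib sum_distrib_left mult_ac)
      also have "\<dots> \<le> b * (\<integral>t. norm (f t - (\<Sum>i\<in>F. c i * g i t)) \<partial>lborel)"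
        by (intro mult_right_mono) (auto simp: b_def)
      also have "\<dots> < b * (\<epsilon> / b)" using F b by (intro mult_strict_left_mono)
      finally show ?thesis using F b by (intro exI[of _ F] exI[of _ "\<lambda>i. a * c i"]) auto
    qed
    then show "(\<lambda>t. a * f t) \<in> L1_closed_span I g" using f by (simp add: L1_closed_span_def)
  next
    fix f assume f: "integrable lborel f"
      and ap: "\<forall>\<epsilon>>0. \<exists>h\<in>L1_closed_span I g. (\<integral>t. norm (f t - h t) \<partial>lborel) < \<epsilon>"
    have "\<exists>F c. finite F \<and> F \<subseteq> I \<and> (\<integral>t. norm (f t - (\<Sum>i\<in>F. c i * g i t)) \<partial>lborel) < \<epsilon>"
      if "\<epsilon> > 0" for \<epsilon>
    proof -
      have e: "\<epsilon> / 2 > 0" using that by simp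
      then obtain h where h: "h \<in> L1_closed_span I g" "(\<integral>t. norm (f t - h t) \<partial>lborel) < \<epsilon> / 2"
        using ap by blast
      then have hi: "integrable lborel h" by (simp add: L1_closed_span_def)
      obtain F c where F: "finite F" "F \<subseteq> I" "(\<integral>t. norm (h t - (\<Sum>i\<in>F. c i * g i t)) \<partial>lborel) < \<epsilon> / 2"
        using h(1) e unfolding L1_closed_span_def by blast
      have "(\<integral>t. norm (f t - (\<Sum>i\<in>F. c i * g i t)) \<partial>lborel) =
          (\<integral>t. norm ((f t - h t) + (h t - (\<Sum>i\<in>F. c i * g i t))) \<partial>lborel)" by simp
      also have "\<dots> \<le> (\<integral>t. norm (f t - h t) \<partial>lborel) + (\<integral>t. norm (h t - (\<Sum>i\<in>F. c i * g i t)) \<partial>lborel)"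
        using f hi F by (intro integral_norm_triangle int) auto
      also have "\<dots> < \<epsilon>" using h F by simp
      finally show ?thesis using F by blast
    qed
    then show "f \<in> L1_closed_span I g" using f by (simp add: L1_closed_span_def)
  qed
qed

section \<open>Divergence of the exponential sum through finite subsets\<close>

lemma infsum_ennreal_eq_top_iff:
  fixes f :: "'a \<Rightarrow> real"
  assumes f: "\<And>x. f x \<ge> 0"
  shows "(\<Sum>\<^sub>\<infinity>x\<in>A. ennreal (f x)) = \<infinity> \<longleftrightarrow> (\<forall>R. \<exists>F. finite F \<and> F \<subseteq> A \<and> R < sum f F)"
proof -
  have eq: "(\<Sum>\<^sub>\<infinity>x\<in>A. ennreal (f x)) = (SUP F\<in>{F. finite F \<and> F \<subseteq> A}. ennreal (sum f F))"
    using f by (subst nonneg_infsum_complete) (auto intro!: SUP_cong simp: sum_ennreal)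
  show ?thesis
  proof
    assume "(\<Sum>\<^sub>\<infinity>x\<in>A. ennreal (f x)) = \<infinity>"
    then have top: "(SUP F\<in>{F. finite F \<and> F \<subseteq> A}. ennreal (sum f F)) = top" using eq by simp
    show "\<forall>R. \<exists>F. finite F \<and> F \<subseteq> A \<and> R < sum f F"
    proof
      fix R :: real
      have "ennreal \<bar>R\<bar> < (SUP F\<in>{F. finite F \<and> F \<subseteq> A}. ennreal (sum f F))"
        unfolding top by (simp add: ennreal_less_top)
      then obtain F where "finite F" "F \<subseteq> A" "ennreal \<bar>R\<bar> < ennreal (sum f F)"
        by (auto simp: less_SUP_iff)
      then show "\<exists>F. finite F \<and> F \<subseteq> A \<and> R < sum f F"
        by (intro exI[of _ F]) (auto simp: ennreal_less_iff)
    qed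
  next
    assume *: "\<forall>R. \<exists>F. finite F \<and> F \<subseteq> A \<and> R < sum f F"
    have "(SUP F\<in>{F. finite F \<and> F \<subseteq> A}. ennreal (sum f F)) = top"
    proof (rule ennreal_SUP_eq_top)
      fix m :: nat
      obtain F where "finite F" "F \<subseteq> A" "real m < sum f F" using * by blast
      then show "\<exists>i\<in>{F. finite F \<and> F \<subseteq> A}. of_nat m \<le> ennreal (sum f i)"
        by (intro bexI[of _ F]) (auto simp: ennreal_of_nat_eq_real_of_nat intro!: ennreal_leI)
    qed
    then show "(\<Sum>\<^sub>\<infinity>x\<in>A. ennreal (f x)) = \<infinity>" using eq by simp
  qed
qed

text \<open>The exponential that maps into the tangent disc is chosen by the sign of the points, so
  the sum has to diverge over one half-line. The point 0 belongs to neither and costs at most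
  \<open>f 0\<close>.\<close>

lemma divergence_one_sided:
  fixes \<Lambda> :: "real set" and f :: "real \<Rightarrow> real"
  assumes f: "\<And>x. 0 \<le> f x" "f 0 \<le> 1"
    and div: "\<And>R. \<exists>F. finite F \<and> F \<subseteq> \<Lambda> \<and> R < sum f F"
  obtains sg :: real where "sg = 1 \<or> sg = -1"
    "\<And>R. \<exists>F. finite F \<and> F \<subseteq> {l\<in>\<Lambda>. sg * l > 0} \<and> R < sum f F"
proof (rule ccontr)
  assume "\<not> thesis"
  then have "\<not> (\<forall>R. \<exists>F. finite F \<and> F \<subseteq> {l\<in>\<Lambda>. 1 * l > 0} \<and> R < sum f F)"
    "\<not> (\<forall>R. \<exists>F. finite F \<and> F \<subseteq> {l\<in>\<Lambda>. -1 * l > 0} \<and> R < sum f F)"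
    using that by blast+
  then obtain R1 R2 where
    R1: "\<And>F. finite F \<Longrightarrow> F \<subseteq> {l\<in>\<Lambda>. 1 * l > 0} \<Longrightarrow> sum f F \<le> R1" and
    R2: "\<And>F. finite F \<Longrightarrow> F \<subseteq> {l\<in>\<Lambda>. -1 * l > 0} \<Longrightarrow> sum f F \<le> R2"
    unfolding not_all not_ex by (meson not_le)
  obtain F where F: "finite F" "F \<subseteq> \<Lambda>" "R1 + R2 + 1 < sum f F" using div by blast
  have "F \<subseteq> {l\<in>F. l > 0} \<union> ({l\<in>F. l < 0} \<union> {0})" by auto
  then have "sum f F \<le> sum f ({l\<in>F. l > 0} \<union> ({l\<in>F. l < 0} \<union> {0}))"
    using F f by (intro sum_mono2) auto
  also have "\<dots> = sum f {l\<in>F. l > 0} + (sum f {l\<in>F. l < 0} + f 0)"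
    using F by (subst sum.union_disjoint; (subst sum.union_disjoint)?; auto)
  also have "\<dots> \<le> R1 + (R2 + 1)"
    using F f by (intro add_mono R1 R2) auto
  finally show False using F by simp
qed

text \<open>To approximate the translate by x, the points are recentred at x. This changes each term
  by a factor of at most exp (c |x|), and the only points that change sides lie in a bounded
  interval; by discreteness they are finitely many.\<close>

lemma divergence_shift:
  fixes \<Lambda> :: "real set" and c x sg :: real
  assumes disc: "discrete_set \<Lambda>" and c: "c \<ge> 0" and sg: "sg = 1 \<or> sg = -1"
    and div: "\<And>R. \<exists>F. finite F \<and> F \<subseteq> {l\<in>\<Lambda>. sg * l > 0} \<and> R < (\<Sum>l\<in>F. exp (- c * \<bar>l\<bar>))"
  shows "\<exists>F. finite F \<and> F \<subseteq> {l\<in>\<Lambda>. sg * (l - x) > 0} \<and> R < (\<Sum>l\<in>F. exp (- c * \<bar>l - x\<bar>))"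
proof -
  define T where "T = \<Lambda> \<inter> {-\<bar>x\<bar>..\<bar>x\<bar>}"
  have T: "finite T" using disc by (simp add: T_def discrete_set_def)
  \<comment> \<open>Each lost term is at most 1, so together they cost at most
    \<open>card T\<close>; the factor \<open>exp (c * \<bar>x\<bar>)\<close> pays for |l - x| \<le>
    |l| + |x|.\<close>
  define R' where "R' = R * exp (c * \<bar>x\<bar>) + card T"
  obtain F where F: "finite F" "F \<subseteq> {l\<in>\<Lambda>. sg * l > 0}" "R' < (\<Sum>l\<in>F. exp (- c * \<bar>l\<bar>))"
    using div by blast
  define F' where "F' = {l\<in>F. sg * (l - x) > 0}"
  have "F - F' \<subseteq> T" 
  proof
    fix l assume "l \<in> F - F'"
    then have l: "l \<in> \<Lambda>" "sg * l > 0" "\<not> sg * (l - x) > 0" using F by (auto simp: F'_def)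
    from sg have "\<bar>l\<bar> \<le> \<bar>x\<bar>"
    proof
      assume "sg = 1"
      then have "l > 0" "l \<le> x" using l by simp_all
      then show ?thesis by linarith
    next
      assume "sg = -1"
      then have "l < 0" "x \<le> l" using l by simp_all
      then show ?thesis by linarith
    qed
    then show "l \<in> T" using l by (simp add: T_def abs_le_iff)
  qed
  then have "(\<Sum>l\<in>F - F'. exp (- c * \<bar>l\<bar>)) \<le> (\<Sum>l\<in>T. exp (- c * \<bar>l\<bar>))"
    using T by (intro sum_mono2) auto
  also have "\<dots> \<le> (\<Sum>l\<in>T. 1)" using c by (intro sum_mono) auto
  finally have "(\<Sum>l\<in>F - F'. exp (- c * \<bar>l\<bar>)) \<le> card T" by simp
  moreover have "(\<Sum>l\<in>F. exp (- c * \<bar>l\<bar>)) = (\<Sum>l\<in>F - F'. exp (- c * \<bar>l\<bar>)) + (\<Sum>l\<in>F'. exp (- c * \<bar>l\<bar>))"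
    using F by (intro sum.subset_diff) (auto simp: F'_def)
  ultimately have "R * exp (c * \<bar>x\<bar>) < (\<Sum>l\<in>F'. exp (- c * \<bar>l\<bar>))" using F by (simp add: R'_def)
  also have "\<dots> \<le> (\<Sum>l\<in>F'. exp (c * \<bar>x\<bar>) * exp (- c * \<bar>l - x\<bar>))"
  proof (rule sum_mono)
    fix l
    have "c * \<bar>l - x\<bar> \<le> c * (\<bar>l\<bar> + \<bar>x\<bar>)" using c by (intro mult_left_mono) auto
    then show "exp (- c * \<bar>l\<bar>) \<le> exp (c * \<bar>x\<bar>) * exp (- c * \<bar>l - x\<bar>)"
      by (simp add: exp_add[symmetric] algebra_simps)
  qed
  finally have "R < (\<Sum>l\<in>F'. exp (- c * \<bar>l - x\<bar>))" by (simp flip: sum_distrib_left)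
  then show ?thesis using F by (intro exI[of _ F']) (auto simp: F'_def)
qed

context exp_decay_window
begin

lemma spans_if_divergent:
  assumes disc: "discrete_set \<Lambda>"
    and div: "\<And>R. \<exists>F. finite F \<and> F \<subseteq> \<Lambda> \<and> R < (\<Sum>l\<in>F. exp (- (pi / 2) * \<bar>l\<bar>))"
  shows "spans_L1 \<Lambda> (\<lambda>l t. \<phi> (t - l))"
proof -
  have int: "integrable lborel (\<lambda>t. \<phi> (t - x))" for x
    by (rule integrable_lborel_translate[OF integrable_window])
  let ?V = "L1_closed_span \<Lambda> (\<lambda>l t. \<phi> (t - l))"
  obtain sg :: real where sg: "sg = 1 \<or> sg = -1" and
    div': "\<And>R. \<exists>F. finite F \<and> F \<subseteq> {l\<in>\<Lambda>. sg * l > 0} \<and> R < (\<Sum>l\<in>F. exp (- (pi / 2) * \<bar>l\<bar>))"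
    using divergence_one_sided[OF _ _ div] by auto
  obtain K where K: "K > 0"
    "\<And>S sg. \<lbrakk>finite S; sg = 1 \<or> sg = -1; \<And>\<mu>. \<mu> \<in> S \<Longrightarrow> sg * \<mu> > 0\<rbrakk> \<Longrightarrow>
      \<exists>d. (\<integral>t. norm (\<phi> t - (\<Sum>\<mu>\<in>S. d \<mu> * \<phi> (t - \<mu>))) \<partial>lborel) \<le>
        K * (\<Prod>\<mu>\<in>S. 1 - exp (- (pi / 2) * \<bar>\<mu>\<bar>))"
    by (rule window_approximation) blast
  have tr: "(\<lambda>t. \<phi> (t - x)) \<in> ?V" for x
    unfolding L1_closed_span_def mem_Collect_eq
  proof (intro conjI int allI impI)
    fix \<epsilon> :: real assume \<epsilon>: "\<epsilon> > 0"
    \<comment> \<open>Since 1 - y \<le> exp (- y), the product over \<open>S\<close> is at most exp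
      of minus the sum, hence less than exp (- R); and K exp (- R) = \<epsilon>.\<close>
    define R where "R = ln (K / \<epsilon>)"
    obtain F where F: "finite F" "F \<subseteq> {l\<in>\<Lambda>. sg * (l - x) > 0}" "R < (\<Sum>l\<in>F. exp (- (pi / 2) * \<bar>l - x\<bar>))"
      using divergence_shift[OF disc _ sg div', of x R] by auto
    define S where "S = (\<lambda>l. l - x) ` F"
    have inj: "inj_on (\<lambda>l. l - x) F" by (auto simp: inj_on_def)
    have "finite S" "\<And>\<mu>. \<mu> \<in> S \<Longrightarrow> sg * \<mu> > 0" using F by (auto simp: S_def)
    from K(2)[OF this(1) sg this(2)] obtain d where
      d: "(\<integral>t. norm (\<phi> t - (\<Sum>\<mu>\<in>S. d \<mu> * \<phi> (t - \<mu>))) \<partial>lborel) \<le>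
        K * (\<Prod>\<mu>\<in>S. 1 - exp (- (pi / 2) * \<bar>\<mu>\<bar>))" by blast
    have "(\<integral>t. norm (\<phi> (t - x) - (\<Sum>l\<in>F. d (l - x) * \<phi> (t - l))) \<partial>lborel) =
        (\<integral>t. norm (\<phi> (t - x) - (\<Sum>\<mu>\<in>S. d \<mu> * \<phi> (t - x - \<mu>))) \<partial>lborel)"
      by (simp add: S_def sum.reindex[OF inj])
    also have "\<dots> = (\<integral>t. norm (\<phi> t - (\<Sum>\<mu>\<in>S. d \<mu> * \<phi> (t - \<mu>))) \<partial>lborel)"
      by (rule integral_lborel_translate[where f="\<lambda>t. norm (\<phi> t - (\<Sum>\<mu>\<in>S. d \<mu> * \<phi> (t - \<mu>)))"])
    also note d
    also have "(\<Prod>\<mu>\<in>S. 1 - exp (- (pi / 2) * \<bar>\<mu>\<bar>)) \<le> (\<Prod>\<mu>\<in>S. exp (- exp (- (pi / 2) * \<bar>\<mu>\<bar>)))"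
      using exp_ge_add_one_self[of "- exp (- (pi / 2) * \<bar>\<mu>\<bar>)" for \<mu>] by (intro prod_mono) auto
    also have "\<dots> = exp (- (\<Sum>l\<in>F. exp (- (pi / 2) * \<bar>l - x\<bar>)))"
      using F by (simp add: S_def prod.reindex[OF inj] exp_sum sum_negf[symmetric])
    also have "K * \<dots> < K * exp (- R)"
      using F(3) K(1) by (intro mult_strict_left_mono) auto
    also have "\<dots> = \<epsilon>" using K(1) \<epsilon> by (simp add: R_def exp_minus)
    finally show "\<exists>F c. finite F \<and> F \<subseteq> \<Lambda> \<and> (\<integral>t. norm (\<phi> (t - x) - (\<Sum>i\<in>F. c i * \<phi> (t - i))) \<partial>lborel) < \<epsilon>"
      using F K(1) by (intro exI[of _ F] exI[of _ "\<lambda>l. d (l - x)"]) (auto intro: mult_left_mono)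
  qed
  have "closed_L1_subspace ?V" by (rule closed_L1_subspace_closed_span) (rule int)
  then have "f \<in> ?V" if "integrable lborel f" for f
    using tr that by (rule translates_dense)
  then show ?thesis using int by (subst spans_L1_iff) auto
qed

end

section \<open>Fourier transforms of functions holomorphic in a strip\<close>

lemma FTC_real_line:
  fixes F f :: "real \<Rightarrow> complex"
  assumes d: "\<And>x. (F has_vector_derivative f x) (at x)" and cont: "continuous_on UNIV f"
    and b: "\<And>x. norm (f x) \<le> M / (1 + x\<^sup>2)"
  shows "(\<lambda>n. F (real n) - F (- real n)) \<longlonglongrightarrow> (\<integral>x. f x \<partial>lborel)"
proof -
  have [measurable]: "f \<in> borel_measurable borel" using cont by (rule borel_measurable_continuous_onI)
  have eq: "(\<integral>x. indicator {- real n..real n} x *\<^sub>R f x \<partial>lborel) = F (real n) - F (- real n)" for n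
    by (rule integral_FTC_Icc)
       (auto intro: has_vector_derivative_at_within[OF d] continuous_on_subset[OF cont])
  have "(\<lambda>n. \<integral>x. indicator {- real n..real n} x *\<^sub>R f x \<partial>lborel) \<longlonglongrightarrow> (\<integral>x. f x \<partial>lborel)"
  proof (rule integral_dominated_convergence[where w="\<lambda>x. M * (1 / (1 + x\<^sup>2))"])
    show "integrable lborel (\<lambda>x. M * (1 / (1 + x\<^sup>2)))"
      using has_bochner_integral_inverse_1_plus_square
      by (intro integrable_mult_right) (auto simp: has_bochner_integral_iff)
    show "AE x in lborel. (\<lambda>n. indicator {- real n..real n} x *\<^sub>R f x) \<longlonglongrightarrow> f x"
    proof (intro AE_I2 tendsto_eventually)
      fix x :: real
      obtain m where "\<bar>x\<bar> \<le> real m" using real_arch_simple by blast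
      then show "\<forall>\<^sub>F n in sequentially. indicator {- real n..real n} x *\<^sub>R f x = f x"
        by (auto simp: eventually_sequentially indicator_def intro!: exI[of _ m])
    qed
    have "norm (indicator {- real n..real n} x *\<^sub>R f x) \<le> M * (1 / (1 + x\<^sup>2))" for n x
    proof -
      have "norm (indicator {- real n..real n} x *\<^sub>R f x) \<le> norm (f x)"
        by (simp add: indicator_def)
      then show ?thesis using b[of x] by simp
    qed
    then show "AE x in lborel. norm (indicator {- real n..real n} x *\<^sub>R f x) \<le> M * (1 / (1 + x\<^sup>2))" for n
      by simp
  qed measurable
  then show ?thesis by (simp only: eq)
qed

lemma decay_tendsto_0:
  "(\<lambda>n. M / (1 + (real n)\<^sup>2)) \<longlonglongrightarrow> 0"
proof -
  have "filterlim (\<lambda>n. 1 + (real n)\<^sup>2) at_infinity sequentially"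
  proof (rule filterlim_at_top_imp_at_infinity, rule filterlim_at_top_mono[OF filterlim_real_sequentially], rule always_eventually, rule allI)
    fix n :: nat
    have "0 \<le> (real n - 1)\<^sup>2" by simp
    then show "real n \<le> 1 + (real n)\<^sup>2" by (simp add: power2_eq_square algebra_simps)
  qed
  then show ?thesis by (rule tendsto_divide_0[OF tendsto_const])
qed

lemma integral_derivative_eq_0:
  fixes F f :: "real \<Rightarrow> complex"
  assumes d: "\<And>x. (F has_vector_derivative f x) (at x)" and cont: "continuous_on UNIV f"
    and b: "\<And>x. norm (f x) \<le> M / (1 + x\<^sup>2)" and b': "\<And>x. norm (F x) \<le> M / (1 + x\<^sup>2)"
  shows "(\<integral>x. f x \<partial>lborel) = 0"
proof (rule LIMSEQ_unique[OF FTC_real_line[OF d cont b]])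
  have 1: "(\<lambda>n. F (real n)) \<longlonglongrightarrow> 0"
    by (rule Lim_null_comparison[OF always_eventually decay_tendsto_0[of M]]) (use b' in blast)
  have 2: "(\<lambda>n. F (- real n)) \<longlonglongrightarrow> 0"
    by (rule Lim_null_comparison[OF always_eventually decay_tendsto_0[of M]])
       (use b'[of "- real n" for n] in simp)
  show "(\<lambda>n. F (real n) - F (- real n)) \<longlonglongrightarrow> 0" using tendsto_diff[OF 1 2] by simp
qed

section \<open>Contour shifts in the strip\<close>

definition strip :: "complex set" where
  "strip = {z. \<bar>Im z\<bar> < 1}"

lemma strip_eq: "strip = {z. Im z < 1} \<inter> {z. Im z > -1}"
  by (auto simp: strip_def)

lemma open_strip: "open strip"
  unfolding strip_eq by (intro open_Int open_halfspace_Im_lt open_halfspace_Im_gt)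

lemma convex_strip: "convex strip"
  unfolding strip_eq by (intro convex_Int convex_halfspace_Im_lt convex_halfspace_Im_gt)

lemma Complex_eq_add: "Complex x y = of_real x + \<i> * of_real y"
  by (simp add: complex_eq_iff)

text \<open>A primitive \<open>P\<close> exists on the convex strip. Both integrals are limits of
  differences of \<open>P\<close> along horizontal lines, and the vertical differences at real part
  r are at most M / (1 + r^2), so they vanish in the limit.\<close>

lemma contour_shift:
  assumes H: "H holomorphic_on strip" and b: "\<And>z. z \<in> strip \<Longrightarrow> norm (H z) \<le> M / (1 + (Re z)\<^sup>2)"
    and y: "\<bar>y\<bar> < 1"
  shows "(\<integral>x. H (Complex x y) \<partial>lborel) = (\<integral>x. H (of_real x) \<partial>lborel)"
proof -
  obtain P where P: "\<And>z. z \<in> strip \<Longrightarrow> (P has_field_derivative H z) (at z within strip)"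
    using holomorphic_convex_primitive'[OF convex_strip open_strip H] by blast
  have lim: "(\<lambda>n. P (Complex (real n) v) - P (Complex (- real n) v)) \<longlonglongrightarrow> (\<integral>x. H (Complex x v) \<partial>lborel)"
    if v: "\<bar>v\<bar> < 1" for v
  proof (rule FTC_real_line)
    have s: "Complex x v \<in> strip" for x using v by (simp add: strip_def)
    show "((\<lambda>x. P (Complex x v)) has_vector_derivative H (Complex x v)) (at x)" for x
    proof -
      have "((\<lambda>x. Complex x v) has_vector_derivative 1) (at x)"
        unfolding Complex_eq_add by (auto intro!: derivative_eq_intros)
      moreover have "(P has_field_derivative H (Complex x v)) (at (Complex x v))"
        using P[OF s[of x]] unfolding at_within_open[OF s open_strip] .
      ultimately show ?thesis
        using field_vector_diff_chain_at[of "\<lambda>x. Complex x v" 1 x P "H (Complex x v)"] by (simp add: o_def)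
    qed
    show "continuous_on UNIV (\<lambda>x. H (Complex x v))"
    proof (rule continuous_on_compose2[OF holomorphic_on_imp_continuous_on[OF H]])
      show "continuous_on UNIV (\<lambda>x. Complex x v)" unfolding Complex_eq_add by (intro continuous_intros)
    qed (use s in auto)
    show "norm (H (Complex x v)) \<le> M / (1 + x\<^sup>2)" for x using b[OF s[of x]] by simp
  qed
  have vert: "norm (P (Complex r y) - P (Complex r 0)) \<le> M / (1 + r\<^sup>2)" for r
  proof -
    let ?S = "{z. Re z = r} \<inter> strip"
    have M0: "0 \<le> M / (1 + r\<^sup>2)" using b[of "Complex r 0"] by (simp add: strip_def order_trans[OF norm_ge_zero])
    have "norm (P (Complex r y) - P (Complex r 0)) \<le> M / (1 + r\<^sup>2) * norm (Complex r y - Complex r 0)"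
    proof (rule field_differentiable_bound)
      have "{z. Re z = r} = {z. Re z \<le> r} \<inter> {z. Re z \<ge> r}" by auto
      then show "convex ?S"
        by (simp only:) (intro convex_Int convex_strip convex_halfspace_Re_le convex_halfspace_Re_ge)
      show "(P has_field_derivative H z) (at z within ?S)" if "z \<in> ?S" for z
        using P[of z] that by (auto intro: DERIV_subset)
      show "norm (H z) \<le> M / (1 + r\<^sup>2)" if "z \<in> ?S" for z using b[of z] that by auto
    qed (use y in \<open>auto simp: strip_def\<close>)
    also have "\<dots> \<le> M / (1 + r\<^sup>2) * 1"
      using y M0 by (intro mult_left_mono) (auto simp: cmod_def)
    finally show ?thesis by simp
  qed
  have 1: "(\<lambda>n. P (Complex (real n) y) - P (Complex (real n) 0)) \<longlonglongrightarrow> 0"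
    by (rule Lim_null_comparison[OF always_eventually decay_tendsto_0[of M]]) (use vert in blast)
  have 2: "(\<lambda>n. P (Complex (- real n) y) - P (Complex (- real n) 0)) \<longlonglongrightarrow> 0"
    by (rule Lim_null_comparison[OF always_eventually decay_tendsto_0[of M]])
       (use vert[of "- real n" for n] in simp)
  have "(\<lambda>n. (P (Complex (real n) y) - P (Complex (- real n) y)) -
      (P (Complex (real n) 0) - P (Complex (- real n) 0))) \<longlonglongrightarrow> 0"
    using tendsto_diff[OF 1 2] by (simp add: algebra_simps)
  moreover have "(\<lambda>n. (P (Complex (real n) y) - P (Complex (- real n) y)) -
      (P (Complex (real n) 0) - P (Complex (- real n) 0))) \<longlonglongrightarrow>
      (\<integral>x. H (Complex x y) \<partial>lborel) - (\<integral>x. H (Complex x 0) \<partial>lborel)"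
    by (intro tendsto_diff lim y) simp
  ultimately have "(\<integral>x. H (Complex x y) \<partial>lborel) - (\<integral>x. H (Complex x 0) \<partial>lborel) = 0"
    by (rule LIMSEQ_unique[rotated])
  then show ?thesis by (simp add: Complex_eq_add)
qed

lemma integral_decay_le:
  assumes b: "\<And>x. norm (f x :: complex) \<le> M / (1 + x\<^sup>2)"
  shows "norm (\<integral>x. f x \<partial>lborel) \<le> M * pi"
proof (cases "integrable lborel f")
  case True
  have "norm (\<integral>x. f x \<partial>lborel) \<le> (\<integral>x. norm (f x) \<partial>lborel)" by (rule integral_norm_bound)
  also have "\<dots> \<le> (\<integral>x. M * (1 / (1 + x\<^sup>2)) \<partial>lborel)"
  proof (rule integral_mono)
    show "integrable lborel (\<lambda>x. M * (1 / (1 + x\<^sup>2)))"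
      using has_bochner_integral_inverse_1_plus_square
      by (intro integrable_mult_right) (auto simp: has_bochner_integral_iff)
  qed (use True b in auto)
  also have "\<dots> = M * pi"
    using has_bochner_integral_inverse_1_plus_square
    by (simp only: integral_mult_right_zero has_bochner_integral_iff)
  finally show ?thesis .
next
  case False
  have "0 \<le> M" using b[of 0] by (simp add: order_trans[OF norm_ge_zero])
  then show ?thesis using False by (simp add: not_integrable_integral_eq)
qed

text \<open>Integration by parts turns the j-th derivative into the factor (2 pi |\<xi>|)^j, and
  moving the line to height r < 1 gives exp (- 2 pi r |\<xi>|). As \<open>M j\<close> does not
  depend on the height, r can tend to 1, which yields the full exponential although \<open>F\<close>
  is given on the open strip only.\<close>

lemma fourier_transform_strip_decay:
  assumes F: "F holomorphic_on strip"
    and b: "\<And>j z. z \<in> strip \<Longrightarrow> norm ((deriv ^^ j) F z) \<le> M j / (1 + (Re z)\<^sup>2)"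
  shows "(2 * pi * \<bar>\<xi>\<bar>) ^ j * norm (fourier_transform (\<lambda>x. F (of_real x)) \<xi>) \<le> exp (- 2 * pi * \<bar>\<xi>\<bar>) * (M j * pi)"
proof -
  define D where "D j = (deriv ^^ j) F" for j
  have real: "complex_of_real x \<in> strip" for x by (simp add: strip_def)
  have holD: "D j holomorphic_on strip" for j
    unfolding D_def by (rule holomorphic_higher_deriv[OF F open_strip])
  have DD: "(D j has_field_derivative D (Suc j) z) (at z)" if "z \<in> strip" for j z
    using holomorphic_derivI[OF holD[of j] open_strip that] by (simp add: D_def)
  have bD: "norm (D j z) \<le> M j / (1 + (Re z)\<^sup>2)" if "z \<in> strip" for j z
    using b[OF that] by (simp add: D_def)
  have contD: "continuous_on UNIV (\<lambda>x::real. D j (of_real x))" for j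
    by (rule continuous_on_compose2[OF holomorphic_on_imp_continuous_on[OF holD]])
       (auto simp: real intro!: continuous_intros)
  define \<omega> where "\<omega> = - (2 * of_real pi * \<i> * of_real \<xi>)"
  have cis: "cis (- 2 * pi * (x * \<xi>)) = exp (\<omega> * of_real x)" for x
    by (simp add: \<omega>_def cis_conv_exp mult_ac)
  define I where "I j = (\<integral>x. D j (of_real x) * exp (\<omega> * of_real x) \<partial>lborel)" for j
  have nexp: "norm (exp (\<omega> * of_real x)) = 1" for x
    by (simp add: norm_exp_eq_Re \<omega>_def)
  have int: "integrable lborel (\<lambda>x. D j (of_real x) * exp (\<omega> * of_real x))" for j
  proof (rule integrable_decay[where M="M j"])
    show "(\<lambda>x. D j (of_real x) * exp (\<omega> * of_real x)) \<in> borel_measurable borel"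
      by (intro borel_measurable_continuous_onI continuous_intros contD)
    show "norm (D j (of_real x) * exp (\<omega> * of_real x)) \<le> M j / (1 + x\<^sup>2)" for x
      using bD[OF real[of x]] by (simp only: norm_mult nexp mult_1_right Re_complex_of_real)
  qed
  have step: "I (Suc j) = - \<omega> * I j" for j
  proof -
    have "(\<integral>x. D (Suc j) (of_real x) * exp (\<omega> * of_real x) + \<omega> * (D j (of_real x) * exp (\<omega> * of_real x)) \<partial>lborel) = 0"
    proof (rule integral_derivative_eq_0)
      let ?M = "M j + (M (Suc j) + norm \<omega> * M j)"
      have M0: "0 \<le> M j" for j using bD[OF real[of 0], of j] by (simp add: order_trans[OF norm_ge_zero])
      show "((\<lambda>x. D j (of_real x) * exp (\<omega> * of_real x)) has_vector_derivative
          (D (Suc j) (of_real x) * exp (\<omega> * of_real x) + \<omega> * (D j (of_real x) * exp (\<omega> * of_real x)))) (at x)" for x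
      proof -
        have "((\<lambda>z. D j z * exp (\<omega> * z)) has_field_derivative
            (D (Suc j) (of_real x) * exp (\<omega> * of_real x) + \<omega> * (D j (of_real x) * exp (\<omega> * of_real x)))) (at (of_real x))"
          by (rule derivative_eq_intros DD real refl | simp add: algebra_simps)+
        from has_vector_derivative_real_field[OF this] show ?thesis by (simp add: o_def)
      qed
      show "continuous_on UNIV (\<lambda>x. D (Suc j) (of_real x) * exp (\<omega> * of_real x) + \<omega> * (D j (of_real x) * exp (\<omega> * of_real x)))"
        by (intro continuous_intros contD)
      fix x :: real
      have j: "norm (D j (of_real x) * exp (\<omega> * of_real x)) \<le> M j / (1 + x\<^sup>2)" for j
        using bD[OF real[of x]] by (simp only: norm_mult nexp mult_1_right Re_complex_of_real)
      show "norm (D j (of_real x) * exp (\<omega> * of_real x)) \<le> ?M / (1 + x\<^sup>2)"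
        using M0 by (intro order_trans[OF j] divide_right_mono) auto
      have "norm (D (Suc j) (of_real x) * exp (\<omega> * of_real x) + \<omega> * (D j (of_real x) * exp (\<omega> * of_real x)))
          \<le> M (Suc j) / (1 + x\<^sup>2) + norm \<omega> * (M j / (1 + x\<^sup>2))"
        unfolding norm_mult[of \<omega>, symmetric]
        by (intro norm_triangle_le add_mono j) (simp only: norm_mult[of \<omega>] mult_left_mono[OF j] norm_ge_zero)
      also have "\<dots> = (M (Suc j) + norm \<omega> * M j) / (1 + x\<^sup>2)" by (simp add: add_divide_distrib)
      also have "\<dots> \<le> ?M / (1 + x\<^sup>2)" using M0[of j] by (intro divide_right_mono) auto
      finally show "norm (D (Suc j) (of_real x) * exp (\<omega> * of_real x) + \<omega> * (D j (of_real x) * exp (\<omega> * of_real x)))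
          \<le> ?M / (1 + x\<^sup>2)" .
    qed
    then have "I (Suc j) + \<omega> * I j = 0"
      unfolding I_def using int by (subst (asm) Bochner_Integration.integral_add) auto
    then show ?thesis by (simp add: eq_neg_iff_add_eq_0)
  qed
  have I: "I j = (- \<omega>) ^ j * I 0" for j
    by (induction j) (simp_all add: step mult_ac)
  have "I 0 = fourier_transform (\<lambda>x. F (of_real x)) \<xi>"
    by (simp only: I_def D_def fourier_transform_cis cis funpow_0)
  moreover have "norm (- \<omega>) = 2 * pi * \<bar>\<xi>\<bar>" by (simp add: \<omega>_def norm_mult)
  ultimately have norm_I: "norm (I j) = (2 * pi * \<bar>\<xi>\<bar>) ^ j * norm (fourier_transform (\<lambda>x. F (of_real x)) \<xi>)"
    using I[of j] by (simp only: norm_mult norm_power)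
  have shift: "norm (I j) \<le> exp (- 2 * pi * r * \<bar>\<xi>\<bar>) * (M j * pi)" if r: "0 \<le> r" "r < 1" for r
  proof -
    \<comment> \<open>The modulus of exp (\<omega> z) is exp (2 pi Im z \<xi>), so the line is moved
      to the side where Im z and \<xi> have opposite signs.\<close>
    define y where "y = (if \<xi> \<ge> 0 then - r else r)"
    have y: "\<bar>y\<bar> < 1" "y * \<xi> = - r * \<bar>\<xi>\<bar>" using r by (auto simp: y_def)
    let ?H = "\<lambda>z. D j z * exp (\<omega> * z)"
    have nH: "norm (?H z) = norm (D j z) * exp (2 * pi * (Im z * \<xi>))" for z
      by (simp add: norm_mult norm_exp_eq_Re \<omega>_def mult_ac)
    have "I j = (\<integral>x. ?H (Complex x y) \<partial>lborel)"
      unfolding I_def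
    proof (rule contour_shift[symmetric, OF _ _ y(1)])
      show "?H holomorphic_on strip" by (intro holomorphic_intros holD)
      show "norm (?H z) \<le> (M j * exp (2 * pi * \<bar>\<xi>\<bar>)) / (1 + (Re z)\<^sup>2)" if z: "z \<in> strip" for z
      proof -
        have "\<bar>Im z * \<xi>\<bar> \<le> 1 * \<bar>\<xi>\<bar>" unfolding abs_mult using z by (intro mult_right_mono) (auto simp: strip_def)
        then have "norm (D j z) * exp (2 * pi * (Im z * \<xi>)) \<le> M j / (1 + (Re z)\<^sup>2) * exp (2 * pi * \<bar>\<xi>\<bar>)"
          using order_trans[OF norm_ge_zero bD[OF z]] by (intro mult_mono bD z) auto
        then show ?thesis unfolding nH by simp
      qed
    qed
    also have "norm \<dots> \<le> (exp (- 2 * pi * r * \<bar>\<xi>\<bar>) * M j) * pi"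
    proof (rule integral_decay_le)
      fix x :: real
      have "norm (?H (Complex x y)) = norm (D j (Complex x y)) * exp (- 2 * pi * r * \<bar>\<xi>\<bar>)"
        unfolding nH using y(2) by (simp add: mult_ac)
      also have "\<dots> \<le> M j / (1 + x\<^sup>2) * exp (- 2 * pi * r * \<bar>\<xi>\<bar>)"
        using bD[of "Complex x y" j] y(1) by (intro mult_right_mono) (auto simp: strip_def)
      finally show "norm (?H (Complex x y)) \<le> (exp (- 2 * pi * r * \<bar>\<xi>\<bar>) * M j) / (1 + x\<^sup>2)"
        by (simp add: mult_ac)
    qed
    finally show ?thesis by (simp add: mult_ac)
  qed
  have "norm (I j) \<le> exp (- 2 * pi * 1 * \<bar>\<xi>\<bar>) * (M j * pi)"
  proof (rule tendsto_lowerbound[where F="at_left (1::real)"])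
    show "((\<lambda>r. exp (- 2 * pi * r * \<bar>\<xi>\<bar>) * (M j * pi)) \<longlongrightarrow> exp (- 2 * pi * 1 * \<bar>\<xi>\<bar>) * (M j * pi)) (at_left 1)"
      by (intro tendsto_intros)
    have "\<forall>\<^sub>F r in at_left (1::real). r \<in> {0<..<1}"
      by (rule eventually_at_leftI[of 0]) auto
    then show "\<forall>\<^sub>F r in at_left (1::real). norm (I j) \<le> exp (- 2 * pi * r * \<bar>\<xi>\<bar>) * (M j * pi)"
      by eventually_elim (rule shift, auto)
  qed simp
  then show ?thesis unfolding norm_I by simp
qed

section \<open>Blaschke products in the strip\<close>

text \<open>A neighbourhood of the closed strip \<open>\<bar>Im z\<bar> \<le> 1\<close> whose thickness at \<open>Re z = x\<close> is of order
  \<open>exp (- pi \<bar>x\<bar> / 2)\<close>; both \<open>exp (pi z / 2)\<close> and \<open>exp (- pi z / 2)\<close> map it into \<open>Re w > -1\<close>.\<close>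
definition thick_strip :: "complex set" where
  "thick_strip = {z. - 1 < exp (pi / 2 * \<bar>Re z\<bar>) * cos (pi / 2 * Im z)}"

text \<open>A negative cosine does most harm next to the larger of the two exponentials, which is
  the one in the definition of \<open>thick_strip\<close>; so this one domain serves both
  signs.\<close>

lemma Re_exp_thick_strip:
  assumes z: "z \<in> thick_strip" and s: "s = 1 \<or> s = -1"
  shows "Re (exp (of_real (pi / 2 * s) * z)) > - 1"
proof -
  have "Re (exp (of_real (pi / 2 * s) * z)) = exp (pi / 2 * (s * Re z)) * cos (pi / 2 * (s * Im z))"
    by (simp add: Re_exp mult_ac)
  also have "cos (pi / 2 * (s * Im z)) = cos (pi / 2 * Im z)" using s by auto
  finally have eq: "Re (exp (of_real (pi / 2 * s) * z)) = exp (pi / 2 * (s * Re z)) * cos (pi / 2 * Im z)" .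
  show ?thesis
  proof (cases "cos (pi / 2 * Im z) \<ge> 0")
    case True
    have "0 \<le> exp (pi / 2 * (s * Re z)) * cos (pi / 2 * Im z)" using True by simp
    then show ?thesis unfolding eq by linarith
  next
    case False
    have "s * Re z \<le> \<bar>Re z\<bar>" using s by auto
    then have "exp (pi / 2 * (s * Re z)) \<le> exp (pi / 2 * \<bar>Re z\<bar>)" by simp
    then have "exp (pi / 2 * \<bar>Re z\<bar>) * cos (pi / 2 * Im z) \<le> exp (pi / 2 * (s * Re z)) * cos (pi / 2 * Im z)"
      using False by (intro mult_right_mono_neg) auto
    then show ?thesis using z unfolding eq thick_strip_def by simp
  qed
qed

lemma cos_ge_neg: "- (pi / 2) * \<delta> \<le> cos (pi / 2 * y)" if "\<bar>y\<bar> \<le> 1 + \<delta>" "0 \<le> \<delta>" "\<delta> \<le> 1"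
proof (cases "\<bar>y\<bar> \<le> 1")
  case True
  then have "\<bar>pi / 2 * y\<bar> \<le> pi / 2" by (simp add: abs_mult)
  then have "0 \<le> cos (pi / 2 * y)" by (intro cos_ge_zero) linarith+
  moreover have "- (pi / 2) * \<delta> \<le> 0" using that by simp
  ultimately show ?thesis by linarith
next
  case False
  define \<theta> where "\<theta> = pi / 2 * (\<bar>y\<bar> - 1)"
  have "cos (pi / 2 * y) = cos \<bar>pi / 2 * y\<bar>" by (rule cos_abs_real[symmetric])
  also have "\<bar>pi / 2 * y\<bar> = pi / 2 + \<theta>" by (simp add: \<theta>_def abs_mult right_diff_distrib diff_divide_distrib)
  also have "cos (pi / 2 + \<theta>) = - sin \<theta>" by (simp add: cos_add)
  finally have "cos (pi / 2 * y) = - sin \<theta>" .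
  moreover have "0 \<le> \<theta>" unfolding \<theta>_def using False by (intro mult_nonneg_nonneg) auto
  then have "sin \<theta> \<le> \<theta>" by (rule sin_x_le_x)
  moreover have "\<theta> \<le> pi / 2 * \<delta>" unfolding \<theta>_def using that by (intro mult_left_mono) auto
  ultimately show ?thesis by simp
qed

text \<open>Let r be the radius. On the disc the cosine is at least - pi r / 2, and exp (pi |Re w| /
  2) is at most 3 / (8 r), so their product stays above - 3 pi / 16 > - 1.\<close>

lemma cball_subset_thick_strip:
  assumes z: "z \<in> strip"
  shows "cball z (exp (- (pi / 2) * \<bar>Re z\<bar>) / 8) \<subseteq> thick_strip"
proof
  define r where "r = exp (- (pi / 2) * \<bar>Re z\<bar>) / 8"
  have "exp (- (pi / 2) * \<bar>Re z\<bar>) \<le> 1" by simp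
  then have r: "0 < r" "r \<le> 1 / 8" by (auto simp: r_def)
  fix w assume "w \<in> cball z (exp (- (pi / 2) * \<bar>Re z\<bar>) / 8)"
  then have d: "norm (w - z) \<le> r" by (simp add: r_def dist_norm norm_minus_commute)
  have "\<bar>Re w - Re z\<bar> \<le> r" "\<bar>Im w - Im z\<bar> \<le> r"
    using abs_Re_le_cmod[of "w - z"] abs_Im_le_cmod[of "w - z"] d by auto
  then have w: "\<bar>Re w\<bar> \<le> \<bar>Re z\<bar> + r" "\<bar>Im w\<bar> \<le> 1 + r" using z by (auto simp: strip_def)
  have c: "- (pi / 2) * r \<le> cos (pi / 2 * Im w)" by (rule cos_ge_neg) (use w r in auto)
  have "exp (pi / 2 * \<bar>Re w\<bar>) \<le> exp (pi / 2 * \<bar>Re z\<bar> + pi / 2 * r)"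
    unfolding distrib_left[symmetric] exp_le_cancel_iff by (intro mult_left_mono w(1)) simp
  also have "\<dots> = 1 / (8 * r) * exp (pi / 2 * r)"
  proof -
    have "8 * r = exp (- (pi / 2 * \<bar>Re z\<bar>))" by (simp add: r_def)
    then have "exp (pi / 2 * \<bar>Re z\<bar>) * (8 * r) = 1" by (simp only: exp_add[symmetric]) simp
    then have "exp (pi / 2 * \<bar>Re z\<bar>) = 1 / (8 * r)" using r by (subst nonzero_eq_divide_eq) auto
    then show ?thesis by (simp add: exp_add)
  qed
  also have "\<dots> \<le> 1 / (8 * r) * 3"
  proof (rule mult_left_mono)
    have "pi / 2 * r \<le> 2 * (1 / 8)" using r pi_less_4 by (intro mult_mono) auto
    then have "exp (pi / 2 * r) \<le> exp 1" by simp
    then show "exp (pi / 2 * r) \<le> 3" using exp_le by linarith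
  qed (use r in simp)
  finally have e: "exp (pi / 2 * \<bar>Re w\<bar>) \<le> 1 / (8 * r) * 3" .
  have "exp (pi / 2 * \<bar>Re w\<bar>) * (pi / 2 * r) \<le> (1 / (8 * r) * 3) * (pi / 2 * r)"
    using r by (intro mult_right_mono e) auto
  also have "\<dots> = 3 * pi / 16" using r by simp
  also have "\<dots> < 1" using pi_less_4 by simp
  finally have "- 1 < exp (pi / 2 * \<bar>Re w\<bar>) * (- (pi / 2) * r)" by simp
  also have "\<dots> \<le> exp (pi / 2 * \<bar>Re w\<bar>) * cos (pi / 2 * Im w)" using c by (intro mult_left_mono) auto
  finally show "w \<in> thick_strip" by (simp add: thick_strip_def)
qed

lemma strip_subset_thick_strip: "strip \<subseteq> thick_strip"
proof
  fix z assume "z \<in> strip"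
  then have "cball z (exp (- (pi / 2) * \<bar>Re z\<bar>) / 8) \<subseteq> thick_strip" by (rule cball_subset_thick_strip)
  then show "z \<in> thick_strip" by (rule subsetD) simp
qed

text \<open>Selects the exponential that sends l to exp (pi |l| / 2). The zero then lies far out in
  the half plane, and the factor is close to 1 at a fixed point.\<close>

definition blaschke_sign :: "real \<Rightarrow> real" where
  "blaschke_sign l = (if l \<ge> 0 then 1 else -1)"

text \<open>The Blaschke factor of the half plane Re w > - 1 in the variable w = exp (pi z / 2) or w
  = exp (- pi z / 2). Its zero is at w0 = exp (pi |l| / 2), and its pole at - 2 - w0, the mirror
  image of w0 in the line Re w = - 1.\<close>

definition strip_blaschke_factor :: "real \<Rightarrow> complex \<Rightarrow> complex" where
  "strip_blaschke_factor l z =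
     (of_real (exp (pi / 2 * \<bar>l\<bar>)) - exp (of_real (pi / 2 * blaschke_sign l) * z)) /
     (of_real (exp (pi / 2 * \<bar>l\<bar>)) + exp (of_real (pi / 2 * blaschke_sign l) * z) + 2)"

lemma blaschke_sign_cases: "blaschke_sign l = 1 \<or> blaschke_sign l = -1"
  by (simp add: blaschke_sign_def)

lemma strip_blaschke_denominator:
  assumes "z \<in> thick_strip"
  shows "of_real (exp (pi / 2 * \<bar>l\<bar>)) + exp (of_real (pi / 2 * blaschke_sign l) * z) + 2 \<noteq> 0"
proof
  assume "of_real (exp (pi / 2 * \<bar>l\<bar>)) + exp (of_real (pi / 2 * blaschke_sign l) * z) + 2 = 0"
  then have "Re (of_real (exp (pi / 2 * \<bar>l\<bar>)) + exp (of_real (pi / 2 * blaschke_sign l) * z) + 2) = 0"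
    by (metis zero_complex.simps(1))
  then have "exp (pi / 2 * \<bar>l\<bar>) + Re (exp (of_real (pi / 2 * blaschke_sign l) * z)) + 2 = 0"
    by (simp only: plus_complex.simps Re_complex_of_real complex_Re_numeral)
  moreover have "exp (pi / 2 * \<bar>l\<bar>) > 0" by simp
  ultimately show False using Re_exp_thick_strip[OF assms blaschke_sign_cases, of l] by linarith
qed

text \<open>To the right of the line Re w = - 1 the exponential is nearer to the zero than to its
  mirror image.\<close>

lemma norm_strip_blaschke_factor_le:
  assumes z: "z \<in> thick_strip"
  shows "norm (strip_blaschke_factor l z) \<le> 1"
proof -
  define E where "E = exp (of_real (pi / 2 * blaschke_sign l) * z)"
  define w where "w = exp (pi / 2 * \<bar>l\<bar>)"
  have w: "w > 0" by (simp add: w_def)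
  have E: "Re E > -1" unfolding E_def by (rule Re_exp_thick_strip[OF z blaschke_sign_cases])
  have "(w - Re E)\<^sup>2 \<le> (w + Re E + 2)\<^sup>2"
    using w E by (intro power2_le_iff_abs_le[THEN iffD2]) auto
  then have "norm (of_real w - E) \<le> norm (of_real w + E + 2)"
    unfolding cmod_def by (intro real_sqrt_le_mono) simp
  moreover have "of_real w + E + 2 \<noteq> 0"
    using strip_blaschke_denominator[OF z] by (simp add: w_def E_def)
  ultimately show ?thesis
    unfolding strip_blaschke_factor_def w_def[symmetric] E_def[symmetric]
    by (simp add: norm_divide divide_le_eq_1)
qed

lemma holomorphic_strip_blaschke_factor: "strip_blaschke_factor l holomorphic_on thick_strip"
  unfolding strip_blaschke_factor_def[abs_def]
  by (intro holomorphic_intros strip_blaschke_denominator)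

lemma strip_blaschke_factor_zero: "strip_blaschke_factor l (of_real l) = 0"
  by (auto simp: strip_blaschke_factor_def blaschke_sign_def exp_of_real[symmetric])

definition strip_blaschke :: "real set \<Rightarrow> complex \<Rightarrow> complex" where
  "strip_blaschke S z = exp (- z\<^sup>2) * (\<Prod>l\<in>S. strip_blaschke_factor l z)"

lemma holomorphic_strip_blaschke: "strip_blaschke S holomorphic_on thick_strip"
  unfolding strip_blaschke_def[abs_def]
  by (intro holomorphic_intros holomorphic_strip_blaschke_factor)

lemma norm_strip_blaschke_le:
  assumes "z \<in> thick_strip"
  shows "norm (strip_blaschke S z) \<le> exp ((Im z)\<^sup>2 - (Re z)\<^sup>2)"
proof -
  have "norm (strip_blaschke S z) = exp ((Im z)\<^sup>2 - (Re z)\<^sup>2) * (\<Prod>l\<in>S. norm (strip_blaschke_factor l z))"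
    by (simp add: strip_blaschke_def norm_mult norm_exp_eq_Re prod_norm power2_eq_square)
  also have "\<dots> \<le> exp ((Im z)\<^sup>2 - (Re z)\<^sup>2) * 1"
    using norm_strip_blaschke_factor_le[OF assms] by (intro mult_left_mono prod_le_1) auto
  finally show ?thesis by simp
qed

text \<open>Cauchy's estimate on the disc of radius exp (- pi |x| / 2) / 8 costs the factor 8^j exp
  (j pi |x| / 2), which the Gaussian absorbs. The Blaschke product is at most 1 there, which makes
  \<open>M\<close> independent of \<open>S\<close>.\<close>

lemma strip_blaschke_deriv_bound:
  obtains M where "\<And>S z. z \<in> strip \<Longrightarrow> norm ((deriv ^^ j) (strip_blaschke S) z) \<le> M / (1 + (Re z)\<^sup>2)"
proof -
  have half: "(1 / 2 :: real) > 0" by simp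
  obtain K where K: "K > 0" "\<And>x. (1 + \<bar>x\<bar>) ^ 2 * exp (real j * (pi / 2) * \<bar>x\<bar>) * exp (- (1 / 2) * x\<^sup>2) \<le> K"
    using polynomial_gauss_bounded[OF half, of 2 "real j * (pi / 2)"] by blast
  define M where "M = fact j * 8 ^ j * exp 5 * K"
  have "norm ((deriv ^^ j) (strip_blaschke S) z) \<le> M / (1 + (Re z)\<^sup>2)" if z: "z \<in> strip" for S z
  proof -
    define x where "x = Re z"
    define r where "r = exp (- (pi / 2) * \<bar>x\<bar>) / 8"
    have "exp (- (pi / 2) * \<bar>x\<bar>) \<le> 1" by simp
    then have "r \<le> 1" unfolding r_def by linarith
    moreover have "0 < r" by (simp add: r_def)
    ultimately have r: "0 < r" "r \<le> 1" by auto
    have sub: "cball z r \<subseteq> thick_strip" unfolding r_def x_def by (rule cball_subset_thick_strip[OF z])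
    have "norm ((deriv ^^ j) (strip_blaschke S) z) \<le> fact j * exp (5 - x\<^sup>2 / 2) / r ^ j"
    proof (rule Cauchy_inequality[OF _ _ r(1)])
      show "strip_blaschke S holomorphic_on ball z r"
        using sub by (intro holomorphic_on_subset[OF holomorphic_strip_blaschke]) auto
      show "continuous_on (cball z r) (strip_blaschke S)"
        using sub by (intro holomorphic_on_imp_continuous_on holomorphic_on_subset[OF holomorphic_strip_blaschke])
      fix w assume w: "norm (z - w) = r"
      then have "w \<in> thick_strip" using sub by (auto simp: dist_norm)
      then have "norm (strip_blaschke S w) \<le> exp ((Im w)\<^sup>2 - (Re w)\<^sup>2)" by (rule norm_strip_blaschke_le)
      \<comment> \<open>On the disc |Im w| \<le> 2, which gives 4, and (Re w)^2 \<ge> x^2 / 2 - 1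
        because |x - Re w| \<le> 1.\<close>
      also have "(Im w)\<^sup>2 - (Re w)\<^sup>2 \<le> 5 - x\<^sup>2 / 2"
      proof -
        have d: "\<bar>x - Re w\<bar> \<le> 1" "\<bar>Im z - Im w\<bar> \<le> 1"
          using abs_Re_le_cmod[of "z - w"] abs_Im_le_cmod[of "z - w"] w r by (auto simp: x_def)
        have "\<bar>Im w\<bar> \<le> 2" using d z by (auto simp: strip_def)
        then have i: "(Im w)\<^sup>2 \<le> 2\<^sup>2" by (intro power2_le_iff_abs_le[THEN iffD2]) auto
        have q: "(x - Re w)\<^sup>2 \<le> 1" using d(1) by (simp add: abs_square_le_1)
        have "0 \<le> (x - 2 * Re w)\<^sup>2" by simp
        then have "x\<^sup>2 / 2 \<le> (x - Re w)\<^sup>2 + (Re w)\<^sup>2"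
          by (simp add: power2_eq_square algebra_simps)
        then show ?thesis using q i by simp
      qed
      finally show "norm (strip_blaschke S w) \<le> exp (5 - x\<^sup>2 / 2)" by simp
    qed
    also have "\<dots> = fact j * 8 ^ j * exp 5 * (exp (real j * (pi / 2) * \<bar>x\<bar>) * exp (- (1 / 2) * x\<^sup>2))"
    proof -
      have "r ^ j = exp (- (real j * (pi / 2) * \<bar>x\<bar>)) / 8 ^ j"
        by (simp add: r_def power_divide exp_of_nat_mult[symmetric] mult_ac)
      then have "1 / r ^ j = 8 ^ j * exp (real j * (pi / 2) * \<bar>x\<bar>)"
        by (simp only: exp_minus) (simp add: divide_simps)
      moreover have "exp (5 - x\<^sup>2 / 2) = exp 5 * exp (- (1 / 2) * x\<^sup>2)" by (simp flip: exp_add)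
      moreover have "fact j * exp (5 - x\<^sup>2 / 2) / r ^ j = fact j * exp (5 - x\<^sup>2 / 2) * (1 / r ^ j)" by simp
      ultimately show ?thesis by (simp only: mult_ac)
    qed
    finally have "norm ((deriv ^^ j) (strip_blaschke S) z) * (1 + x\<^sup>2) \<le>
        fact j * 8 ^ j * exp 5 * (exp (real j * (pi / 2) * \<bar>x\<bar>) * exp (- (1 / 2) * x\<^sup>2)) * (1 + \<bar>x\<bar>)\<^sup>2"
      by (intro mult_mono one_plus_square_le) auto
    also have "\<dots> = fact j * 8 ^ j * exp 5 * ((1 + \<bar>x\<bar>) ^ 2 * exp (real j * (pi / 2) * \<bar>x\<bar>) * exp (- (1 / 2) * x\<^sup>2))"
      by (simp only: mult_ac)
    also have "\<dots> \<le> M" unfolding M_def by (intro mult_left_mono K(2)) auto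
    finally show ?thesis by (simp add: pos_le_divide_eq x_def)
  qed
  then show ?thesis by (rule that)
qed

text \<open>Shaped for the division by \<Phi>: the factor 1 + \<xi>^(2n) and the exponential meet
  the lower bound for \<Phi>, and 1 + \<xi>^2 leaves the quotient integrable. The constant is
  uniform in \<open>S\<close>.\<close>

lemma fourier_transform_strip_blaschke:
  fixes n :: nat
  obtains M where "M > 0" "\<And>S \<xi>. norm (fourier_transform (\<lambda>x. strip_blaschke S (of_real x)) \<xi>)
    \<le> M * exp (- 2 * pi * \<bar>\<xi>\<bar>) / ((1 + \<xi>\<^sup>2) * (1 + \<xi> ^ (2 * n)))"
proof -
  have "\<forall>j. \<exists>M. \<forall>S z. z \<in> strip \<longrightarrow> norm ((deriv ^^ j) (strip_blaschke S) z) \<le> M / (1 + (Re z)\<^sup>2)"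
    using strip_blaschke_deriv_bound by metis
  then obtain m where m: "\<And>j S z. z \<in> strip \<Longrightarrow> norm ((deriv ^^ j) (strip_blaschke S) z) \<le> m j / (1 + (Re z)\<^sup>2)"
    by metis
  have m0: "0 \<le> m j" for j
    using order_trans[OF norm_ge_zero m[of 0 j]] by (simp add: strip_def)
  \<comment> \<open>Expanding (1 + \<xi>^2) (1 + \<xi>^(2n)) calls for the derivatives of orders 0,
    2, 2n and 2n + 2; the 1 makes \<open>M\<close> positive.\<close>
  define M where "M = (m 0 + m 2 + m (2 * n) + m (2 * n + 2)) * pi + 1"
  have M: "M > 0" unfolding M_def using m0 by (intro add_nonneg_pos mult_nonneg_nonneg add_nonneg_nonneg) auto
  have "norm (fourier_transform (\<lambda>x. strip_blaschke S (of_real x)) \<xi>)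
    \<le> M * exp (- 2 * pi * \<bar>\<xi>\<bar>) / ((1 + \<xi>\<^sup>2) * (1 + \<xi> ^ (2 * n)))" for S \<xi>
  proof -
    define N where "N = norm (fourier_transform (\<lambda>x. strip_blaschke S (of_real x)) \<xi>)"
    have hol: "strip_blaschke S holomorphic_on strip"
      by (rule holomorphic_on_subset[OF holomorphic_strip_blaschke strip_subset_thick_strip])
    have b: "\<bar>\<xi>\<bar> ^ j * N \<le> exp (- 2 * pi * \<bar>\<xi>\<bar>) * (m j * pi)" for j
    proof -
      have "\<bar>\<xi>\<bar> \<le> 2 * pi * \<bar>\<xi>\<bar>" using pi_gt3 by (simp add: mult_le_cancel_right1)
      then have "\<bar>\<xi>\<bar> ^ j * N \<le> (2 * pi * \<bar>\<xi>\<bar>) ^ j * N"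
        by (intro mult_right_mono power_mono) (auto simp: N_def)
      also have "\<dots> \<le> exp (- 2 * pi * \<bar>\<xi>\<bar>) * (m j * pi)"
        unfolding N_def by (rule fourier_transform_strip_decay[OF hol m])
      finally show ?thesis .
    qed
    have "N * ((1 + \<xi>\<^sup>2) * (1 + \<xi> ^ (2 * n))) =
        \<bar>\<xi>\<bar> ^ 0 * N + \<bar>\<xi>\<bar> ^ 2 * N + \<bar>\<xi>\<bar> ^ (2 * n) * N + \<bar>\<xi>\<bar> ^ (2 * n + 2) * N"
      by (simp add: power_add algebra_simps power_even_abs power2_eq_square)
    also have "\<dots> \<le> exp (- 2 * pi * \<bar>\<xi>\<bar>) * (m 0 * pi) + exp (- 2 * pi * \<bar>\<xi>\<bar>) * (m 2 * pi) +
        exp (- 2 * pi * \<bar>\<xi>\<bar>) * (m (2 * n) * pi) + exp (- 2 * pi * \<bar>\<xi>\<bar>) * (m (2 * n + 2) * pi)"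
      by (intro add_mono b)
    also have "\<dots> = exp (- 2 * pi * \<bar>\<xi>\<bar>) * (M - 1)" by (simp add: M_def algebra_simps)
    also have "\<dots> \<le> M * exp (- 2 * pi * \<bar>\<xi>\<bar>)" by (simp add: algebra_simps)
    finally show ?thesis
      using one_plus_power_pos[of \<xi> n] by (simp add: N_def pos_le_divide_eq)
  qed
  with M show ?thesis by (rule that)
qed

text \<open>A finite set \<open>F0\<close> leaves at most 1/2 for the sum of 1 - q over any finite
  set outside it, and the Weierstrass inequality bounds the corresponding product below by 1/2. The
  factors in \<open>F0\<close> contribute at least their full product, as all factors are at most
  1.\<close>

lemma prod_bounded_below:
  fixes q :: "'a \<Rightarrow> real"
  assumes q: "\<And>l. l \<in> A \<Longrightarrow> 0 < q l" "\<And>l. l \<in> A \<Longrightarrow> q l \<le> 1"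
    and K: "\<And>F. finite F \<Longrightarrow> F \<subseteq> A \<Longrightarrow> (\<Sum>l\<in>F. 1 - q l) \<le> K"
  obtains c where "c > 0" "\<And>F. finite F \<Longrightarrow> F \<subseteq> A \<Longrightarrow> c \<le> (\<Prod>l\<in>F. q l)"
proof -
  let ?T = "{\<Sum>l\<in>F. 1 - q l |F. finite F \<and> F \<subseteq> A}"
  have bdd: "bdd_above ?T" using K by (auto intro!: bdd_aboveI[of _ K])
  have ne: "?T \<noteq> {}" by blast
  have "Sup ?T - 1 / 2 < Sup ?T" by simp
  then obtain F0 where F0: "finite F0" "F0 \<subseteq> A" "Sup ?T - 1 / 2 < (\<Sum>l\<in>F0. 1 - q l)"
    using less_cSup_iff[OF ne bdd] by auto
  define c where "c = (\<Prod>l\<in>F0. q l) * (1 / 2)"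
  have "c > 0" using q F0 by (auto simp: c_def intro!: mult_pos_pos prod_pos)
  moreover have "c \<le> (\<Prod>l\<in>F. q l)" if F: "finite F" "F \<subseteq> A" for F
  proof -
    have "(\<Sum>l\<in>F0 \<union> (F - F0). 1 - q l) \<le> Sup ?T"
      using F F0 by (intro cSup_upper bdd) auto
    moreover have "(\<Sum>l\<in>F0 \<union> (F - F0). 1 - q l) = (\<Sum>l\<in>F0. 1 - q l) + (\<Sum>l\<in>F - F0. 1 - q l)"
      using F F0 by (intro sum.union_disjoint) auto
    ultimately have s: "(\<Sum>l\<in>F - F0. 1 - q l) \<le> 1 / 2" using F0(3) by linarith
    have "1 - (\<Sum>l\<in>F - F0. 1 - q l) \<le> (\<Prod>l\<in>F - F0. 1 - (1 - q l))"
      using q F by (intro Weierstrass_prod_ineq) (auto simp: less_imp_le subset_iff)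
    then have p1: "1 / 2 \<le> (\<Prod>l\<in>F - F0. q l)" using s by simp
    have "(\<Prod>l\<in>F0. q l) = (\<Prod>l\<in>F0 - F. q l) * (\<Prod>l\<in>F0 \<inter> F. q l)"
      using F0 prod.Int_Diff[of F0 q F] by (simp add: mult.commute)
    also have "\<dots> \<le> 1 * (\<Prod>l\<in>F0 \<inter> F. q l)"
      using q F0 by (intro mult_right_mono prod_le_1 prod_nonneg) (auto simp: less_imp_le subset_iff)
    finally have "c \<le> (\<Prod>l\<in>F0 \<inter> F. q l) * (\<Prod>l\<in>F - F0. q l)"
      unfolding c_def using p1 q F F0 by (intro mult_mono prod_nonneg) (auto simp: less_imp_le subset_iff)
    also have "\<dots> = (\<Prod>l\<in>F. q l)"
      using F prod.Int_Diff[of F q F0] by (simp add: Int_commute)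
    finally show ?thesis .
  qed
  ultimately show ?thesis by (rule that)
qed

text \<open>At a fixed real x the factor for l has modulus 1 - O(exp (- pi |l| / 2)), and on the
  real line it vanishes only at l. So convergence of the sum keeps all finite products away from
  0.\<close>

lemma strip_blaschke_bounded_below:
  fixes \<Lambda> :: "real set"
  assumes x: "x \<notin> \<Lambda>"
    and R: "\<And>F. finite F \<Longrightarrow> F \<subseteq> \<Lambda> \<Longrightarrow> (\<Sum>l\<in>F. exp (- (pi / 2) * \<bar>l\<bar>)) \<le> R"
  obtains c where "c > 0" "\<And>S. finite S \<Longrightarrow> S \<subseteq> \<Lambda> \<Longrightarrow> c \<le> norm (strip_blaschke S (of_real x))"
proof -
  define q where "q l = norm (strip_blaschke_factor l (of_real x))" for l
  define E where "E l = exp (pi / 2 * blaschke_sign l * x)" for l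
  define w where "w l = exp (pi / 2 * \<bar>l\<bar>)" for l
  have thick: "complex_of_real x \<in> thick_strip"
    using strip_subset_thick_strip by (auto simp: strip_def)
  have E0: "E l > 0" "w l > 0" for l by (auto simp: E_def w_def)
  have factor: "strip_blaschke_factor l (of_real x) = of_real ((w l - E l) / (w l + E l + 2))" for l
  proof -
    have "exp (of_real (pi / 2 * blaschke_sign l) * complex_of_real x) = of_real (E l)"
      unfolding of_real_mult[symmetric] exp_of_real E_def ..
    then show ?thesis unfolding strip_blaschke_factor_def w_def[symmetric] by simp
  qed
  have q: "q l = \<bar>w l - E l\<bar> / (w l + E l + 2)" for l
    unfolding q_def factor norm_of_real abs_divide using E0[of l] by simp
  have q1: "q l \<le> 1" for l unfolding q_def by (rule norm_strip_blaschke_factor_le[OF thick])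
  have q0: "0 < q l" if "l \<in> \<Lambda>" for l
  proof -
    have "w l \<noteq> E l"
    proof
      assume "w l = E l"
      then have "\<bar>l\<bar> = blaschke_sign l * x" by (simp add: w_def E_def)
      then have "l = x" by (auto simp: blaschke_sign_def split: if_splits)
      then show False using that x by simp
    qed
    then show ?thesis unfolding q using E0[of l] by (intro divide_pos_pos) auto
  qed
  define T where "T = 2 * exp (pi / 2 * \<bar>x\<bar>) + 2"
  have dq: "1 - q l \<le> T * exp (- (pi / 2) * \<bar>l\<bar>)" for l
  proof -
    have "blaschke_sign l * x \<le> \<bar>x\<bar>" by (auto simp: blaschke_sign_def)
    then have "E l \<le> exp (pi / 2 * \<bar>x\<bar>)" by (simp add: E_def mult.assoc)
    then have ET: "2 * E l + 2 \<le> T" by (simp add: T_def)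
    have "1 - q l = (w l + E l + 2 - \<bar>w l - E l\<bar>) / (w l + E l + 2)"
      unfolding q using E0[of l] by (simp add: field_simps)
    also have "\<dots> \<le> (2 * E l + 2) / (w l + E l + 2)"
      using E0[of l] by (intro divide_right_mono) auto
    also have "\<dots> \<le> (2 * E l + 2) / w l"
      using E0[of l] by (intro divide_left_mono) auto
    also have "\<dots> \<le> T / w l" using ET E0[of l] by (intro divide_right_mono) auto
    also have "\<dots> = T * exp (- (pi / 2) * \<bar>l\<bar>)" by (simp add: w_def exp_minus field_simps)
    finally show ?thesis .
  qed
  have "T \<ge> 0" by (simp add: T_def)
  obtain c where c: "c > 0" "\<And>F. finite F \<Longrightarrow> F \<subseteq> \<Lambda> \<Longrightarrow> c \<le> (\<Prod>l\<in>F. q l)"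
  proof (rule prod_bounded_below[of \<Lambda> q "T * R"])
    fix F assume F: "finite F" "F \<subseteq> \<Lambda>"
    have "(\<Sum>l\<in>F. 1 - q l) \<le> (\<Sum>l\<in>F. T * exp (- (pi / 2) * \<bar>l\<bar>))" by (intro sum_mono dq)
    also have "\<dots> = T * (\<Sum>l\<in>F. exp (- (pi / 2) * \<bar>l\<bar>))" by (simp add: sum_distrib_left)
    also have "\<dots> \<le> T * R" using F \<open>T \<ge> 0\<close> by (intro mult_left_mono R)
    finally show "(\<Sum>l\<in>F. 1 - q l) \<le> T * R" .
  qed (use q0 q1 in auto)
  show ?thesis
  proof (rule that)
    show "0 < exp (- x\<^sup>2) * c" using c by simp
    fix S assume S: "finite S" "S \<subseteq> \<Lambda>"
    have "norm (strip_blaschke S (of_real x)) = exp (- x\<^sup>2) * (\<Prod>l\<in>S. q l)"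
      by (simp add: strip_blaschke_def norm_mult norm_exp_eq_Re prod_norm q_def power2_eq_square)
    then show "exp (- x\<^sup>2) * c \<le> norm (strip_blaschke S (of_real x))"
      using c(2)[OF S] by simp
  qed
qed

section \<open>Bounded functions orthogonal to finitely many translates\<close>

context exp_decay_window
begin

text \<open>As \<open>strip_blaschke S\<close> vanishes on \<open>S\<close>, integration against
  \<open>g\<close> kills the translates by points of \<open>S\<close>. The function \<open>g\<close>
  is found by dividing transforms: correlation with \<phi> becomes multiplication by the reflected
  \<Phi>. The bound \<open>G\<close> is independent of \<open>S\<close>.\<close>

lemma annihilator:
  obtains G where "G > 0" "\<And>S. \<exists>g. g \<in> borel_measurable borel \<and> (\<forall>t. norm (g t) \<le> G) \<and>
      (\<forall>x. (\<integral>t. \<phi> (t - x) * g t \<partial>lborel) = strip_blaschke S (of_real x))"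
proof -
  obtain M where M: "M > 0" "\<And>S \<xi>. norm (fourier_transform (\<lambda>x. strip_blaschke S (of_real x)) \<xi>)
    \<le> M * exp (- 2 * pi * \<bar>\<xi>\<bar>) / ((1 + \<xi>\<^sup>2) * (1 + \<xi> ^ (2 * n)))"
    by (rule fourier_transform_strip_blaschke) blast
  obtain M0 where M0: "\<And>S z. z \<in> strip \<Longrightarrow> norm ((deriv ^^ 0) (strip_blaschke S) z) \<le> M0 / (1 + (Re z)\<^sup>2)"
    by (rule strip_blaschke_deriv_bound[of 0]) blast
  define G where "G = M / A * pi"
  have "G > 0" using M pos by (simp add: G_def)
  moreover have "\<exists>g. g \<in> borel_measurable borel \<and> (\<forall>t. norm (g t) \<le> G) \<and>
      (\<forall>x. (\<integral>t. \<phi> (t - x) * g t \<partial>lborel) = strip_blaschke S (of_real x))" for S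
  proof -
    define f where "f x = strip_blaschke S (of_real x)" for x :: real
    have real: "complex_of_real x \<in> strip" for x by (simp add: strip_def)
    have bf: "norm (f x) \<le> M0 / (1 + x\<^sup>2)" for x using M0[OF real[of x], of S] by (simp add: f_def)
    have cf: "continuous_on UNIV f" unfolding f_def
      by (rule continuous_on_compose2[OF holomorphic_on_imp_continuous_on[OF holomorphic_strip_blaschke]])
         (use real strip_subset_thick_strip in \<open>auto intro!: continuous_intros\<close>)
    have if': "integrable lborel f" by (rule integrable_decay[OF borel_measurable_continuous_onI[OF cf] bf])
    note mF = borel_measurable_fourier_transform[OF if'] borel_measurable_fourier_transform[OF integrable_window]
    \<comment> \<open>The argument - \<xi> appears because the pairing involves no conjugation: the
      transform of t \<mapsto> \<phi>(- t - x) is a character times \<Phi>(- \<xi>).\<close>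
    define \<gamma> where "\<gamma> \<xi> = fourier_transform f \<xi> / \<Phi> (- \<xi>)" for \<xi>
    have [measurable]: "\<gamma> \<in> borel_measurable borel"
      unfolding \<gamma>_def using mF by measurable
    have Mf: "norm (fourier_transform f \<xi>) \<le> M * exp (- 2 * pi * \<bar>\<xi>\<bar>) / ((1 + \<xi>\<^sup>2) * (1 + \<xi> ^ (2 * n)))" for \<xi>
      unfolding f_def by (rule M(2))
    have bF: "norm (fourier_transform f \<xi>) \<le> M / (1 + \<xi>\<^sup>2)" for \<xi>
    proof -
      have "norm (fourier_transform f \<xi>) \<le> M * exp (- 2 * pi * \<bar>\<xi>\<bar>) / ((1 + \<xi>\<^sup>2) * (1 + \<xi> ^ (2 * n)))"
        by (rule Mf)
      also have "\<dots> \<le> M * 1 / ((1 + \<xi>\<^sup>2) * 1)"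
        using M(1) zero_le_even_power[of "2 * n" \<xi>] by (intro frac_le mult_left_mono) auto
      finally show ?thesis by simp
    qed
    have iF: "integrable lborel (fourier_transform f)"
      by (rule integrable_decay[OF mF(1) bF])
    have b\<gamma>: "norm (\<gamma> \<xi>) \<le> (M / A) / (1 + \<xi>\<^sup>2)" for \<xi>
    proof -
      let ?p = "1 + \<xi> ^ (2 * n)" and ?e = "exp (2 * pi * \<bar>\<xi>\<bar>)"
      have "norm (\<gamma> \<xi>) = norm (fourier_transform f \<xi>) * (1 / norm (\<Phi> (- \<xi>)))" by (simp add: \<gamma>_def norm_divide)
      also have "\<dots> \<le> M * exp (- 2 * pi * \<bar>\<xi>\<bar>) / ((1 + \<xi>\<^sup>2) * ?p) * (1 / A * (1 + (- \<xi>) ^ (2 * n)) * exp (2 * pi * \<bar>- \<xi>\<bar>))"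
        using M(1) one_plus_power_pos[of \<xi> n]
        by (intro mult_mono inverse_bound(2) Mf) (auto simp: less_imp_le)
      also have "\<dots> = (M / A) / (1 + \<xi>\<^sup>2) * (?p / ?p) * (exp (- 2 * pi * \<bar>\<xi>\<bar>) * ?e)"
        by simp
      also have "?p / ?p = 1" using one_plus_power_pos[of \<xi> n] by simp
      also have "exp (- 2 * pi * \<bar>\<xi>\<bar>) * ?e = 1" by (simp flip: exp_add)
      finally show ?thesis by simp
    qed
    have i\<gamma>: "integrable lborel \<gamma>" by (rule integrable_decay[OF _ b\<gamma>]) measurable
    define g where "g t = fourier_transform \<gamma> (- t)" for t
    have "g \<in> borel_measurable borel"
      unfolding g_def using borel_measurable_fourier_transform[OF i\<gamma>] by measurable
    moreover have "norm (g t) \<le> G" for t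
    proof -
      have "norm (g t) = norm (\<integral>s. \<gamma> s * cis (- 2 * pi * (s * - t)) \<partial>lborel)"
        by (simp only: g_def fourier_transform_cis)
      also have "\<dots> \<le> (M / A) * pi" by (rule integral_decay_le) (use b\<gamma> in \<open>simp add: norm_mult\<close>)
      finally show ?thesis by (simp add: G_def)
    qed
    moreover have "(\<integral>t. \<phi> (t - x) * g t \<partial>lborel) = strip_blaschke S (of_real x)" for x
    proof -
      have ip: "integrable lborel (\<lambda>t. \<phi> (0 - t - x))"
        using integrable_lborel_reflect[OF integrable_lborel_translate[OF integrable_window, of x], of 0] by simp
      have Fp: "fourier_transform (\<lambda>t. \<phi> (0 - t - x)) \<xi> = cis (2 * pi * (x * \<xi>)) * \<Phi> (- \<xi>)" for \<xi>
      proof -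
        have "fourier_transform (\<lambda>t. \<phi> (0 - t - x)) \<xi> =
            (\<integral>t. \<phi> (0 - t - x) * cis (- 2 * pi * ((0 - t) * (- \<xi>))) \<partial>lborel)"
          by (simp add: fourier_transform_cis)
        also have "\<dots> = fourier_transform (\<lambda>t. \<phi> (t - x)) (- \<xi>)"
          unfolding fourier_transform_cis
          by (rule integral_lborel_reflect[where f="\<lambda>t. \<phi> (t - x) * cis (- 2 * pi * (t * (- \<xi>)))"])
        finally show ?thesis by (simp add: fourier_transform_translate)
      qed
      have "(\<integral>t. \<phi> (t - x) * g t \<partial>lborel) = (\<integral>t. \<phi> (0 - t - x) * g (0 - t) \<partial>lborel)"
        by (rule integral_lborel_reflect[where f="\<lambda>t. \<phi> (t - x) * g t", symmetric])
      also have "\<dots> = (\<integral>t. \<phi> (0 - t - x) * fourier_transform \<gamma> t \<partial>lborel)" by (simp add: g_def)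
      also have "\<dots> = (\<integral>\<xi>. fourier_transform (\<lambda>t. \<phi> (0 - t - x)) \<xi> * \<gamma> \<xi> \<partial>lborel)"
        by (rule fourier_transform_multiplication[OF ip i\<gamma>, symmetric])
      also have "\<dots> = (\<integral>\<xi>. fourier_transform f \<xi> * cis (- 2 * pi * (\<xi> * (- x))) \<partial>lborel)"
        unfolding Fp using inverse_bound(1) by (simp add: \<gamma>_def mult_ac)
      also have "\<dots> = fourier_transform (fourier_transform f) (- x)"
        by (simp only: fourier_transform_cis[of "fourier_transform f"])
      also have "\<dots> = f x"
      proof (rule fourier_inversion_continuous[OF if' iF cf])
        show "norm (f y) \<le> M0" for y
        proof -
          have "0 \<le> M0" using order_trans[OF norm_ge_zero bf[of 0]] by simp
          then have "M0 / (1 + y\<^sup>2) \<le> M0" by (simp add: divide_le_eq mult_left_le_one_le algebra_simps)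
          then show ?thesis using bf[of y] by linarith
        qed
      qed
      finally show ?thesis by (simp add: f_def)
    qed
    ultimately show ?thesis by blast
  qed
  ultimately show ?thesis by (rule that)
qed

text \<open>The bounds \<open>c\<close> and \<open>G\<close> are the same for all finite
  \<open>S\<close>, so an approximation with error below c / G can be tested against the function
  belonging to its own finite set of translates. No limiting functional has to be formed.\<close>

lemma not_spans_if_convergent:
  assumes disc: "discrete_set \<Lambda>"
    and R: "\<And>F. finite F \<Longrightarrow> F \<subseteq> \<Lambda> \<Longrightarrow> (\<Sum>l\<in>F. exp (- (pi / 2) * \<bar>l\<bar>)) \<le> R"
  shows "\<not> spans_L1 \<Lambda> (\<lambda>l t. \<phi> (t - l))"
proof
  assume spans: "spans_L1 \<Lambda> (\<lambda>l t. \<phi> (t - l))"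
  have int: "integrable lborel (\<lambda>t. \<phi> (t - x))" for x
    by (rule integrable_lborel_translate[OF integrable_window])
  \<comment> \<open>A discrete set contains no interval, so there is a translate outside the family
    to test.\<close>
  have "finite (\<Lambda> \<inter> {-1..1})" using disc by (simp add: discrete_set_def)
  moreover have "infinite {-1..1::real}" by simp
  ultimately obtain x where x: "x \<notin> \<Lambda>" by (metis Int_absorb1 subsetI)
  obtain c where c: "c > 0" "\<And>S. finite S \<Longrightarrow> S \<subseteq> \<Lambda> \<Longrightarrow> c \<le> norm (strip_blaschke S (of_real x))"
    using strip_blaschke_bounded_below[OF x R] by blast
  obtain G where G: "G > 0" "\<And>S. \<exists>g. g \<in> borel_measurable borel \<and> (\<forall>t. norm (g t) \<le> G) \<and>
      (\<forall>x. (\<integral>t. \<phi> (t - x) * g t \<partial>lborel) = strip_blaschke S (of_real x))"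
    by (rule annihilator) blast
  have "c / G > 0" using c G by simp
  moreover have "(\<lambda>t. \<phi> (t - x)) \<in> L1_closed_span \<Lambda> (\<lambda>l t. \<phi> (t - l))"
    using spans int by (subst (asm) spans_L1_iff) auto
  ultimately obtain S a where S: "finite S" "S \<subseteq> \<Lambda>"
    and a: "(\<integral>t. norm (\<phi> (t - x) - (\<Sum>l\<in>S. a l * \<phi> (t - l))) \<partial>lborel) < c / G"
    unfolding L1_closed_span_def by blast
  obtain g where g [measurable]: "g \<in> borel_measurable borel" and gG: "\<And>t. norm (g t) \<le> G"
    and gx: "\<And>x. (\<integral>t. \<phi> (t - x) * g t \<partial>lborel) = strip_blaschke S (of_real x)"
    using G(2)[of S] by blast
  have ig: "integrable lborel (\<lambda>t. u t * g t)" if u: "integrable lborel u" for u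
  proof (rule Bochner_Integration.integrable_bound)
    show "integrable lborel (\<lambda>t. G * norm (u t))" using u by simp
    show "(\<lambda>t. u t * g t) \<in> borel_measurable lborel" using borel_measurable_integrable[OF u] by measurable
    show "AE t in lborel. norm (u t * g t) \<le> norm (G * norm (u t))"
      using gG G(1) by (intro AE_I2) (simp add: norm_mult abs_mult mult.commute mult_right_mono)
  qed
  let ?u = "\<lambda>t. \<phi> (t - x) - (\<Sum>l\<in>S. a l * \<phi> (t - l))"
  have iu: "integrable lborel ?u"
    by (intro Bochner_Integration.integrable_diff Bochner_Integration.integrable_sum integrable_mult_right int)
  have zero: "strip_blaschke S (of_real l) = 0" if "l \<in> S" for l
    using S(1) that strip_blaschke_factor_zero[of l] by (auto simp: strip_blaschke_def)
  have "(\<integral>t. ?u t * g t \<partial>lborel) = (\<integral>t. \<phi> (t - x) * g t - (\<Sum>l\<in>S. a l * (\<phi> (t - l) * g t)) \<partial>lborel)"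
    by (simp add: left_diff_distrib sum_distrib_right mult.assoc)
  also have "\<dots> = (\<integral>t. \<phi> (t - x) * g t \<partial>lborel) - (\<integral>t. (\<Sum>l\<in>S. a l * (\<phi> (t - l) * g t)) \<partial>lborel)"
    by (intro Bochner_Integration.integral_diff Bochner_Integration.integrable_sum integrable_mult_right ig int)
  also have "(\<integral>t. (\<Sum>l\<in>S. a l * (\<phi> (t - l) * g t)) \<partial>lborel) = (\<Sum>l\<in>S. \<integral>t. a l * (\<phi> (t - l) * g t) \<partial>lborel)"
    by (intro Bochner_Integration.integral_sum integrable_mult_right ig int)
  also have "\<dots> = 0" by (simp add: gx zero)
  finally have "strip_blaschke S (of_real x) = (\<integral>t. ?u t * g t \<partial>lborel)" by (simp add: gx)
  then have "norm (strip_blaschke S (of_real x)) \<le> (\<integral>t. norm (?u t * g t) \<partial>lborel)"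
    by (simp only: integral_norm_bound)
  also have "\<dots> \<le> (\<integral>t. G * norm (?u t) \<partial>lborel)"
  proof (rule integral_mono)
    show "integrable lborel (\<lambda>t. norm (?u t * g t))" using ig[OF iu] by (rule integrable_norm)
    show "integrable lborel (\<lambda>t. G * norm (?u t))" using iu by (intro integrable_mult_right integrable_norm)
    show "norm (?u t * g t) \<le> G * norm (?u t)" for t
      unfolding norm_mult using mult_right_mono[OF gG[of t] norm_ge_zero[of "?u t"]] by (simp only: mult.commute)
  qed
  also have "\<dots> = G * (\<integral>t. norm (?u t) \<partial>lborel)" by simp
  also have "\<dots> < G * (c / G)" using a G(1) by (rule mult_strict_left_mono)
  also have "\<dots> = c" using G(1) by simp
  also have "\<dots> \<le> norm (strip_blaschke S (of_real x))" by (rule c(2)[OF S])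
  finally show False by simp
qed

end

theorem theorem3p1:
  fixes n :: nat and \<phi> :: "real \<Rightarrow> complex" and \<Lambda> :: "real set"
  assumes L1: "L1 \<phi>"
    and ABC: "A > 0" "B > 0" "C > 0"
    and lower: "\<And>\<xi>::real. A * exp (- 2 * pi * \<bar>\<xi>\<bar>) / (1 + \<xi> ^ (2 * n))
                  \<le> norm (fourier_transform \<phi> \<xi>)"
    and upper: "\<And>\<xi>::real. norm (fourier_transform \<phi> \<xi>)
                  \<le> B * (1 + \<xi> ^ (2 * n)) * exp (- 2 * pi * \<bar>\<xi>\<bar>)"
    and deriv: "\<And>\<xi>::real. fourier_transform \<phi> differentiable (at \<xi>)"
    and deriv_bound: "\<And>\<xi>::real. norm (vector_derivative (fourier_transform \<phi>) (at \<xi>))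
                  \<le> C * (1 + \<xi> ^ (2 * n)) * exp (- 2 * pi * \<bar>\<xi>\<bar>)"
    and disc: "discrete_set \<Lambda>"
  shows "spans_L1 \<Lambda> (\<lambda>l t. \<phi> (t - l)) \<longleftrightarrow>
         (\<Sum>\<^sub>\<infinity>l\<in>\<Lambda>. ennreal (exp (- (pi / 2) * \<bar>l\<bar>))) = \<infinity>"
proof -
  interpret exp_decay_window \<phi> n A B C
    using assms by unfold_locales (auto simp: L1_def)
  have iff: "(\<Sum>\<^sub>\<infinity>l\<in>\<Lambda>. ennreal (exp (- (pi / 2) * \<bar>l\<bar>))) = \<infinity> \<longleftrightarrow>
      (\<forall>R. \<exists>F. finite F \<and> F \<subseteq> \<Lambda> \<and> R < (\<Sum>l\<in>F. exp (- (pi / 2) * \<bar>l\<bar>)))"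
    by (rule infsum_ennreal_eq_top_iff) simp
  show ?thesis
  proof
    assume spans: "spans_L1 \<Lambda> (\<lambda>l t. \<phi> (t - l))"
    show "(\<Sum>\<^sub>\<infinity>l\<in>\<Lambda>. ennreal (exp (- (pi / 2) * \<bar>l\<bar>))) = \<infinity>"
    proof (rule ccontr)
      assume "(\<Sum>\<^sub>\<infinity>l\<in>\<Lambda>. ennreal (exp (- (pi / 2) * \<bar>l\<bar>))) \<noteq> \<infinity>"
      then obtain R where "\<And>F. finite F \<Longrightarrow> F \<subseteq> \<Lambda> \<Longrightarrow> (\<Sum>l\<in>F. exp (- (pi / 2) * \<bar>l\<bar>)) \<le> R"
        unfolding iff by (meson not_le)
      from not_spans_if_convergent[OF disc this] spans show False by blast
    qed
  next
    assume "(\<Sum>\<^sub>\<infinity>l\<in>\<Lambda>. ennreal (exp (- (pi / 2) * \<bar>l\<bar>))) = \<infinity>"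
    then show "spans_L1 \<Lambda> (\<lambda>l t. \<phi> (t - l))"
      unfolding iff by (intro spans_if_divergent[OF disc]) blast
  qed
qed

end
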